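(* $$L(f,4)=\frac{\pi^{3}}{288}\left(3\,F^{1;3;2}_{1;2;1}\left[\left.\begin{matrix}\tfrac12\\ \tfrac32\end{matrix};\begin{matrix}1,1,1\\ \tfrac32,\tfrac32\end{matrix};\begin{matrix}\tfrac12,\tfrac12\\ 1\end{matrix}\right|1,1\right]+F^{1;3;2}_{1;2;1}\left[\left.\begin{matrix}\tfrac32\\ \tfrac52\end{matrix};\begin{matrix}1,1,1\\ \tfrac32,\tfrac32\end{matrix};\begin{matrix}\tfrac12,\tfrac12\\ 1\end{matrix}\right|1,1\right]\right).$$
   Context: For $|q|<1$ let $\theta_2(q)=\sum_{n\in\mathbb Z}q^{(n+1/2)^2}$, $\theta_3(q)=\sum_{n\in\mathbb Z}q^{n^2}$, $\theta_4(q)=\sum_{n\in\mathbb Z}(-1)^nq^{n^2}$. Let $f(q)=\frac1{16}\theta_2^4(q)\theta_4^2(q)=\sum_{n\ge0}a_nq^n$ and $L(f,s)=\sum_{n\ge1}a_nn^{-s}$ (analytically continued). $(a)_n=\Gamma(a+n)/\Gamma(a)$. The Kampé de Fériet function is $$F^{A;B;B'}_{C;D;D'}\left[\left.\begin{matrix}a_1,\dots,a_A\\ c_1,\dots,c_C\end{matrix};\begin{matrix}b_1,\dots,b_B\\ d_1,\dots,d_D\end{matrix};\begin{matrix}b'_1,\dots,b'_{B'}\\ d'_1,\dots,d'_{D'}\end{matrix}\right|x,y\right]=\sum_{m,n\ge0}\frac{\prod_i(a_i)_{m+n}\prod_i(b_i)_m\prod_i(b'_i)_n}{\prod_i(c_i)_{m+n}\prod_i(d_i)_m\prod_i(d'_i)_n}\frac{x^my^n}{m!\,n!},$$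 which converges absolutely at $x=y=1$ for the parameters used here. *)

theory Defs
  imports "HOL-Analysis.Analysis"
begin

definition theta2 :: "real \<Rightarrow> real" where
  "theta2 q = (\<Sum>\<^sub>\<infinity>n\<in>(UNIV::int set). q powr ((real_of_int n + 1/2)^2))"

definition theta3 :: "real \<Rightarrow> real" where
  "theta3 q = (\<Sum>\<^sub>\<infinity>n\<in>(UNIV::int set). q ^ (nat (n^2)))"

definition theta4 :: "real \<Rightarrow> real" where
  "theta4 q = (\<Sum>\<^sub>\<infinity>n\<in>(UNIV::int set). (-1) powi n * q ^ (nat (n^2)))"

definition fq :: "real \<Rightarrow> real" where
  "fq q = theta2 q ^ 4 * theta4 q ^ 2 / 16"

definition fcoeff :: "nat \<Rightarrow> real" where
  "fcoeff = (THE a. \<forall>q\<in>{0<..<1}. (\<lambda>n. a n * q ^ n) sums fq q)"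

text \<open>L(f,4) = sum_{n>=1} a_n n^(-4) (the Dirichlet series converges absolutely at s = 4).\<close>

definition Lf4 :: real where
  "Lf4 = (\<Sum>n. fcoeff (Suc n) / real (Suc n) ^ 4)"

text \<open>Kampe de Feriet function
  F^{A;B;B'}_{C;D;D'}[a_1..a_A / c_1..c_C ; b_1..b_B / d_1..d_D ; b'_1..b'_B' / d'_1..d'_D' | x, y].
  Argument order: as cs bs ds bs' ds' x y.\<close>

definition kampe_de_feriet ::
  "real list \<Rightarrow> real list \<Rightarrow> real list \<Rightarrow> real list \<Rightarrow> real list \<Rightarrow> real list \<Rightarrow> real \<Rightarrow> real \<Rightarrow> real" where
  "kampe_de_feriet as cs bs ds bs' ds' x y =
     (\<Sum>\<^sub>\<infinity>(m,n)\<in>(UNIV::(nat\<times>nat) set).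
        (prod_list (map (\<lambda>a. pochhammer a (m+n)) as)
          * prod_list (map (\<lambda>b. pochhammer b m) bs)
          * prod_list (map (\<lambda>b. pochhammer b n) bs'))
        / (prod_list (map (\<lambda>c. pochhammer c (m+n)) cs)
          * prod_list (map (\<lambda>d. pochhammer d m) ds)
          * prod_list (map (\<lambda>d. pochhammer d n) ds'))
        * x ^ m * y ^ n / (fact m * fact n))"

end

theory Submission
  imports Defs "HOL-Real_Asymp.Real_Asymp"
begin

text \<open>
  Both sides equal \<open>\<pi>\<^sup>2/12 \<beta>(4)\<close>, where \<open>\<beta>(4) = \<Sum> (-1)\<^sup>k/(2k+1)\<^sup>4\<close>.

  On the left, \<open>f\<close> is an Eisenstein series. With \<open>q = e\<^sup>-\<^sup>\<alpha>\<close> put \<open>F(z) = \<Sum> sech(\<alpha>n) z\<^sup>n\<close>. The partial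
  fractions of products of hyperbolic functions turn the coefficients of \<open>F\<^sup>2\<close> and \<open>F\<^sup>3\<close> into telescoping
  sums, which express \<open>F''(-1)\<close> through \<open>F(1)\<close> and \<open>F(-1)\<close>. The same computation shows that \<open>F(z) F(-z)\<close> is
  constant; hence \<open>F(\<plusminus>1)\<close> obey the recursions of the arithmetic-geometric mean and coincide with
  \<open>\<theta>\<^sub>3\<^sup>2\<close> and \<open>\<theta>\<^sub>4\<^sup>2\<close>. So \<open>f = \<Sum> (-1)\<^sup>d\<^sup>-\<^sup>1 d\<^sup>2 q\<^sup>d/(1+q\<^sup>2\<^sup>d)\<close>, and its Dirichlet series at 4
  factors as \<open>(\<Sum> (-1)\<^sup>d\<^sup>-\<^sup>1/d\<^sup>2) \<beta>(4)\<close>.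

  On the right, let \<open>W\<^sub>m\<close> and \<open>(\<pi>/2) V\<^sub>m\<close> be the integrals of \<open>sin\<^sup>2\<^sup>m\<^sup>+\<^sup>1\<close> and \<open>sin\<^sup>2\<^sup>m\<close> over \<open>[0, \<pi>/2]\<close>. The sum over
  \<open>n\<close> satisfies a first-order recursion in \<open>m\<close>, shared by \<open>(2/\<pi>) V\<^sub>m R\<^sub>m\<close> with
  \<open>R\<^sub>m = \<integral> sin\<^sup>2\<^sup>m t artanh(sin t) dt\<close>. The sum over \<open>m\<close> then becomes the integral of \<open>artanh(sin t)\<close>
  against \<open>\<Phi>(t)/sin t\<close>, where \<open>\<Phi>' = t/sin t\<close>, respectively against \<open>t\<^sup>2/2\<close>. The first integral is an Euler
  double sum, equal to \<open>6\<beta>(4) - \<pi>\<lambda>(3)\<close>; the second is \<open>\<pi>\<lambda>(3) - 2\<beta>(4)\<close> by Fourier expansion, where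
  \<open>\<lambda>(3) = \<Sum> 1/(2k+1)\<^sup>3\<close>.
\<close>

text \<open>The weight 3 in the theorem is what cancels \<open>lambda3\<close>, which each of the
  two double series still contains. No modularity enters on the left: squaring q = e^(-\<alpha>)
  doubles \<alpha>, the sech sums and the theta squares obey the same homogeneous positive recursion
  along this doubling, and agreement to leading order at q = 0 then forces equality. On the right
  the obstacle is the logarithmic singularity of artanh(sin t) at pi/2 together with the exchange of
  sums and integrals. Expansions with nonnegative terms are integrated by monotone convergence. Two
  series with signs remain: the Euler sum is treated as an absolutely convergent double family, the
  Fourier series is damped by a factor r < 1. The first integral becomes an Euler sum because in x =
  tan(t/2) both artanh(sin t) = 2 artanh x and the primitive of t/sin t are power series, and dx/dt
  = x/sin t.\<close>

lemma has_sum_product: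
  fixes f :: "'a \<Rightarrow> 'c :: {real_normed_field, banach}" and g :: "'b \<Rightarrow> 'c"
  assumes f: "(\<lambda>x. norm (f x)) summable_on A" and g: "(\<lambda>y. norm (g y)) summable_on B"
  shows "((\<lambda>(x, y). f x * g y) has_sum (infsum f A * infsum g B)) (A \<times> B)"
    and "(\<lambda>(x, y). norm (f x * g y)) summable_on (A \<times> B)"
proof -
  have *: "(\<lambda>p. norm (case p of (x, y) \<Rightarrow> f x * g y)) summable_on (A \<times> B)"
  proof (rule summable_on_SigmaI)
    show "((\<lambda>y. norm (case (x, y) of (x, y) \<Rightarrow> f x * g y)) has_sum
            norm (f x) * infsum (\<lambda>y. norm (g y)) B) B" for x
      using has_sum_cmult_right[OF has_sum_infsum[OF g], of "norm (f x)"] by (simp add: norm_mult)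
    show "(\<lambda>x. norm (f x) * infsum (\<lambda>y. norm (g y)) B) summable_on A"
      by (intro summable_on_cmult_left f)
  qed auto
  then show "(\<lambda>(x, y). norm (f x * g y)) summable_on (A \<times> B)"
    by (simp add: case_prod_unfold)
  show "((\<lambda>(x, y). f x * g y) has_sum (infsum f A * infsum g B)) (A \<times> B)"
  proof (rule has_sum_SigmaI)
    show "((\<lambda>y. case (x, y) of (x, y) \<Rightarrow> f x * g y) has_sum (f x * infsum g B)) B" for x
      using has_sum_cmult_right[OF has_sum_infsum[OF abs_summable_summable[OF g]], of "f x"] by simp
    show "((\<lambda>x. f x * infsum g B) has_sum infsum f A * infsum g B) A"
      by (intro has_sum_cmult_left has_sum_infsum abs_summable_summable[OF f])
    show "(\<lambda>(x, y). f x * g y) summable_on A \<times> B"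
      using * by (rule abs_summable_summable)
  qed
qed

text \<open>Joins two sources: a majorant gives unordered summability, an ordered evaluation
  (telescoping, possibly only conditionally convergent pieces) gives the value.\<close>

lemma has_sum_of_sums:
  fixes f :: "nat \<Rightarrow> 'a :: {comm_monoid_add, t2_space}"
  assumes "f summable_on UNIV" "f sums S"
  shows "(f has_sum S) UNIV"
proof -
  have *: "(f has_sum infsum f UNIV) UNIV"
    by (rule has_sum_infsum[OF assms(1)])
  with sums_unique2[OF assms(2) has_sum_imp_sums[OF *]] show ?thesis
    by simp
qed

section \<open>An alternating Euler double sum\<close>

definition odd_of :: "nat \<Rightarrow> real" where "odd_of k = 2 * real k + 1"

lemma odd_of_pos [simp]: "odd_of k > 0" "odd_of k \<ge> 1" "odd_of k \<noteq> 0" "odd_of k \<ge> 0"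
  by (auto simp: odd_of_def)

lemma odd_of_add_pos [simp]: "odd_of j + odd_of k > 0" "odd_of j + odd_of k \<noteq> 0"
  using odd_of_pos(1)[of j] odd_of_pos(1)[of k] by linarith+

lemma odd_of_eq_iff [simp]: "odd_of j = odd_of k \<longleftrightarrow> j = k"
  by (auto simp: odd_of_def)

lemma sums_shift_telescope:
  fixes u :: "nat \<Rightarrow> real"
  assumes "u \<longlonglongrightarrow> 0"
  shows "(\<lambda>j. u j - u (Suc (Suc j))) sums (u 0 + u 1)"
proof -
  have "(\<lambda>j. u j - u (Suc j)) sums (u 0 - 0)"
    by (rule telescope_sums'[OF assms])
  moreover have "(\<lambda>j. u (Suc j) - u (Suc (Suc j))) sums (u (Suc 0) - 0)"
    by (rule telescope_sums'[of "\<lambda>j. u (Suc j)"]) (use assms in \<open>simp add: filterlim_sequentially_Suc\<close>)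
  ultimately show ?thesis
    using sums_add by fastforce
qed

lemma tendsto_sign_over_linear:
  fixes \<epsilon> :: real
  assumes "\<epsilon> = 1 \<or> \<epsilon> = -1"
  shows "(\<lambda>j. \<epsilon> ^ j / (real j + c)) \<longlonglongrightarrow> 0"
proof -
  have "(\<lambda>j. 1 / (real j + c)) \<longlonglongrightarrow> 0"
    by real_asymp
  then have "(\<lambda>j. norm (\<epsilon> ^ j / (real j + c))) \<longlonglongrightarrow> 0"
    using assms by (auto simp: power_abs dest: tendsto_norm_zero)
  then show ?thesis by (rule tendsto_norm_zero_cancel)
qed

text \<open>Since \<open>1 / 0 = 0\<close>, the singular term is left out of the sum automatically.\<close>

lemma sums_sign_reflected_aux:
  fixes \<epsilon> :: real
  assumes \<epsilon>: "\<epsilon> = 1 \<or> \<epsilon> = -1"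
  shows "(\<lambda>j. \<epsilon> ^ j * (1 / (real j - real k) - \<epsilon> / (real j + real k + 1))) sums 0"
proof (induction k)
  case 0
  have "(\<lambda>j. \<epsilon> ^ j / real j - \<epsilon> ^ Suc j / real (Suc j)) sums (\<epsilon> ^ 0 / real 0 - 0)"
    by (rule telescope_sums') (use tendsto_sign_over_linear[OF \<epsilon>, of 0] in simp)
  then show ?case
    by (simp add: algebra_simps)
next
  case (Suc k)
  define u where "u j = \<epsilon> ^ j / (real j + (real k + 1))" for j
  define t where "t k j = \<epsilon> ^ j * (1 / (real j - real k) - \<epsilon> / (real j + real k + 1))" for k j
  have "\<epsilon> * \<epsilon> = 1"
    using \<epsilon> by auto
  \<comment> \<open>Raising both indices keeps \<open>j - k\<close>, so the singular fraction is
    unchanged; the change of the regular one telescopes with step two.\<close>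
  then have *: "t (Suc k) (Suc j) = \<epsilon> * t k j + (u j - u (Suc (Suc j)))" for j
    using \<epsilon> by (auto simp: t_def u_def algebra_simps)
  have "(\<lambda>j. \<epsilon> * t k j + (u j - u (Suc (Suc j)))) sums (\<epsilon> * 0 + (u 0 + u 1))"
    using Suc.IH unfolding t_def[symmetric]
    by (intro sums_add sums_mult sums_shift_telescope)
       (use tendsto_sign_over_linear[OF \<epsilon>, of "real k + 1"] in \<open>simp_all add: u_def\<close>)
  then have "(\<lambda>j. t (Suc k) (Suc j)) sums (u 0 + u 1)"
    by (simp add: *)
  then have "t (Suc k) sums (u 0 + u 1 + t (Suc k) 0)"
    by (rule sums_Suc)
  \<comment> \<open>The boundary terms of the telescope cancel the term \<open>j = 0\<close>, which
    the index shift left out.\<close>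
  moreover have "u 0 + u 1 + t (Suc k) 0 = 0"
    using divide_minus_left[of 1 "real k + 1"]
    by (simp add: u_def t_def add_ac flip: minus_add_distrib)
  ultimately show ?case by (simp add: t_def [abs_def])
qed

lemma sums_sign_reflected:
  fixes \<epsilon> :: real
  assumes "\<epsilon> = 1 \<or> \<epsilon> = -1"
  shows "(\<lambda>j. \<epsilon> ^ j * (1 / (odd_of j - odd_of k) - \<epsilon> / (odd_of j + odd_of k))) sums 0"
proof -
  have "1 / (odd_of j - odd_of k) = 1/2 * (1 / (real j - real k))"
       "\<epsilon> / (odd_of j + odd_of k) = 1/2 * (\<epsilon> / (real j + real k + 1))" for j
    using divide_divide_eq_right[of 1 2] by (auto simp: odd_of_def divide_simps)
  then have "(\<lambda>j. \<epsilon> ^ j * (1 / (odd_of j - odd_of k) - \<epsilon> / (odd_of j + odd_of k))) =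
        (\<lambda>j. 1/2 * (\<epsilon> ^ j * (1 / (real j - real k) - \<epsilon> / (real j + real k + 1))))"
    by (simp only: right_diff_distrib mult.left_commute)
  then show ?thesis
    using sums_mult[OF sums_sign_reflected_aux[OF assms], of "1/2"] by simp
qed

text \<open>The exponent is real because the majorant of the double series needs 3/2.\<close>

lemma summable_odd_of_powr: "a > 1 \<Longrightarrow> summable (\<lambda>k. 1 / odd_of k powr a)"
proof (rule summable_comparison_test')
  assume a: "a > 1"
  show "summable (\<lambda>k. 1 / real (k + 1) powr a)"
    using summable_ignore_initial_segment[of "\<lambda>k. 1 / real k powr a" 1] summable_real_powr_iff[of "-a"] a
    by (simp add: powr_minus_divide)
  show "norm (1 / odd_of k powr a) \<le> 1 / real (k + 1) powr a" for k
    using a by (auto simp: odd_of_def intro!: divide_left_mono powr_mono2)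
qed

lemma summable_odd_of_power: "n \<ge> 2 \<Longrightarrow> summable (\<lambda>k. 1 / odd_of k ^ n)"
  using summable_odd_of_powr[of "real n"] by (simp add: powr_realpow)

lemma summable_sign_odd_of_power: "n \<ge> 2 \<Longrightarrow> summable (\<lambda>k. (-1) ^ k / odd_of k ^ n)"
  by (rule summable_norm_cancel) (simp add: summable_odd_of_power norm_divide norm_power)

definition lambda3 :: real where "lambda3 = (\<Sum>k. 1 / odd_of k ^ 3)"
definition beta4 :: real where "beta4 = (\<Sum>k. (-1) ^ k / odd_of k ^ 4)"

lemma lambda3_sums: "(\<lambda>k. 1 / odd_of k ^ 3) sums lambda3"
  unfolding lambda3_def by (intro summable_sums summable_odd_of_power) simp

lemma beta4_sums: "(\<lambda>k. (-1) ^ k / odd_of k ^ 4) sums beta4"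
  unfolding beta4_def by (intro summable_sums summable_sign_odd_of_power) simp

lemma leibniz_sums: "(\<lambda>k. (-1) ^ k / odd_of k) sums (pi / 4)"
proof -
  have "summable (\<lambda>k. (-1) ^ k * (1 / real (k * 2 + 1)) * 1 ^ (k * 2 + 1) :: real)"
    using summable_arctan_series[of 1] by simp
  then have "summable (\<lambda>k. (-1) ^ k * 1 / real (k * 2 + 1))"
    by simp
  then show ?thesis
    unfolding pi_series by (auto dest!: summable_sums simp: odd_of_def algebra_simps)
qed

text \<open>By the arithmetic-geometric mean inequality the factor p + n dominates sqrt(p n); this
  splits the kernel into a product with summable exponent 3/2 in each index.\<close>

lemma odd_of_pair_bound:
  "1 / (odd_of p * odd_of n * (odd_of p + odd_of n)) \<le> (1 / odd_of p powr (3/2)) * (1 / odd_of n powr (3/2))"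
proof -
  have "odd_of p powr (1/2) * odd_of n powr (1/2) = sqrt (odd_of p * odd_of n)"
    by (simp add: powr_half_sqrt real_sqrt_mult)
  also have "\<dots> \<le> (odd_of p + odd_of n) / 2"
    by (rule arith_geo_mean_sqrt) auto
  also have "\<dots> \<le> odd_of p + odd_of n"
    using odd_of_add_pos(1)[of p n] by simp
  finally have *: "odd_of p powr (1/2) * odd_of n powr (1/2) \<le> odd_of p + odd_of n" .
  have "odd_of p powr (3/2) * odd_of n powr (3/2) =
     odd_of p * odd_of n * (odd_of p powr (1/2) * odd_of n powr (1/2))"
    using powr_add[of "odd_of p" 1 "1/2"] powr_add[of "odd_of n" 1 "1/2"] by simp
  also have "\<dots> \<le> odd_of p * odd_of n * (odd_of p + odd_of n)"
    using * by (intro mult_left_mono) auto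
  finally show ?thesis
    by (auto intro!: divide_left_mono mult_pos_pos)
qed

lemma summable_on_odd_of_pair:
  fixes F :: "nat \<times> nat \<Rightarrow> real"
  assumes "\<And>p n. \<bar>F (p, n)\<bar> \<le> C * (1 / (odd_of p * odd_of n * (odd_of p + odd_of n)))" "C \<ge> 0"
  shows "F summable_on UNIV \<times> UNIV"
proof -
  define a where "a k = 1 / odd_of k powr (3/2)" for k
  have "a summable_on UNIV"
    by (rule summable_nonneg_imp_summable_on)
       (use summable_odd_of_powr[of "3/2"] in \<open>auto simp: a_def [abs_def]\<close>)
  moreover have "norm (a x) = a x" for x
    by (simp add: a_def)
  ultimately have "(\<lambda>x. norm (a x)) summable_on UNIV"
    by simp
  from has_sum_product(1)[OF this this]
  have "(\<lambda>x. C * (case x of (x, y) \<Rightarrow> a x * a y)) summable_on (UNIV \<times> UNIV)"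
    by (intro summable_on_cmult_right) (auto dest: has_sum_imp_summable)
  then have "(\<lambda>x. norm (F x)) summable_on UNIV \<times> UNIV"
  proof (rule Infinite_Sum.abs_summable_on_comparison_test')
    fix x :: "nat \<times> nat"
    have "norm (F x) \<le> C * (1 / (odd_of (fst x) * odd_of (snd x) * (odd_of (fst x) + odd_of (snd x))))"
      using assms(1)[of "fst x" "snd x"] by simp
    also have "\<dots> \<le> C * (a (fst x) * a (snd x))"
      unfolding a_def by (intro mult_left_mono odd_of_pair_bound assms)
    finally show "norm (F x) \<le> C * (case x of (x, y) \<Rightarrow> a x * a y)"
      by (simp add: case_prod_unfold)
  qed
  then show ?thesis by (rule abs_summable_summable)
qed

text \<open>The kernel \<open>F (p, n)\<close> is summed by rows and by columns. Summing over \<open>p\<close> gives a closed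
  form, because the reflected alternating sum vanishes; summing over \<open>n\<close> reproduces the double
  series twice. As \<open>1 / 0 = 0\<close>, the diagonal contributes only its regular half.\<close>

lemma euler_double_sum:
  "((\<lambda>(p, n). (-1) ^ p / (odd_of p ^ 2 * odd_of n * (odd_of p + odd_of n)))
      has_sum (3/2 * beta4 - pi / 4 * lambda3)) (UNIV \<times> UNIV)"
proof -
  define F :: "nat \<times> nat \<Rightarrow> real" where
    "F = (\<lambda>(p, n). (-1) ^ p / (odd_of p ^ 2 * odd_of n) * (1 / (odd_of p + odd_of n) + 1 / (odd_of p - odd_of n)))"
  define G :: "nat \<times> nat \<Rightarrow> real" where
    "G = (\<lambda>(p, n). (-1) ^ p / (odd_of p ^ 2 * odd_of n * (odd_of p + odd_of n)))"
  have F_sum: "F summable_on UNIV \<times> UNIV"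
  proof (rule summable_on_odd_of_pair)
    fix p n
    show "\<bar>F (p, n)\<bar> \<le> 1 * (1 / (odd_of p * odd_of n * (odd_of p + odd_of n)))"
    proof (cases "p = n")
      case True
      have "odd_of n \<le> odd_of n ^ 2"
        by (rule self_le_power) auto
      then show ?thesis unfolding True
        by (simp add: F_def abs_mult power_abs field_simps power2_eq_square)
    next
      case False
      \<comment> \<open>Distinct odd numbers differ by at least 2, which absorbs the factor 2
        produced by adding the two fractions.\<close>
      have d: "\<bar>odd_of p - odd_of n\<bar> \<ge> 2"
        using False by (auto simp: odd_of_def)
      have "F (p, n) = (-1) ^ p * 2 / (odd_of p * odd_of n * (odd_of p + odd_of n) * (odd_of p - odd_of n))"
      proof -
        have "1 / (P ^ 2 * N) * (1 / (P + N) + 1 / (P - N)) = 2 / (P * N * (P + N) * (P - N))"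
          if "P \<noteq> 0" "N \<noteq> 0" "P + N \<noteq> 0" "P - N \<noteq> 0" for P N :: real
          using that by (simp add: divide_simps) algebra
        from this[of "odd_of p" "odd_of n"] False
        have "(-1) ^ p * (1 / (odd_of p ^ 2 * odd_of n) * (1 / (odd_of p + odd_of n) + 1 / (odd_of p - odd_of n)))
          = (-1) ^ p * (2 / (odd_of p * odd_of n * (odd_of p + odd_of n) * (odd_of p - odd_of n)))"
          by simp
        then show ?thesis
          by (simp add: F_def)
      qed
      then have "\<bar>F (p, n)\<bar> = 2 / (odd_of p * odd_of n * (odd_of p + odd_of n) * \<bar>odd_of p - odd_of n\<bar>)"
        by (simp add: abs_mult power_abs)
      also have "\<dots> \<le> 2 / (odd_of p * odd_of n * (odd_of p + odd_of n) * 2)"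
        using d by (intro divide_left_mono mult_left_mono) (auto intro!: mult_pos_pos)
      finally show ?thesis by simp
    qed
  qed auto
  have G_sum: "G summable_on UNIV \<times> UNIV"
  proof (rule summable_on_odd_of_pair)
    fix p n
    have "odd_of p \<le> odd_of p ^ 2"
      by (rule self_le_power) auto
    then show "\<bar>G (p, n)\<bar> \<le> 1 * (1 / (odd_of p * odd_of n * (odd_of p + odd_of n)))"
      by (auto simp: G_def power_abs abs_mult intro!: divide_left_mono mult_right_mono)
  qed auto
  define g where "g p = (\<Sum>\<^sub>\<infinity>n. G (p, n))" for p
  have g: "((\<lambda>n. G (p, n)) has_sum g p) UNIV" for p
    unfolding g_def using summable_on_SigmaD1[of "\<lambda>x y. G (x, y)" UNIV "\<lambda>_. UNIV" p] G_sum
    by (intro has_sum_infsum) simp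
  have g_has_sum: "(g has_sum infsum G (UNIV \<times> UNIV)) UNIV"
    using has_sum_SigmaD[OF has_sum_infsum[OF G_sum] g] by simp
  have row: "((\<lambda>n. F (p, n)) has_sum (2 * g p - (-1) ^ p / odd_of p ^ 4)) UNIV" for p
  proof -
    have s: "(\<lambda>n. F (p, n)) summable_on UNIV"
      using summable_on_SigmaD1[of "\<lambda>x y. F (x, y)" UNIV "\<lambda>_. UNIV" p] F_sum by simp
    define c :: real where "c = (-1) ^ p / odd_of p ^ 3"
    \<comment> \<open>Partial fractions in n: twice the wanted kernel minus a reflected sum that
      vanishes. The last summand repairs \<open>n = p\<close>, where the partial fractions break
      down.\<close>
    let ?f = "\<lambda>n. 2 * G (p, n) - c * (1 ^ n * (1 / (odd_of n - odd_of p) - 1 / (odd_of n + odd_of p)))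
            + (if n = p then - ((-1) ^ p / odd_of p ^ 4) else 0)"
    have "?f sums (2 * g p - c * 0 + (- ((-1) ^ p / odd_of p ^ 4)))"
      by (intro sums_add sums_diff sums_mult has_sum_imp_sums[OF g] sums_sign_reflected sums_single) simp
    also have "?f = (\<lambda>n. F (p, n))"
    proof
      fix n
      show "?f n = F (p, n)"
      proof (cases "n = p")
        case True
        then show ?thesis
          by (simp add: F_def G_def c_def divide_simps eval_nat_numeral)
      next
        case False
        have pf: "2 / (P ^ 2 * N * (P + N)) - 1 / P ^ 3 * (1 / (N - P) - 1 / (N + P))
            = 1 / (P ^ 2 * N) * (1 / (P + N) + 1 / (P - N))"
          if "P \<noteq> 0" "N \<noteq> 0" "P + N \<noteq> 0" "P - N \<noteq> 0" for P N :: real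
        proof -
          have "1 / (N - P) = - (1 / (P - N))"
            by (simp add: minus_divide_right)
          then have "1 / (N - P) - 1 / (N + P) = - (1 / (P - N) + 1 / (P + N))"
            by (simp add: add.commute)
          then have "2 / (P ^ 2 * N * (P + N)) - 1 / P ^ 3 * (1 / (N - P) - 1 / (N + P))
            = 2 / (P ^ 2 * N * (P + N)) + 1 / P ^ 3 * (1 / (P - N) + 1 / (P + N))"
            by (simp only: mult_minus_right diff_minus_eq_add)
          also have "\<dots> = 1 / (P ^ 2 * N) * (1 / (P + N) + 1 / (P - N))"
            using that by (simp add: divide_simps) algebra
          finally show ?thesis .
        qed
        have G2: "2 * G (p, n) = (-1) ^ p * (2 / (odd_of p ^ 2 * odd_of n * (odd_of p + odd_of n)))"
          by (simp add: G_def)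
        have c1: "c * (1 ^ n * (1 / (odd_of n - odd_of p) - 1 / (odd_of n + odd_of p))) =
            (-1) ^ p * (1 / odd_of p ^ 3 * (1 / (odd_of n - odd_of p) - 1 / (odd_of n + odd_of p)))"
          by (simp add: c_def)
        have "2 * G (p, n) - c * (1 ^ n * (1 / (odd_of n - odd_of p) - 1 / (odd_of n + odd_of p)))
            = (-1) ^ p * (1 / (odd_of p ^ 2 * odd_of n) * (1 / (odd_of p + odd_of n) + 1 / (odd_of p - odd_of n)))"
          unfolding G2 c1 right_diff_distrib[symmetric]
          by (rule arg_cong[OF pf]) (use False in auto)
        then show ?thesis
          using False by (simp add: F_def)
      qed
    qed
    finally show ?thesis
      by (intro has_sum_of_sums[OF s]) simp
  qed
  have col: "((\<lambda>p. F (p, n)) has_sum (2 * ((-1) ^ n / odd_of n ^ 4) - pi / 2 * (1 / odd_of n ^ 3))) UNIV" for n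
  proof -
    have "(\<lambda>(n, p). F (p, n)) summable_on UNIV \<times> UNIV"
      using F_sum by (subst (asm) summable_on_swap) simp
    then have s: "(\<lambda>p. F (p, n)) summable_on UNIV"
      using summable_on_SigmaD1[of "\<lambda>x y. F (y, x)" UNIV "\<lambda>_. UNIV" n] by simp
    define c :: real where "c = 1 / odd_of n ^ 3"
    \<comment> \<open>Partial fractions in p: the reflected alternating sum vanishes, the simple
      pole at 0 gives the Leibniz series, and the last summand repairs \<open>p = n\<close>.\<close>
    let ?f = "\<lambda>p. c * ((-1) ^ p * (1 / (odd_of p - odd_of n) - (-1) / (odd_of p + odd_of n)))
              - 2 * c * ((-1) ^ p / odd_of p) + (if p = n then 2 * ((-1) ^ n / odd_of n ^ 4) else 0)"
    have "?f sums (c * 0 - 2 * c * (pi / 4) + 2 * ((-1) ^ n / odd_of n ^ 4))"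
      by (intro sums_add sums_diff sums_mult sums_sign_reflected sums_single leibniz_sums) simp
    also have "?f = (\<lambda>p. F (p, n))"
    proof
      fix p
      show "?f p = F (p, n)"
      proof (cases "p = n")
        case True
        then show ?thesis
          by (simp add: F_def c_def field_simps eval_nat_numeral)
      next
        case False
        have "1 / N ^ 3 * (1 / (P - N) - (-1) / (P + N)) - 2 * (1 / N ^ 3) * (1 / P)
            = 1 / (P ^ 2 * N) * (1 / (P + N) + 1 / (P - N))"
          if "P \<noteq> 0" "N \<noteq> 0" "P + N \<noteq> 0" "P - N \<noteq> 0" for P N :: real
          using that by (simp add: divide_simps) algebra
        from this[of "odd_of p" "odd_of n"] False
        have "(-1) ^ p * (1 / odd_of n ^ 3 * (1 / (odd_of p - odd_of n) - (-1) / (odd_of p + odd_of n))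
                - 2 * (1 / odd_of n ^ 3) * (1 / odd_of p)) =
              (-1) ^ p * (1 / (odd_of p ^ 2 * odd_of n) * (1 / (odd_of p + odd_of n) + 1 / (odd_of p - odd_of n)))"
          by simp
        then show ?thesis
          using False by (simp add: F_def c_def algebra_simps)
      qed
    qed
    finally have "(\<lambda>p. F (p, n)) sums (2 * ((-1) ^ n / odd_of n ^ 4) - pi / 2 * (1 / odd_of n ^ 3))"
      by (simp add: c_def)
    then show ?thesis
      by (rule has_sum_of_sums[OF s])
  qed
  have "((\<lambda>p. 2 * g p - (-1) ^ p / odd_of p ^ 4) has_sum infsum F (UNIV \<times> UNIV)) UNIV"
    using has_sum_SigmaD[OF has_sum_infsum[OF F_sum] row] .
  then have "(\<lambda>p. 2 * g p - (-1) ^ p / odd_of p ^ 4) sums infsum F (UNIV \<times> UNIV)"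
    by (rule has_sum_imp_sums)
  moreover have "(\<lambda>p. 2 * g p - (-1) ^ p / odd_of p ^ 4) sums (2 * infsum G (UNIV \<times> UNIV) - beta4)"
    by (intro sums_diff sums_mult beta4_sums has_sum_imp_sums[OF g_has_sum])
  ultimately have rows: "infsum F (UNIV \<times> UNIV) = 2 * infsum G (UNIV \<times> UNIV) - beta4"
    by (rule sums_unique2)
  have "((\<lambda>(n, p). F (p, n)) has_sum infsum F (UNIV \<times> UNIV)) (UNIV \<times> UNIV)"
    using has_sum_infsum[OF F_sum] by (subst (asm) has_sum_swap)
  from has_sum_SigmaD[OF this, of "\<lambda>n. 2 * ((-1) ^ n / odd_of n ^ 4) - pi / 2 * (1 / odd_of n ^ 3)"]
  have "((\<lambda>n. 2 * ((-1) ^ n / odd_of n ^ 4) - pi / 2 * (1 / odd_of n ^ 3)) has_sum infsum F (UNIV \<times> UNIV)) UNIV"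
    using col by simp
  then have "(\<lambda>n. 2 * ((-1) ^ n / odd_of n ^ 4) - pi / 2 * (1 / odd_of n ^ 3)) sums infsum F (UNIV \<times> UNIV)"
    by (rule has_sum_imp_sums)
  moreover have "(\<lambda>n. 2 * ((-1) ^ n / odd_of n ^ 4) - pi / 2 * (1 / odd_of n ^ 3)) sums (2 * beta4 - pi / 2 * lambda3)"
    by (intro sums_diff sums_mult beta4_sums lambda3_sums)
  ultimately have "infsum F (UNIV \<times> UNIV) = 2 * beta4 - pi / 2 * lambda3"
    by (rule sums_unique2)
  with rows have "2 * infsum G (UNIV \<times> UNIV) - beta4 = 2 * beta4 - pi / 2 * lambda3"
    by simp
  then have "infsum G (UNIV \<times> UNIV) = 3/2 * beta4 - pi / 4 * lambda3"
    by simp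
  then show ?thesis
    using has_sum_infsum[OF G_sum] by (simp add: G_def)
qed

section \<open>Hyperbolic secant series over the integers\<close>

lemma has_sum_int_nonneg_neg:
  fixes f :: "int \<Rightarrow> 'a :: {topological_comm_monoid_add, t2_space}"
  assumes "((\<lambda>n. f (int n)) has_sum S) UNIV" and "((\<lambda>n. f (- int (Suc n))) has_sum T) UNIV"
  shows "(f has_sum (S + T)) UNIV"
proof -
  have "(f has_sum S) {0..}"
    using assms(1) by (subst (asm) has_sum_reindex_bij_witness[of _ nat int "{0..}" f]) auto
  moreover have "(f has_sum T) {..<0}"
    using assms(2)
    by (subst (asm) has_sum_reindex_bij_witness[of _ "\<lambda>k. nat (- k - 1)" "\<lambda>n. - int (Suc n)" "{..<0}" f]) auto
  ultimately have "(f has_sum (S + T)) ({0..} \<union> {..<0})"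
    by (intro has_sum_Un_disjoint) auto
  also have "{0..} \<union> {..<0} = (UNIV :: int set)"
    by auto
  finally show ?thesis .
qed

lemma summable_on_int_abs:
  fixes g :: "nat \<Rightarrow> real"
  assumes "summable g" "\<And>n. g n \<ge> 0"
  shows "(\<lambda>n::int. g (nat \<bar>n\<bar>)) summable_on UNIV"
proof -
  have "(\<lambda>n. g (nat \<bar>int n\<bar>)) summable_on UNIV"
    using assms by (simp add: summable_nonneg_imp_summable_on)
  moreover have "(\<lambda>n. g (nat \<bar>- int (Suc n)\<bar>)) summable_on UNIV"
  proof (rule summable_nonneg_imp_summable_on)
    have "nat \<bar>- int (Suc n)\<bar> = Suc n" for n
      by (simp only: abs_minus abs_of_nat nat_int)
    then show "summable (\<lambda>n. g (nat \<bar>- int (Suc n)\<bar>))"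
      using assms(1) by (simp only: summable_Suc_iff)
  qed (use assms in auto)
  ultimately show ?thesis
    unfolding summable_on_def using has_sum_int_nonneg_neg[of "\<lambda>n. g (nat \<bar>n\<bar>)"] by blast
qed

lemma summable_inverse_square_bigo:
  fixes f :: "nat \<Rightarrow> real"
  assumes "f \<in> O(\<lambda>n. 1 / real n ^ 2)"
  shows "summable f"
proof (rule summable_comparison_test_bigo[OF _ assms])
  show "summable (\<lambda>n. norm (1 / real n ^ 2))"
    using inverse_power_summable[of 2, where 'a = real] by (simp add: field_simps)
qed

lemma abs_summable_on_int_exp_bound:
  fixes f :: "int \<Rightarrow> 'a :: banach"
  assumes "\<alpha> > 0" "\<And>n. norm (f n) \<le> C * \<bar>real_of_int n\<bar> ^ k * exp (- \<alpha> * \<bar>real_of_int n\<bar>)"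
  shows "(\<lambda>n. norm (f n)) summable_on UNIV"
proof (rule Infinite_Sum.abs_summable_on_comparison_test')
  define g where "g n = real n ^ k * exp (- \<alpha> * real n)" for n
  have "summable g"
    unfolding g_def by (rule summable_inverse_square_bigo) (use assms(1) in real_asymp)
  then have "(\<lambda>n::int. g (nat \<bar>n\<bar>)) summable_on UNIV"
    by (rule summable_on_int_abs) (simp add: g_def)
  then have "(\<lambda>n::int. C * g (nat \<bar>n\<bar>)) summable_on UNIV"
    by (rule summable_on_cmult_right)
  then show "(\<lambda>n. C * \<bar>real_of_int n\<bar> ^ k * exp (- \<alpha> * \<bar>real_of_int n\<bar>)) summable_on UNIV"
    by (simp add: g_def mult.assoc)
qed (use assms in auto)

text \<open>Cauchy product of two Laurent series with the powers of z absorbed into \<open>f\<close>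
  and \<open>g\<close>. The coefficients are a separate parameter \<open>c\<close>, so that closed
  forms can be inserted.\<close>

lemma has_sum_int_convolution:
  fixes f g c :: "int \<Rightarrow> 'a :: {real_normed_field, banach}"
  assumes "(\<lambda>n. norm (f n)) summable_on UNIV" "(\<lambda>n. norm (g n)) summable_on UNIV"
    and "\<And>n. ((\<lambda>j. f j * g (n - j)) has_sum c n) UNIV"
  shows "(c has_sum (infsum f UNIV * infsum g UNIV)) UNIV"
proof -
  have "((\<lambda>(j, k). f j * g k) has_sum (infsum f UNIV * infsum g UNIV)) (UNIV \<times> UNIV)"
    using assms by (intro has_sum_product)
  also have "?this \<longleftrightarrow> ((\<lambda>(n, j). f j * g (n - j)) has_sum (infsum f UNIV * infsum g UNIV)) (UNIV \<times> UNIV)"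
    by (rule has_sum_reindex_bij_witness[of _ "\<lambda>(n, j). (j, n - j)" "\<lambda>(j, k). (j + k, j)"]) auto
  finally show ?thesis
    by (rule has_sum_SigmaD) (use assms(3) in auto)
qed

lemma has_sum_int_reflect:
  fixes f :: "int \<Rightarrow> 'a :: {comm_monoid_add, topological_space}"
  shows "((\<lambda>j. f (n - j)) has_sum S) UNIV \<longleftrightarrow> (f has_sum S) UNIV"
  by (rule has_sum_reindex_bij_witness[of _ "\<lambda>j. n - j" "\<lambda>j. n - j"]) auto

lemma has_sum_int_shift:
  fixes f :: "int \<Rightarrow> 'a :: {comm_monoid_add, topological_space}"
  shows "((\<lambda>j. f (j - n)) has_sum S) UNIV \<longleftrightarrow> (f has_sum S) UNIV"
  by (rule has_sum_reindex_bij_witness[of _ "\<lambda>j. j + n" "\<lambda>j. j - n"]) auto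

lemma has_sum_int_even:
  fixes f :: "int \<Rightarrow> 'a :: {topological_comm_monoid_add, t2_space}"
  assumes "(f has_sum S) UNIV" "\<And>n. odd n \<Longrightarrow> f n = 0"
  shows "((\<lambda>n. f (2 * n)) has_sum S) UNIV"
proof -
  have "(f has_sum S) {n. even n}"
    using assms(1) by (rule has_sum_cong_neutral[THEN iffD1, rotated 3]) (use assms(2) in auto)
  then show ?thesis
    by (subst has_sum_reindex_bij_witness[of _ "\<lambda>n. n div 2" "\<lambda>n. 2 * n" "{n. even n}" f]) auto
qed

lemma abs_powi_unit [simp]: "\<bar>(-1) powi n * x\<bar> = \<bar>x :: real\<bar>"
  by (simp add: power_int_minus_left)

definition sechs :: "real \<Rightarrow> int \<Rightarrow> real" where "sechs \<alpha> n = 1 / cosh (\<alpha> * of_int n)"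
definition tanhs :: "real \<Rightarrow> int \<Rightarrow> real" where "tanhs \<alpha> n = tanh (\<alpha> * of_int n)"

text \<open>The coefficients of the square of the sech series. At 0 the quotient degenerates; the
  sum of squares put there is never evaluated, it only has to be the same number in all
  identities.\<close>

definition cosech_coeff :: "real \<Rightarrow> int \<Rightarrow> real" where
  "cosech_coeff \<alpha> n =
    (if n = 0 then infsum (\<lambda>j. sechs \<alpha> j ^ 2) UNIV else 2 * of_int n / sinh (\<alpha> * of_int n))"

definition sech_sum :: "real \<Rightarrow> real" where
  "sech_sum \<alpha> = infsum (sechs \<alpha>) UNIV"

definition alt_sech_sum :: "real \<Rightarrow> real" where
  "alt_sech_sum \<alpha> = infsum (\<lambda>n. (-1) powi n * sechs \<alpha> n) UNIV"

lemma sechs_minus [simp]: "sechs \<alpha> (- n) = sechs \<alpha> n"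
  by (simp add: sechs_def)

lemma sechs_minus_commute: "sechs \<alpha> (n - j) = sechs \<alpha> (j - n)"
  using sechs_minus[of \<alpha> "j - n"] by simp

lemma sechs_pos [simp]: "sechs \<alpha> n > 0" "sechs \<alpha> n \<ge> 0"
  by (simp_all add: sechs_def)

lemma sechs_le_1: "sechs \<alpha> n \<le> 1"
  by (simp add: sechs_def cosh_real_ge_1)

lemma sechs_double: "sechs \<alpha> (2 * n) = sechs (2 * \<alpha>) n"
  by (simp add: sechs_def mult_ac)

lemma sechs_bound:
  assumes "\<alpha> > 0"
  shows "sechs \<alpha> n \<le> 2 * exp (- \<alpha> * \<bar>real_of_int n\<bar>)"
proof -
  have "exp (\<alpha> * \<bar>real_of_int n\<bar>) / 2 \<le> cosh (\<alpha> * \<bar>real_of_int n\<bar>)"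
    by (simp add: cosh_field_def)
  also have "\<dots> = cosh \<bar>\<alpha> * real_of_int n\<bar>"
    using assms by (simp add: abs_mult)
  also have "\<dots> = cosh (\<alpha> * real_of_int n)"
    by (rule cosh_real_abs)
  finally have *: "exp (\<alpha> * \<bar>real_of_int n\<bar>) / 2 \<le> cosh (\<alpha> * real_of_int n)" .
  have "1 / cosh (\<alpha> * real_of_int n) \<le> 1 / (exp (\<alpha> * \<bar>real_of_int n\<bar>) / 2)"
    by (rule divide_left_mono[OF *]) auto
  then show ?thesis
    by (simp add: sechs_def exp_minus field_simps)
qed

lemma abs_summable_on_sechs_bound:
  fixes f :: "int \<Rightarrow> 'a :: banach"
  assumes "\<alpha> > 0" "C \<ge> 0" "\<And>n. norm (f n) \<le> C * \<bar>real_of_int n\<bar> ^ k * sechs \<alpha> n"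
  shows "(\<lambda>n. norm (f n)) summable_on UNIV"
proof (rule abs_summable_on_int_exp_bound[OF assms(1)])
  fix n
  have "norm (f n) \<le> C * \<bar>real_of_int n\<bar> ^ k * sechs \<alpha> n"
    by (rule assms)
  also have "\<dots> \<le> C * \<bar>real_of_int n\<bar> ^ k * (2 * exp (- \<alpha> * \<bar>real_of_int n\<bar>))"
    using assms by (intro mult_left_mono sechs_bound) auto
  finally show "norm (f n) \<le> (2 * C) * \<bar>real_of_int n\<bar> ^ k * exp (- \<alpha> * \<bar>real_of_int n\<bar>)"
    by (simp add: mult_ac)
qed

text \<open>The source of all telescoping: a product of two shifted sech values is a difference of
  tanh values, up to a factor independent of j.\<close>

lemma tanhs_diff: "tanhs \<alpha> j - tanhs \<alpha> (j - n) = sinh (\<alpha> * of_int n) * (sechs \<alpha> j * sechs \<alpha> (j - n))"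
proof -
  have *: "tanh x - tanh y = sinh (x - y) / (cosh x * cosh y)" for x y :: real
    by (simp add: tanh_def sinh_diff field_simps)
  show ?thesis
    unfolding tanhs_def sechs_def * by (simp add: algebra_simps)
qed

lemma tanhs_diff_bound:
  "\<bar>tanhs \<alpha> j - tanhs \<alpha> (j - n)\<bar> \<le> \<bar>sinh (\<alpha> * of_int n)\<bar> * sechs \<alpha> j"
  unfolding tanhs_diff abs_mult
  by (intro mult_left_mono mult_left_le) (auto simp: sechs_le_1)

lemma tanhs_minus [simp]: "tanhs \<alpha> (- n) = - tanhs \<alpha> n"
  by (simp add: tanhs_def)

lemma tanhs_minus_commute: "tanhs \<alpha> (n - j) = - tanhs \<alpha> (j - n)"
  using tanhs_minus[of \<alpha> "j - n"] by simp

context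
  fixes \<alpha> :: real
  assumes alpha: "\<alpha> > 0"
begin

lemma summable_on_tanhs_diff:
  assumes "\<epsilon> = 1 \<or> \<epsilon> = (-1::real)"
  shows "(\<lambda>j. \<epsilon> powi j * (tanhs \<alpha> j - tanhs \<alpha> (j - n))) summable_on UNIV"
  by (rule abs_summable_summable, rule abs_summable_on_sechs_bound[OF alpha, of "\<bar>sinh (\<alpha> * of_int n)\<bar>" _ 0])
     (use tanhs_diff_bound[of \<alpha> _ n] assms in \<open>auto simp: abs_mult power_int_minus_left\<close>)

text \<open>The value 2 is the total rise of tanh from -1 to 1.\<close>

lemma has_sum_tanhs_diff_1: "((\<lambda>j. tanhs \<alpha> j - tanhs \<alpha> (j - 1)) has_sum 2) UNIV"
proof -
  define f where "f j = tanhs \<alpha> j - tanhs \<alpha> (j - 1)" for j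
  have nonneg: "f j \<ge> 0" for j
    unfolding f_def tanhs_diff using alpha by simp
  have lim: "(\<lambda>k. tanhs \<alpha> (int k + c)) \<longlonglongrightarrow> 1" for c
    unfolding tanhs_def using alpha by real_asymp
  have "(\<lambda>k. tanhs \<alpha> (int (Suc k) + -1) - tanhs \<alpha> (int k + -1)) sums (1 - tanhs \<alpha> (int 0 + -1))"
    by (rule telescope_sums[OF lim])
  then have "(\<lambda>k. f (int k)) sums (1 + tanhs \<alpha> 1)"
    by (simp add: f_def)
  then have 1: "((\<lambda>k. f (int k)) has_sum (1 + tanhs \<alpha> 1)) UNIV"
    by (intro sums_nonneg_imp_has_sum nonneg)
  have "(\<lambda>k. tanhs \<alpha> (int (Suc k) + 1) - tanhs \<alpha> (int k + 1)) sums (1 - tanhs \<alpha> (int 0 + 1))"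
    by (rule telescope_sums[OF lim])
  moreover have "f (- int (Suc k)) = tanhs \<alpha> (int (Suc k) + 1) - tanhs \<alpha> (int k + 1)" for k
    using tanhs_minus[of \<alpha> "int (Suc k)"] tanhs_minus[of \<alpha> "int (Suc k) + 1"]
    by (simp add: f_def algebra_simps)
  ultimately have "(\<lambda>k. f (- int (Suc k))) sums (1 - tanhs \<alpha> 1)"
    by simp
  then have "((\<lambda>k. f (- int (Suc k))) has_sum (1 - tanhs \<alpha> 1)) UNIV"
    by (intro sums_nonneg_imp_has_sum nonneg)
  from has_sum_int_nonneg_neg[OF 1 this] show ?thesis
    by (simp add: f_def)
qed

text \<open>The reflection j -> 1 - j preserves the tanh difference and reverses the sign
  \<open>(-1) powi j\<close>, so the sum equals its negative.\<close>

lemma has_sum_tanhs_diff_alternating_1: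
  "((\<lambda>j. (-1) powi j * (tanhs \<alpha> j - tanhs \<alpha> (j - 1))) has_sum 0) UNIV"
proof -
  define f where "f j = (-1) powi j * (tanhs \<alpha> j - tanhs \<alpha> (j - 1))" for j
  have "f summable_on UNIV"
    unfolding f_def by (rule summable_on_tanhs_diff) simp
  then have *: "(f has_sum infsum f UNIV) UNIV"
    by simp
  then have "((\<lambda>j. f (1 - j)) has_sum infsum f UNIV) UNIV"
    by (simp only: has_sum_int_reflect)
  moreover have "f (1 - j) = - f j" for j
    using tanhs_minus_commute[of \<alpha> 1 j]
    by (simp add: f_def power_int_minus_left algebra_simps)
  ultimately have "((\<lambda>j. - f j) has_sum infsum f UNIV) UNIV"
    by simp
  with has_sum_uminusI[OF *] have "infsum f UNIV = 0"
    using has_sum_unique by fastforce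
  with * show ?thesis
    by (simp add: f_def [abs_def])
qed

text \<open>A shift by n + 1 is a shift by n plus a translated shift by 1. The equivalence lets
  integer induction run upwards and downwards with one lemma.\<close>

lemma has_sum_tanhs_diff_step:
  fixes \<epsilon> :: real
  assumes "\<epsilon> = 1 \<or> \<epsilon> = -1"
    and "((\<lambda>j. \<epsilon> powi j * (tanhs \<alpha> j - tanhs \<alpha> (j - 1))) has_sum T) UNIV"
  shows "((\<lambda>j. \<epsilon> powi j * (tanhs \<alpha> j - tanhs \<alpha> (j - (n + 1)))) has_sum (S + \<epsilon> powi n * T)) UNIV \<longleftrightarrow>
         ((\<lambda>j. \<epsilon> powi j * (tanhs \<alpha> j - tanhs \<alpha> (j - n))) has_sum S) UNIV"
proof -
  have "((\<lambda>j. \<epsilon> powi (j - n) * (tanhs \<alpha> (j - n) - tanhs \<alpha> (j - n - 1))) has_sum T) UNIV"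
    using assms(2) by (subst has_sum_int_shift)
  then have "((\<lambda>j. \<epsilon> powi n * (\<epsilon> powi (j - n) * (tanhs \<alpha> (j - n) - tanhs \<alpha> (j - n - 1)))) has_sum (\<epsilon> powi n * T)) UNIV"
    by (rule has_sum_cmult_right)
  also have "(\<lambda>j. \<epsilon> powi n * (\<epsilon> powi (j - n) * (tanhs \<alpha> (j - n) - tanhs \<alpha> (j - n - 1))))
      = (\<lambda>j. \<epsilon> powi j * (tanhs \<alpha> (j - n) - tanhs \<alpha> (j - (n + 1))))"
    using assms(1) by (auto simp: power_int_diff algebra_simps)
  finally have *: "((\<lambda>j. \<epsilon> powi j * (tanhs \<alpha> (j - n) - tanhs \<alpha> (j - (n + 1)))) has_sum (\<epsilon> powi n * T)) UNIV" .
  show ?thesis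
  proof
    assume "((\<lambda>j. \<epsilon> powi j * (tanhs \<alpha> j - tanhs \<alpha> (j - (n + 1)))) has_sum (S + \<epsilon> powi n * T)) UNIV"
    from has_sum_add[OF this has_sum_uminusI[OF *]]
    show "((\<lambda>j. \<epsilon> powi j * (tanhs \<alpha> j - tanhs \<alpha> (j - n))) has_sum S) UNIV"
      by (simp add: algebra_simps)
  next
    assume "((\<lambda>j. \<epsilon> powi j * (tanhs \<alpha> j - tanhs \<alpha> (j - n))) has_sum S) UNIV"
    from has_sum_add[OF this *]
    show "((\<lambda>j. \<epsilon> powi j * (tanhs \<alpha> j - tanhs \<alpha> (j - (n + 1)))) has_sum (S + \<epsilon> powi n * T)) UNIV"
      by (simp add: algebra_simps)
  qed
qed

lemma has_sum_tanhs_diff: "((\<lambda>j. tanhs \<alpha> j - tanhs \<alpha> (j - n)) has_sum (2 * of_int n)) UNIV"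
proof (induction n rule: int_induct[of _ 0])
  case (step1 n)
  then show ?case
    using has_sum_tanhs_diff_step[of 1 2 n "2 * of_int n"] has_sum_tanhs_diff_1 by simp
next
  case (step2 n)
  then show ?case
    using has_sum_tanhs_diff_step[of 1 2 "n - 1" "2 * of_int (n - 1)"] has_sum_tanhs_diff_1 by simp
qed auto

lemma has_sum_tanhs_diff_alternating:
  "((\<lambda>j. (-1) powi j * (tanhs \<alpha> j - tanhs \<alpha> (j - n))) has_sum 0) UNIV"
proof (induction n rule: int_induct[of _ 0])
  case (step1 n)
  then show ?case
    using has_sum_tanhs_diff_step[of "-1" 0 n 0] has_sum_tanhs_diff_alternating_1 by simp
next
  case (step2 n)
  then show ?case
    using has_sum_tanhs_diff_step[of "-1" 0 "n - 1" 0] has_sum_tanhs_diff_alternating_1 by simp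
qed auto

text \<open>The reflection i -> n - i preserves the difference and turns the weight i into n - i;
  twice the sum is therefore n times the unweighted value 2n.\<close>

lemma has_sum_tanhs_diff_weighted:
  "((\<lambda>i. of_int i * (tanhs \<alpha> i - tanhs \<alpha> (i - n))) has_sum (of_int n ^ 2)) UNIV"
proof -
  define d where "d i = tanhs \<alpha> i - tanhs \<alpha> (i - n)" for i
  have "(\<lambda>i. of_int i * d i) summable_on UNIV"
  proof (rule abs_summable_summable,
      rule abs_summable_on_sechs_bound[OF alpha, of "\<bar>sinh (\<alpha> * of_int n)\<bar>" _ 1])
    show "norm (of_int i * d i) \<le> \<bar>sinh (\<alpha> * of_int n)\<bar> * \<bar>real_of_int i\<bar> ^ 1 * sechs \<alpha> i" for i
      using mult_left_mono[OF tanhs_diff_bound[of \<alpha> i n], of "\<bar>of_int i\<bar>"]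
      by (simp add: d_def abs_mult mult_ac)
  qed auto
  then have *: "((\<lambda>i. of_int i * d i) has_sum infsum (\<lambda>i. of_int i * d i) UNIV) UNIV"
    by simp
  then have "((\<lambda>i. of_int (n - i) * d (n - i)) has_sum infsum (\<lambda>i. of_int i * d i) UNIV) UNIV"
    by (subst has_sum_int_reflect)
  moreover have "of_int (n - i) * d (n - i) = of_int n * d i - of_int i * d i" for i
    using tanhs_minus_commute[of \<alpha> n i] by (simp add: d_def algebra_simps)
  ultimately have "((\<lambda>i. of_int n * d i - of_int i * d i) has_sum infsum (\<lambda>i. of_int i * d i) UNIV) UNIV"
    by simp
  from has_sum_add[OF this *]
  have "((\<lambda>i. of_int n * d i) has_sum (2 * infsum (\<lambda>i. of_int i * d i) UNIV)) UNIV"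
    by simp
  moreover have "((\<lambda>i. of_int n * d i) has_sum (of_int n * (2 * of_int n))) UNIV"
    unfolding d_def by (intro has_sum_cmult_right has_sum_tanhs_diff)
  ultimately have "2 * infsum (\<lambda>i. of_int i * d i) UNIV = of_int n * (2 * of_int n)"
    by (rule has_sum_unique)
  with * show ?thesis
    by (simp add: d_def power2_eq_square)
qed

lemma summable_on_sechs: "(\<lambda>n. norm (sechs \<alpha> n)) summable_on UNIV"
  by (rule abs_summable_on_sechs_bound[OF alpha, of 1 _ 0]) auto

lemma sechs_mult_eq_tanhs_diff:
  "n \<noteq> 0 \<Longrightarrow> sechs \<alpha> j * sechs \<alpha> (n - j) = (tanhs \<alpha> j - tanhs \<alpha> (j - n)) / sinh (\<alpha> * of_int n)"
  using alpha unfolding tanhs_diff sechs_minus_commute[of \<alpha> n j] by simp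

lemma has_sum_sechs_convolution:
  "((\<lambda>j. sechs \<alpha> j * sechs \<alpha> (n - j)) has_sum cosech_coeff \<alpha> n) UNIV"
proof (cases "n = 0")
  case True
  have "(\<lambda>j. sechs \<alpha> j ^ 2) summable_on UNIV"
    by (rule abs_summable_summable, rule abs_summable_on_sechs_bound[OF alpha, of 1 _ 0])
       (auto simp: power2_eq_square intro!: mult_left_le sechs_le_1)
  then show ?thesis
    using True by (simp add: cosech_coeff_def power2_eq_square)
next
  case False
  then show ?thesis
    using has_sum_divide_const[OF has_sum_tanhs_diff[of n], of "sinh (\<alpha> * of_int n)"]
    by (simp add: cosech_coeff_def sechs_mult_eq_tanhs_diff)
qed

lemma has_sum_sechs_convolution_alternating:
  assumes "n \<noteq> 0"
  shows "((\<lambda>j. (-1) powi j * (sechs \<alpha> j * sechs \<alpha> (n - j))) has_sum 0) UNIV"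
  using has_sum_divide_const[OF has_sum_tanhs_diff_alternating[of n], of "sinh (\<alpha> * of_int n)"] assms
  by (simp add: sechs_mult_eq_tanhs_diff)

text \<open>With x = \<alpha> i and y = \<alpha> n, dividing cosh x cosh y = cosh(x - y) + sinh x
  sinh y by the three other factors separates the pole in x from a tanh difference; sinh 2x = 2 sinh
  x cosh x explains the doubled index.\<close>

lemma cosech_coeff_mult_sechs:
  "cosech_coeff \<alpha> i * sechs \<alpha> (n - i) =
     sechs \<alpha> n * (cosech_coeff \<alpha> (2 * i) + 2 * (of_int i * (tanhs \<alpha> i - tanhs \<alpha> (i - n))))"
proof (cases "i = 0")
  case False
  define x y where "x = \<alpha> * of_int i" and "y = \<alpha> * of_int n"
  have sx: "sinh x \<noteq> 0"
    using False alpha by (simp add: x_def)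
  have c: "cosh y * cosh x = cosh (x - y) + sinh x * sinh y"
    by (simp add: cosh_diff)
  have "1 / (sinh x * cosh (x - y)) = (1 / cosh y) * (1 / (sinh x * cosh x) + sinh y / (cosh x * cosh (x - y)))"
    using sx c by (simp add: divide_simps)
  then have "2 * of_int i * (1 / (sinh x * cosh (x - y))) =
     2 * of_int i * ((1 / cosh y) * (1 / (sinh x * cosh x) + sinh y / (cosh x * cosh (x - y))))"
    by simp
  moreover have "cosech_coeff \<alpha> (2 * i) = 2 * of_int i * (1 / (sinh x * cosh x))"
  proof -
    have "cosech_coeff \<alpha> (2 * i) = 4 * of_int i / sinh (2 * x)"
      using False by (simp add: cosech_coeff_def x_def mult_ac)
    then show ?thesis
      using sx by (simp add: sinh_double)
  qed
  moreover have "cosech_coeff \<alpha> i * sechs \<alpha> (n - i) = 2 * of_int i * (1 / (sinh x * cosh (x - y)))"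
    using False unfolding sechs_minus_commute[of \<alpha> n i]
    by (simp add: cosech_coeff_def sechs_def x_def y_def algebra_simps)
  moreover have "tanhs \<alpha> i - tanhs \<alpha> (i - n) = sinh y / (cosh x * cosh (x - y))"
    unfolding tanhs_diff by (simp add: sechs_def x_def y_def algebra_simps)
  moreover have "sechs \<alpha> n = 1 / cosh y"
    by (simp add: sechs_def y_def)
  ultimately show ?thesis
    by (simp only: ring_distribs mult_ac)
qed simp

lemma summable_on_alt_sechs: "(\<lambda>n. (-1) powi n * sechs \<alpha> n) summable_on UNIV"
  by (rule abs_summable_summable) (use summable_on_sechs in simp)

lemma has_sum_cosech_coeff: "(cosech_coeff \<alpha> has_sum (sech_sum \<alpha> * sech_sum \<alpha>)) UNIV"
  unfolding sech_sum_def
  by (rule has_sum_int_convolution[OF summable_on_sechs summable_on_sechs has_sum_sechs_convolution])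

lemma has_sum_cosech_coeff_alternating:
  "((\<lambda>n. (-1) powi n * cosech_coeff \<alpha> n) has_sum (alt_sech_sum \<alpha> * alt_sech_sum \<alpha>)) UNIV"
  unfolding alt_sech_sum_def
proof (rule has_sum_int_convolution)
  fix n
  have "(-1) powi n * (sechs \<alpha> j * sechs \<alpha> (n - j))
     = (-1) powi j * sechs \<alpha> j * ((-1) powi (n - j) * sechs \<alpha> (n - j))" for j
    by (simp add: power_int_diff power_int_minus_left)
  with has_sum_cmult_right[OF has_sum_sechs_convolution[of n], of "(-1) powi n"]
  show "((\<lambda>j. (-1) powi j * sechs \<alpha> j * ((-1) powi (n - j) * sechs \<alpha> (n - j)))
      has_sum (-1) powi n * cosech_coeff \<alpha> n) UNIV"
    by simp
qed (use summable_on_sechs in simp_all)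

lemma has_sum_cosech_coeff_even:
  "((\<lambda>n. cosech_coeff \<alpha> (2 * n)) has_sum ((sech_sum \<alpha> ^ 2 + alt_sech_sum \<alpha> ^ 2) / 2)) UNIV"
proof -
  define f where "f n = (cosech_coeff \<alpha> n + (-1) powi n * cosech_coeff \<alpha> n) / 2" for n
  have "(f has_sum ((sech_sum \<alpha> * sech_sum \<alpha> + alt_sech_sum \<alpha> * alt_sech_sum \<alpha>) / 2)) UNIV"
    unfolding f_def
    by (intro has_sum_divide_const has_sum_add has_sum_cosech_coeff has_sum_cosech_coeff_alternating)
  then have "((\<lambda>n. f (2 * n)) has_sum ((sech_sum \<alpha> * sech_sum \<alpha> + alt_sech_sum \<alpha> * alt_sech_sum \<alpha>) / 2)) UNIV"
    by (rule has_sum_int_even) (simp add: f_def power_int_minus_left)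
  then show ?thesis
    by (simp add: f_def power2_eq_square power_int_minus_left)
qed

text \<open>Read as series this says F^3 = E F + 2 (z d/dz)^2 F with E = (F(1)^2 + F(-1)^2)/2, the
  differential equation of Jacobi's dn, of which F on the unit circle is a rescaling.\<close>

lemma has_sum_sechs_cube_convolution:
  "((\<lambda>i. cosech_coeff \<alpha> i * sechs \<alpha> (n - i)) has_sum
      (sechs \<alpha> n * ((sech_sum \<alpha> ^ 2 + alt_sech_sum \<alpha> ^ 2) / 2 + 2 * of_int n ^ 2))) UNIV"
  unfolding cosech_coeff_mult_sechs
  by (intro has_sum_cmult_right has_sum_add has_sum_cosech_coeff_even has_sum_tanhs_diff_weighted)

text \<open>The equation F^3 = E F + 2 (z d/dz)^2 F evaluated at z = -1 and solved for the second
  derivative.\<close>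

lemma has_sum_sechs_second_moment:
  "((\<lambda>n. (-1) powi n * of_int n ^ 2 * sechs \<alpha> n) has_sum
      (- alt_sech_sum \<alpha> * (sech_sum \<alpha> ^ 2 - alt_sech_sum \<alpha> ^ 2) / 4)) UNIV"
proof -
  define E where "E = (sech_sum \<alpha> ^ 2 + alt_sech_sum \<alpha> ^ 2) / 2"
  have cube: "((\<lambda>n. (-1) powi n * (sechs \<alpha> n * (E + 2 * of_int n ^ 2))) has_sum
      (infsum (\<lambda>n. (-1) powi n * cosech_coeff \<alpha> n) UNIV * alt_sech_sum \<alpha>)) UNIV"
    unfolding alt_sech_sum_def
  proof (rule has_sum_int_convolution)
    fix n
    have "(-1) powi n * (cosech_coeff \<alpha> j * sechs \<alpha> (n - j))
       = (-1) powi j * cosech_coeff \<alpha> j * ((-1) powi (n - j) * sechs \<alpha> (n - j))" for j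
      by (simp add: power_int_diff power_int_minus_left)
    with has_sum_cmult_right[OF has_sum_sechs_cube_convolution[of n], of "(-1) powi n"]
    show "((\<lambda>j. (-1) powi j * cosech_coeff \<alpha> j * ((-1) powi (n - j) * sechs \<alpha> (n - j)))
        has_sum (-1) powi n * (sechs \<alpha> n * (E + 2 * of_int n ^ 2))) UNIV"
      by (simp add: E_def)
    show "(\<lambda>n. norm ((-1) powi n * cosech_coeff \<alpha> n)) summable_on UNIV"
      using has_sum_cosech_coeff summable_on_iff_abs_summable_on_real[of "cosech_coeff \<alpha>" UNIV]
      by (auto dest: has_sum_imp_summable)
  qed (use summable_on_sechs in simp_all)
  have "infsum (\<lambda>n. (-1) powi n * cosech_coeff \<alpha> n) UNIV = alt_sech_sum \<alpha> ^ 2"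
    using infsumI[OF has_sum_cosech_coeff_alternating] by (simp add: power2_eq_square)
  with cube have "((\<lambda>n. (-1) powi n * (sechs \<alpha> n * (E + 2 * of_int n ^ 2))) has_sum (alt_sech_sum \<alpha> ^ 2 * alt_sech_sum \<alpha>)) UNIV"
    by simp
  moreover have "((\<lambda>n. (-1) powi n * sechs \<alpha> n * E) has_sum (alt_sech_sum \<alpha> * E)) UNIV"
    unfolding alt_sech_sum_def
    by (intro has_sum_cmult_left has_sum_infsum summable_on_alt_sechs)
  ultimately have "((\<lambda>n. (-1) powi n * (sechs \<alpha> n * (E + 2 * of_int n ^ 2)) + - ((-1) powi n * sechs \<alpha> n * E))
      has_sum (alt_sech_sum \<alpha> ^ 2 * alt_sech_sum \<alpha> + - (alt_sech_sum \<alpha> * E))) UNIV"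
    by (intro has_sum_add has_sum_uminusI)
  from has_sum_divide_const[OF this, of 2]
  have "((\<lambda>n. (-1) powi n * of_int n ^ 2 * sechs \<alpha> n) has_sum
      ((alt_sech_sum \<alpha> ^ 2 * alt_sech_sum \<alpha> + - (alt_sech_sum \<alpha> * E)) / 2)) UNIV"
    by (simp add: distrib_left mult_ac)
  moreover have "(alt_sech_sum \<alpha> ^ 2 * alt_sech_sum \<alpha> + - (alt_sech_sum \<alpha> * E)) / 2
      = - alt_sech_sum \<alpha> * (sech_sum \<alpha> ^ 2 - alt_sech_sum \<alpha> ^ 2) / 4"
    by (simp add: E_def field_simps power2_eq_square)
  ultimately show ?thesis
    by simp
qed

text \<open>In the product F(-1) F(1) every convolution coefficient except the constant one
  vanishes, so the product equals that coefficient.\<close>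

lemma has_sum_alternating_sechs_square:
  "((\<lambda>j. (-1) powi j * sechs \<alpha> j ^ 2) has_sum (sech_sum \<alpha> * alt_sech_sum \<alpha>)) UNIV"
proof -
  define S where "S = infsum (\<lambda>j. (-1) powi j * sechs \<alpha> j ^ 2) UNIV"
  have "(\<lambda>j. (-1) powi j * sechs \<alpha> j ^ 2) summable_on UNIV"
    by (rule abs_summable_summable, rule abs_summable_on_sechs_bound[OF alpha, of 1 _ 0])
       (auto simp: power2_eq_square intro!: mult_left_le sechs_le_1)
  then have S: "((\<lambda>j. (-1) powi j * sechs \<alpha> j ^ 2) has_sum S) UNIV"
    by (simp add: S_def)
  have "((\<lambda>n::int. if n = 0 then S else 0) has_sum (alt_sech_sum \<alpha> * sech_sum \<alpha>)) UNIV"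
    unfolding alt_sech_sum_def sech_sum_def
  proof (rule has_sum_int_convolution)
    fix n :: int
    show "((\<lambda>j. (-1) powi j * sechs \<alpha> j * sechs \<alpha> (n - j)) has_sum (if n = 0 then S else 0)) UNIV"
      using has_sum_sechs_convolution_alternating[of n] S by (auto simp: mult.assoc power2_eq_square)
  qed (use summable_on_sechs in simp_all)
  moreover have "((\<lambda>n::int. if n = 0 then S else 0) has_sum S) UNIV"
    by (rule has_sum_finite_neutralI[of "{0}"]) auto
  ultimately have "S = sech_sum \<alpha> * alt_sech_sum \<alpha>"
    using has_sum_unique by (metis mult.commute)
  with S show ?thesis by simp
qed

text \<open>The convolution of \<open>\<Sum> sech(\<alpha>n) z\<^sup>n\<close> and \<open>\<Sum> sech(\<alpha>n) (-z)\<^sup>n\<close> has only a constant term, so that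
  the product does not depend on \<open>z\<close>; it is evaluated at \<open>z = \<i>\<close> and compared with \<open>z = 1\<close>.\<close>

lemma sech_sum_mult_alt_sech_sum:
  "sech_sum \<alpha> * alt_sech_sum \<alpha> = (infsum (\<lambda>n. (-1) powi n * sechs (2 * \<alpha>) n) UNIV) ^ 2"
proof -
  define f where "f n = \<i> powi n * of_real (sechs \<alpha> n)" for n
  define g where "g n = (-\<i>) powi n * of_real (sechs \<alpha> n)" for n
  have nf: "(\<lambda>n. norm (f n)) summable_on UNIV" and ng: "(\<lambda>n. norm (g n)) summable_on UNIV"
    using summable_on_sechs by (simp_all add: f_def g_def norm_mult norm_power_int)
  have fg: "f (- n) = g n" for n
    by (simp add: f_def g_def power_int_minus flip: power_int_inverse)
  have S: "((\<lambda>j. (-1) powi j * complex_of_real (sechs \<alpha> j ^ 2)) has_sum of_real (sech_sum \<alpha> * alt_sech_sum \<alpha>)) UNIV"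
    using has_sum_of_real[OF has_sum_alternating_sechs_square, where 'a = complex] by simp
  have "((\<lambda>n::int. if n = 0 then of_real (sech_sum \<alpha> * alt_sech_sum \<alpha>) else 0) has_sum (infsum f UNIV * infsum g UNIV)) UNIV"
  proof (rule has_sum_int_convolution[OF nf ng])
    fix n :: int
    have eq: "f j * g (n - j) = (-\<i>) powi n * ((-1) powi j * of_real (sechs \<alpha> j * sechs \<alpha> (n - j)))" for j
    proof -
      have "\<i> powi j / (-\<i>) powi j = (-1) powi j"
        by (simp flip: power_int_divide_distrib)
      then show ?thesis
        by (simp add: f_def g_def power_int_diff field_simps)
    qed
    show "((\<lambda>j. f j * g (n - j)) has_sum (if n = 0 then of_real (sech_sum \<alpha> * alt_sech_sum \<alpha>) else 0)) UNIV"
    proof (cases "n = 0")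
      case True
      then show ?thesis
        unfolding eq using S by (simp add: power2_eq_square)
    next
      case False
      from has_sum_of_real[OF has_sum_sechs_convolution_alternating[OF this], where 'a = complex]
      have "((\<lambda>j. (-1) powi j * complex_of_real (sechs \<alpha> j * sechs \<alpha> (n - j))) has_sum 0) UNIV"
        by simp
      from has_sum_cmult_right[OF this, of "(-\<i>) powi n"] False show ?thesis
        unfolding eq by simp
    qed
  qed
  moreover have "((\<lambda>n::int. if n = 0 then complex_of_real (sech_sum \<alpha> * alt_sech_sum \<alpha>) else 0)
      has_sum of_real (sech_sum \<alpha> * alt_sech_sum \<alpha>)) UNIV"
    by (rule has_sum_finite_neutralI[of "{0}"]) auto
  ultimately have prod: "of_real (sech_sum \<alpha> * alt_sech_sum \<alpha>) = infsum f UNIV * infsum g UNIV"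
    using has_sum_unique by blast
  have f_sum: "(f has_sum infsum f UNIV) UNIV"
    by (rule has_sum_infsum[OF abs_summable_summable[OF nf]])
  then have "((\<lambda>n. f (0 - n)) has_sum infsum f UNIV) UNIV"
    by (simp only: has_sum_int_reflect)
  then have g_sum: "(g has_sum infsum f UNIV) UNIV"
    by (simp add: fg [abs_def])
  have ii: "\<i> powi (2 * n) = (-1) powi n" "(-\<i>) powi (2 * n) = (-1) powi n" for n
    by (simp_all add: power_int_mult)
  have odd: "(-\<i>) powi n = - (\<i> powi n)" if "odd n" for n
    using that by (simp add: power_int_minus_left)
  \<comment> \<open>By symmetry F(i) = F(-i); in their sum the odd exponents cancel, and the even
    ones give the alternating series at 2\<alpha>.\<close>
  have "((\<lambda>n. f (2 * n) + g (2 * n)) has_sum (infsum f UNIV + infsum f UNIV)) UNIV"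
    by (rule has_sum_int_even[OF has_sum_add[OF f_sum g_sum]]) (simp add: f_def g_def odd)
  from has_sum_divide_const[OF this, of 2]
  have "((\<lambda>n. (f (2 * n) + g (2 * n)) / 2) has_sum infsum f UNIV) UNIV"
    by simp
  moreover have "(f (2 * n) + g (2 * n)) / 2 = of_real ((-1) powi n * sechs (2 * \<alpha>) n)" for n
    by (simp add: f_def g_def ii sechs_double)
  ultimately have "((\<lambda>n. complex_of_real ((-1) powi n * sechs (2 * \<alpha>) n)) has_sum infsum f UNIV) UNIV"
    by simp
  moreover have "(\<lambda>n. (-1) powi n * sechs (2 * \<alpha>) n) summable_on UNIV"
    by (rule abs_summable_summable, rule abs_summable_on_sechs_bound[of "2 * \<alpha>" 1 _ 0]) (use alpha in auto)
  from has_sum_of_real[OF has_sum_infsum[OF this], where 'a = complex]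
  have "((\<lambda>n. complex_of_real ((-1) powi n * sechs (2 * \<alpha>) n)) has_sum
      of_real (infsum (\<lambda>n. (-1) powi n * sechs (2 * \<alpha>) n) UNIV)) UNIV" .
  ultimately have "infsum f UNIV = of_real (infsum (\<lambda>n. (-1) powi n * sechs (2 * \<alpha>) n) UNIV)"
    by (rule has_sum_unique)
  moreover have "infsum g UNIV = infsum f UNIV"
    using g_sum by (rule infsumI)
  ultimately have "complex_of_real (sech_sum \<alpha> * alt_sech_sum \<alpha>)
      = of_real ((infsum (\<lambda>n. (-1) powi n * sechs (2 * \<alpha>) n) UNIV) ^ 2)"
    using prod by (simp add: power2_eq_square)
  then show ?thesis
    by (simp only: of_real_eq_iff)
qed

text \<open>The arithmetic-mean half of the recursion; the preceding product formula is the
  geometric-mean half.\<close>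

lemma sech_sum_add_alt_sech_sum: "sech_sum \<alpha> + alt_sech_sum \<alpha> = 2 * infsum (sechs (2 * \<alpha>)) UNIV"
proof -
  define f where "f n = sechs \<alpha> n + (-1) powi n * sechs \<alpha> n" for n
  have "(f has_sum (sech_sum \<alpha> + alt_sech_sum \<alpha>)) UNIV"
    unfolding f_def sech_sum_def alt_sech_sum_def
    by (intro has_sum_add has_sum_infsum summable_on_alt_sechs abs_summable_summable[OF summable_on_sechs])
  then have "((\<lambda>n. f (2 * n)) has_sum (sech_sum \<alpha> + alt_sech_sum \<alpha>)) UNIV"
    by (rule has_sum_int_even) (simp add: f_def power_int_minus_left)
  then have "((\<lambda>n. 2 * sechs (2 * \<alpha>) n) has_sum (sech_sum \<alpha> + alt_sech_sum \<alpha>)) UNIV"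
    by (simp add: f_def power_int_minus_left sechs_double)
  then show ?thesis
    by (metis infsumI infsum_cmult_right')
qed

end

section \<open>Leading behaviour at q = 0 and uniqueness for the mean recursion\<close>

lemma int_sum_tail_bound:
  fixes f :: "int \<Rightarrow> real"
  assumes q: "0 < q" "q < 1" and C: "C \<ge> 0"
    and bound: "\<And>n. \<bar>n\<bar> \<ge> 2 \<Longrightarrow> \<bar>f n\<bar> \<le> C * q ^ nat \<bar>n\<bar>"
  shows "f summable_on UNIV"
    and "\<bar>infsum f UNIV - (f 0 + f 1 + f (-1))\<bar> \<le> 2 * C * (q ^ 2 / (1 - q))"
proof -
  define h where "h n = (if \<bar>n\<bar> < 2 then 0 else C * q ^ nat \<bar>n\<bar>)" for n :: int
  define g where "g n = (if \<bar>n\<bar> < 2 then 0 else f n)" for n :: int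
  define T where "T = C * (q ^ 2 / (1 - q))"
  have geo: "(\<lambda>n. q ^ n) sums (1 / (1 - q))"
    using q by (intro geometric_sums) auto
  have s2: "(\<lambda>n. C * (q ^ 2 * q ^ n)) sums T"
    using sums_mult[OF sums_mult[OF geo, of "q ^ 2"], of C] by (simp add: T_def)
  have 1: "((\<lambda>n. h (int n)) has_sum T) UNIV"
  proof (rule sums_nonneg_imp_has_sum)
    have "(\<lambda>n. h (int (n + 2))) sums T"
      using s2 by (simp add: h_def nat_add_distrib power_add power2_eq_square mult_ac)
    then have "(\<lambda>n. h (int n)) sums (T + (\<Sum>i<2. h (int i)))"
      using sums_iff_shift[of "\<lambda>n. h (int n)" 2 T] by blast
    then show "(\<lambda>n. h (int n)) sums T"
      by (simp add: h_def numeral_2_eq_2)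
  qed (use q C in \<open>auto simp: h_def\<close>)
  have 2: "((\<lambda>n. h (- int (Suc n))) has_sum T) UNIV"
  proof (rule sums_nonneg_imp_has_sum)
    have "h (- int (Suc (Suc n))) = C * (q ^ 2 * q ^ n)" for n
    proof -
      have "nat \<bar>- int (Suc (Suc n))\<bar> = Suc (Suc n)"
        by (simp only: abs_minus abs_of_nat nat_int)
      then show ?thesis
        by (simp add: h_def power2_eq_square)
    qed
    then have "(\<lambda>n. h (- int (Suc (Suc n)))) sums T"
      using s2 by simp
    then have "(\<lambda>n. h (- int (Suc n))) sums (T + h (- int (Suc 0)))"
      by (rule sums_Suc)
    then show "(\<lambda>n. h (- int (Suc n))) sums T"
      by (simp add: h_def)
  qed (use q C in \<open>auto simp: h_def\<close>)
  have h: "(h has_sum (T + T)) UNIV"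
    by (rule has_sum_int_nonneg_neg[OF 1 2])
  have gh: "norm (g n) \<le> h n" for n
    using bound[of n] by (auto simp: g_def h_def)
  have ng: "(\<lambda>n. norm (g n)) summable_on UNIV"
    by (rule Infinite_Sum.abs_summable_on_comparison_test'[OF has_sum_imp_summable[OF h] gh])
  have g: "(g has_sum infsum g UNIV) UNIV"
    by (rule has_sum_infsum[OF abs_summable_summable[OF ng]])
  have f0: "((\<lambda>n. if \<bar>n\<bar> < 2 then f n else 0) has_sum (f 0 + f 1 + f (-1))) UNIV"
  proof (rule has_sum_finite_neutralI[of "{0, 1, -1}"])
    show "(if \<bar>x\<bar> < 2 then f x else 0) = 0" if "x \<in> UNIV - {0, 1, -1}" for x :: int
      using that by auto
  qed auto
  have "((\<lambda>n. g n + (if \<bar>n\<bar> < 2 then f n else 0)) has_sum (infsum g UNIV + (f 0 + f 1 + f (-1)))) UNIV"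
    by (rule has_sum_add[OF g f0])
  also have "(\<lambda>n. g n + (if \<bar>n\<bar> < 2 then f n else 0)) = f"
    by (auto simp: g_def)
  finally have f: "(f has_sum (infsum g UNIV + (f 0 + f 1 + f (-1)))) UNIV" .
  then show "f summable_on UNIV"
    by (rule has_sum_imp_summable)
  have "norm (infsum g UNIV) \<le> infsum (\<lambda>n. norm (g n)) UNIV"
    by (rule norm_infsum_bound[OF ng])
  also have "\<dots> \<le> infsum h UNIV"
    by (rule infsum_mono[OF ng has_sum_imp_summable[OF h] gh])
  also have "infsum h UNIV = T + T"
    by (rule infsumI[OF h])
  finally show "\<bar>infsum f UNIV - (f 0 + f 1 + f (-1))\<bar> \<le> 2 * C * (q ^ 2 / (1 - q))"
    using infsumI[OF f] by (simp add: T_def)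
qed

text \<open>Outside the indices 0, 1, -1 the sum is O(X^2), which vanishes even after division by X.
  The exponent \<open>e\<close> is 1 only for \<open>sech_diff\<close>, which is of first order at
  0.\<close>

lemma tendsto_int_sum_tail:
  fixes X :: "nat \<Rightarrow> real" and f :: "nat \<Rightarrow> int \<Rightarrow> real"
  assumes X: "\<And>k. 0 < X k" "\<And>k. X k < 1" "X \<longlonglongrightarrow> 0" and C: "C \<ge> 0"
    and bound: "\<And>k n. \<bar>n\<bar> \<ge> 2 \<Longrightarrow> \<bar>f k n\<bar> \<le> C * X k ^ nat \<bar>n\<bar>"
    and main: "(\<lambda>k. (f k 0 + f k 1 + f k (-1)) / X k ^ e) \<longlonglongrightarrow> L" and e: "e \<le> 1"
  shows "(\<lambda>k. infsum (f k) UNIV / X k ^ e) \<longlonglongrightarrow> L"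
proof -
  let ?r = "\<lambda>k. (infsum (f k) UNIV - (f k 0 + f k 1 + f k (-1))) / X k ^ e"
  have "?r \<longlonglongrightarrow> 0"
  proof (rule Lim_null_comparison)
    have "(\<lambda>k. 2 * C * (X k ^ (2 - e) / (1 - X k))) \<longlonglongrightarrow> 2 * C * (0 ^ (2 - e) / (1 - 0))"
      by (intro tendsto_intros X) auto
    then show "(\<lambda>k. 2 * C * (X k ^ (2 - e) / (1 - X k))) \<longlonglongrightarrow> 0"
      using e by (simp add: power_0_left)
    show "\<forall>\<^sub>F k in sequentially. norm (?r k)
        \<le> 2 * C * (X k ^ (2 - e) / (1 - X k))"
    proof (intro always_eventually allI)
      fix k
      have "\<bar>infsum (f k) UNIV - (f k 0 + f k 1 + f k (-1))\<bar> \<le> 2 * C * (X k ^ 2 / (1 - X k))"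
        by (intro int_sum_tail_bound X C bound)
      then have "\<bar>infsum (f k) UNIV - (f k 0 + f k 1 + f k (-1))\<bar> / X k ^ e \<le> 2 * C * (X k ^ 2 / (1 - X k)) / X k ^ e"
        using X(1)[of k] by (intro divide_right_mono) auto
      also have "\<dots> = 2 * C * (X k ^ (2 - e) / (1 - X k))"
        using e X(1)[of k] power_diff[of "X k" e 2] by simp
      finally show "norm (?r k)
        \<le> 2 * C * (X k ^ (2 - e) / (1 - X k))"
        using X(1)[of k] by simp
    qed
  qed
  from tendsto_add[OF this main] show ?thesis
    by (simp add: diff_divide_distrib)
qed

lemma exp_ln_abs_int:
  assumes "0 < q"
  shows "exp (- (- ln q) * \<bar>real_of_int n\<bar>) = q ^ nat \<bar>n\<bar>"
proof -
  have "\<bar>real_of_int n\<bar> = real (nat \<bar>n\<bar>)"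
    by simp
  then show ?thesis
    using assms exp_of_nat2_mult[of "ln q" "nat \<bar>n\<bar>"] by (simp del: of_nat_nat)
qed

text \<open>The two-square theorem is obtained from the AGM-type recursions
  \<open>A(q) = A(q\<^sup>2) + D(q)\<close> and \<open>D(q)\<^sup>2 = 4 D(q\<^sup>2) A(q\<^sup>4)\<close>, which determine
  positive functions with prescribed behaviour at \<open>q = 0\<close>.\<close>

context
  fixes a d A D :: "nat \<Rightarrow> real"
  assumes pos: "\<And>k. a k > 0" "\<And>k. d k > 0" "\<And>k. A k > 0" "\<And>k. D k > 0"
    and rec: "\<And>k. a k = a (Suc k) + d k" "\<And>k. d k ^ 2 = 4 * d (Suc k) * a (Suc (Suc k))"
             "\<And>k. A k = A (Suc k) + D k" "\<And>k. D k ^ 2 = 4 * D (Suc k) * A (Suc (Suc k))"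
begin

text \<open>Both recursions are homogeneous with positive coefficients, so a comparison with factor
  \<open>c\<close> that holds far out is inherited by smaller indices. Index k refers to k + 1 and k
  + 2, hence the complete induction on \<open>N - k\<close>.\<close>

lemma agm_recursion_bound:
  assumes c: "c \<ge> 1" and ev: "\<And>k. k \<ge> N \<Longrightarrow> a k \<le> c * A k \<and> d k \<le> c * D k"
  shows "a k \<le> c * A k \<and> d k \<le> c * D k"
proof (induction "N - k" arbitrary: k rule: less_induct)
  case less
  show ?case
  proof (cases "k \<ge> N")
    case False
    then have 1: "a (Suc k) \<le> c * A (Suc k)" "d (Suc k) \<le> c * D (Suc k)" and 2: "a (Suc (Suc k)) \<le> c * A (Suc (Suc k))"
      using less.hyps[of "Suc k"] less.hyps[of "Suc (Suc k)"] by auto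
    have "d k ^ 2 = 4 * (d (Suc k) * a (Suc (Suc k)))"
      by (simp add: rec(2))
    also have "\<dots> \<le> 4 * ((c * D (Suc k)) * (c * A (Suc (Suc k))))"
      using 1 2 pos c by (intro mult_left_mono mult_mono) (auto simp: less_imp_le)
    also have "\<dots> = (c * D k) ^ 2"
      by (simp add: power_mult_distrib rec(4)) (simp add: power2_eq_square)
    finally have "d k \<le> c * D k"
      by (rule power2_le_imp_le) (use pos(4)[of k] c in \<open>simp add: less_imp_le\<close>)
    moreover have "a k \<le> c * A (Suc k) + c * D k"
      using 1 calculation rec(1)[of k] by linarith
    ultimately show ?thesis
      by (simp add: rec(3)[of k] distrib_left)
  qed (use ev in auto)
qed

text \<open>Each factor above 1 works eventually because the ratios tend to 1, hence everywhere;
  then the factor is lowered to 1.\<close>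

lemma agm_recursion_le:
  assumes lim: "(\<lambda>k. a k / A k) \<longlonglongrightarrow> 1" "(\<lambda>k. d k / D k) \<longlonglongrightarrow> 1"
  shows "a k \<le> A k \<and> d k \<le> D k"
proof -
  have *: "a k \<le> c * A k \<and> d k \<le> c * D k" if c: "c > 1" for c
  proof -
    have "\<forall>\<^sub>F k in sequentially. a k / A k < c \<and> d k / D k < c"
      by (intro eventually_conj order_tendstoD(2)[OF lim(1) c] order_tendstoD(2)[OF lim(2) c])
    then obtain N where N: "\<And>k. k \<ge> N \<Longrightarrow> a k / A k < c \<and> d k / D k < c"
      by (auto simp: eventually_at_top_linorder)
    show ?thesis
    proof (rule agm_recursion_bound)
      show "a k \<le> c * A k \<and> d k \<le> c * D k" if "k \<ge> N" for k
        using N[OF that] pos(3)[of k] pos(4)[of k] by (auto simp: divide_less_eq)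
    qed (use c in auto)
  qed
  have **: "x \<le> y" if "\<And>c. c > 1 \<Longrightarrow> x \<le> c * y" "y > 0" for x y :: real
  proof (rule field_le_mult_one_interval)
    fix z :: real assume z: "0 < z" "z < 1"
    then have "x \<le> (1 / z) * y"
      by (intro that(1)) auto
    with z show "z * x \<le> y"
      by (simp add: field_simps)
  qed
  show ?thesis
    by (intro conjI **[of "a k" "A k"] **[of "d k" "D k"] pos conjunct1[OF *] conjunct2[OF *])
qed

end

lemma agm_recursion_unique:
  fixes a d A D :: "nat \<Rightarrow> real"
  assumes pos: "\<And>k. a k > 0" "\<And>k. d k > 0" "\<And>k. A k > 0" "\<And>k. D k > 0"
    and rec: "\<And>k. a k = a (Suc k) + d k" "\<And>k. d k ^ 2 = 4 * d (Suc k) * a (Suc (Suc k))"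
             "\<And>k. A k = A (Suc k) + D k" "\<And>k. D k ^ 2 = 4 * D (Suc k) * A (Suc (Suc k))"
    and lim: "(\<lambda>k. a k / A k) \<longlonglongrightarrow> 1" "(\<lambda>k. d k / D k) \<longlonglongrightarrow> 1"
  shows "a k = A k" "d k = D k"
proof -
  have "(\<lambda>k. A k / a k) \<longlonglongrightarrow> 1" "(\<lambda>k. D k / d k) \<longlonglongrightarrow> 1"
    using tendsto_inverse[OF lim(1)] tendsto_inverse[OF lim(2)] by simp_all
  note 1 = agm_recursion_le[of A D a d, OF pos(3,4,1,2) rec(3,4,1,2) this]
  note 2 = agm_recursion_le[of a d A D, OF pos rec lim]
  from 1 2 show "a k = A k" "d k = D k"
    by (auto intro: antisym)
qed

section \<open>Theta functions\<close>

lemma half_sum_add_half_diff: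
  fixes m n :: int
  shows "even m = even n \<Longrightarrow> (m + n) div 2 + (m - n) div 2 = m"
    and "even m = even n \<Longrightarrow> (m + n) div 2 - (m - n) div 2 = n"
    and "even m \<noteq> even n \<Longrightarrow> (m - 1 + n) div 2 + (m - 1 - n) div 2 = m - 1"
    and "even m \<noteq> even n \<Longrightarrow> (m - 1 + n) div 2 - (m - 1 - n) div 2 = n"
  by presburger+

text \<open>Rotating the lattice by 45 degrees: the pairs with m + n even and those with m + n odd
  are each parametrised by all pairs (u, v).\<close>

lemma has_sum_int_pairs_parity:
  fixes F :: "int \<times> int \<Rightarrow> real"
  assumes "(F has_sum S) (UNIV \<times> UNIV)"
    and "((\<lambda>(u, v). F (u + v, u - v)) has_sum S0) (UNIV \<times> UNIV)"
    and "((\<lambda>(u, v). F (u + v + 1, u - v)) has_sum S1) (UNIV \<times> UNIV)"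
  shows "S = S0 + S1"
proof -
  have "(F has_sum S0) {(m, n). even (m + n)}"
    using assms(2)
    by (subst (asm) has_sum_reindex_bij_witness[of _ "\<lambda>(m, n). ((m + n) div 2, (m - n) div 2)"
          "\<lambda>(u, v). (u + v, u - v)" "{(m, n). even (m + n)}" F]) (auto simp: half_sum_add_half_diff)
  moreover have "(F has_sum S1) {(m, n). odd (m + n)}"
    using assms(3)
    by (subst (asm) has_sum_reindex_bij_witness[of _ "\<lambda>(m, n). ((m - 1 + n) div 2, (m - 1 - n) div 2)"
          "\<lambda>(u, v). (u + v + 1, u - v)" "{(m, n). odd (m + n)}" F]) (auto simp: half_sum_add_half_diff)
  ultimately have "(F has_sum (S0 + S1)) ({(m, n). even (m + n)} \<union> {(m, n). odd (m + n)})"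
    by (intro has_sum_Un_disjoint) auto
  also have "{(m, n). even (m + n)} \<union> {(m, n). odd (m + n)} = (UNIV \<times> UNIV :: (int \<times> int) set)"
    by auto
  finally show ?thesis
    using assms(1) has_sum_unique by blast
qed

definition theta_term :: "real \<Rightarrow> real \<Rightarrow> real" where
  "theta_term q x = q powr (x ^ 2)"

text \<open>The parallelogram law. The argument is real so that integers and half-integers are
  treated alike.\<close>

lemma theta_term_rotate:
  assumes "0 < q"
  shows "theta_term q (a + b) * theta_term q (a - b) = theta_term (q ^ 2) a * theta_term (q ^ 2) b"
proof -
  have "q powr ((a + b) ^ 2 + (a - b) ^ 2) = q powr (2 * a ^ 2 + 2 * b ^ 2)"
    by (simp add: power2_eq_square algebra_simps)
  moreover have "q ^ 2 = q powr 2"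
    using assms by simp
  ultimately show ?thesis
    by (simp only: theta_term_def powr_add powr_powr)
qed

lemma theta2_eq: "theta2 q = infsum (\<lambda>n. theta_term q (of_int n + 1/2)) UNIV"
  by (simp add: theta2_def theta_term_def)

lemma powr_of_int_square: "0 < (q :: real) \<Longrightarrow> q powr (of_int n ^ 2) = q ^ nat (n ^ 2)"
  by (simp add: powr_realpow [symmetric])

lemma theta3_eq: "0 < q \<Longrightarrow> theta3 q = infsum (\<lambda>n. theta_term q (of_int n)) UNIV"
  by (simp add: theta3_def theta_term_def powr_of_int_square)

lemma theta4_eq: "0 < q \<Longrightarrow> theta4 q = infsum (\<lambda>n. (-1) powi n * theta_term q (of_int n)) UNIV"
  by (simp add: theta4_def theta_term_def powr_of_int_square)

lemma theta_term_nonneg [simp]: "theta_term q x \<ge> 0"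
  by (simp add: theta_term_def)

lemma theta_term_bound:
  assumes q: "0 < q" "q < 1" and x: "x ^ 2 \<ge> \<bar>real_of_int n\<bar> + c"
  shows "theta_term q x \<le> q powr c * q ^ nat \<bar>n\<bar>"
proof -
  have "theta_term q x \<le> q powr (real (nat \<bar>n\<bar>) + c)"
    unfolding theta_term_def using q x by (intro powr_mono') auto
  then show ?thesis
    using q by (simp add: powr_add powr_realpow mult_ac del: of_nat_nat)
qed

lemma square_ge_abs_int: "(real_of_int n) ^ 2 \<ge> \<bar>real_of_int n\<bar>"
proof -
  have "\<bar>n\<bar> \<le> \<bar>n\<bar> ^ 2"
    using self_le_power[of "\<bar>n\<bar>" 2] by (cases "n = 0") auto
  then have "real_of_int \<bar>n\<bar> \<le> real_of_int (\<bar>n\<bar> ^ 2)"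
    by (simp only: of_int_le_iff)
  then show ?thesis by simp
qed

text \<open>The constant 3/4 is forced by equality at n = -1.\<close>

lemma square_half_ge_abs_int: "(real_of_int n + 1/2) ^ 2 \<ge> \<bar>real_of_int n\<bar> - 3/4"
proof (cases "n \<ge> 0")
  case True
  then show ?thesis
    using square_ge_abs_int[of n] by (simp add: power2_eq_square algebra_simps)
next
  case False
  have "(real_of_int n + 1) ^ 2 \<ge> 0"
    by simp
  with False show ?thesis
    by (simp add: power2_eq_square algebra_simps)
qed

lemma abs_summable_on_theta_int:
  assumes "0 < q" "q < 1"
  shows "(\<lambda>n::int. norm (theta_term q (of_int n))) summable_on UNIV"
    and "(\<lambda>n::int. norm ((-1) powi n * theta_term q (of_int n))) summable_on UNIV"
proof -
  have "theta_term q (of_int n) \<le> 1 * q ^ nat \<bar>n\<bar>" for n :: int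
    using theta_term_bound[OF assms, of n 0 "of_int n"] square_ge_abs_int[of n] assms by simp
  from int_sum_tail_bound(1)[OF assms, of 1 "\<lambda>n. theta_term q (of_int n)"] this
  show "(\<lambda>n::int. norm (theta_term q (of_int n))) summable_on UNIV"
    by simp
  then show "(\<lambda>n::int. norm ((-1) powi n * theta_term q (of_int n))) summable_on UNIV"
    by simp
qed

lemma abs_summable_on_theta_half_int:
  assumes "0 < q" "q < 1"
  shows "(\<lambda>n::int. norm (theta_term q (of_int n + 1/2))) summable_on UNIV"
proof -
  have "theta_term q (of_int n + 1/2) \<le> q powr (-3/4) * q ^ nat \<bar>n\<bar>" for n :: int
    using theta_term_bound[OF assms, of n "-3/4" "of_int n + 1/2"] square_half_ge_abs_int[of n] by simp
  with int_sum_tail_bound(1)[OF assms, of "q powr (-3/4)" "\<lambda>n. theta_term q (of_int n + 1/2)"]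
  show ?thesis
    by simp
qed

context
  fixes q :: real
  assumes q: "0 < q" "q < 1"
begin

lemma q2: "0 < q ^ 2" "q ^ 2 < 1"
  using q by (auto simp: power_less_one_iff)

lemma has_sum_theta3_square:
  "((\<lambda>(u, v). theta_term (q ^ 2) (of_int u) * theta_term (q ^ 2) (of_int v)) has_sum
      theta3 (q ^ 2) ^ 2) (UNIV \<times> UNIV)"
  using has_sum_product(1)[OF abs_summable_on_theta_int(1)[OF q2] abs_summable_on_theta_int(1)[OF q2]] q
  by (simp add: theta3_eq power2_eq_square)

lemma has_sum_theta2_square:
  "((\<lambda>(u, v). theta_term (q ^ 2) (of_int u + 1/2) * theta_term (q ^ 2) (of_int v + 1/2)) has_sum
      theta2 (q ^ 2) ^ 2) (UNIV \<times> UNIV)"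
  using has_sum_product(1)[OF abs_summable_on_theta_half_int[OF q2] abs_summable_on_theta_half_int[OF q2]]
  by (simp add: theta2_eq power2_eq_square)

text \<open>In the odd class both rotated coordinates become half-integers, which is where
  \<open>theta2\<close> enters.\<close>

lemma theta3_square: "theta3 q ^ 2 = theta3 (q ^ 2) ^ 2 + theta2 (q ^ 2) ^ 2"
proof (rule has_sum_int_pairs_parity)
  let ?F = "\<lambda>(m, n). theta_term q (of_int m) * theta_term q (of_int n)"
  show "(?F has_sum theta3 q ^ 2) (UNIV \<times> UNIV)"
    using has_sum_product(1)[OF abs_summable_on_theta_int(1)[OF q] abs_summable_on_theta_int(1)[OF q]] q
    by (simp add: theta3_eq power2_eq_square)
  show "((\<lambda>(u, v). ?F (u + v, u - v)) has_sum theta3 (q ^ 2) ^ 2) (UNIV \<times> UNIV)"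
    using has_sum_theta3_square q by (simp add: theta_term_rotate)
  have *: "theta_term q (of_int u + of_int v + 1) * theta_term q (of_int u - of_int v) =
        theta_term (q ^ 2) (of_int u + 1/2) * theta_term (q ^ 2) (of_int v + 1/2)" for u v :: int
    using theta_term_rotate[OF q(1), of "of_int u + 1/2" "of_int v + 1/2"] by (simp add: algebra_simps)
  show "((\<lambda>(u, v). ?F (u + v + 1, u - v)) has_sum theta2 (q ^ 2) ^ 2) (UNIV \<times> UNIV)"
    using has_sum_theta2_square by (simp add: *)
qed

text \<open>The combined sign depends only on the parity of m + n, so just the odd class is negated;
  the form \<open>+ -\<close> matches the parity rule.\<close>

lemma theta4_square: "theta4 q ^ 2 = theta3 (q ^ 2) ^ 2 + - (theta2 (q ^ 2) ^ 2)"
proof (rule has_sum_int_pairs_parity)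
  let ?F = "\<lambda>(m, n). ((-1) powi m * theta_term q (of_int m)) * ((-1) powi n * theta_term q (of_int n))"
  show "(?F has_sum theta4 q ^ 2) (UNIV \<times> UNIV)"
    using has_sum_product(1)[OF abs_summable_on_theta_int(2)[OF q] abs_summable_on_theta_int(2)[OF q]] q
    by (simp add: theta4_eq power2_eq_square)
  have "?F (u + v, u - v) = theta_term (q ^ 2) (of_int u) * theta_term (q ^ 2) (of_int v)" for u v
    using theta_term_rotate[OF q(1), of "of_int u" "of_int v"] by (auto simp: power_int_minus_left)
  then show "((\<lambda>(u, v). ?F (u + v, u - v)) has_sum theta3 (q ^ 2) ^ 2) (UNIV \<times> UNIV)"
    using has_sum_theta3_square by simp
  have "?F (u + v + 1, u - v) =
        - (theta_term (q ^ 2) (of_int u + 1/2) * theta_term (q ^ 2) (of_int v + 1/2))" for u v :: int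
    using theta_term_rotate[OF q(1), of "of_int u + 1/2" "of_int v + 1/2"]
    by (auto simp: power_int_minus_left algebra_simps)
  then show "((\<lambda>(u, v). ?F (u + v + 1, u - v)) has_sum - (theta2 (q ^ 2) ^ 2)) (UNIV \<times> UNIV)"
    using has_sum_uminusI[OF has_sum_theta2_square] by (simp add: case_prod_unfold)
qed

lemma theta2_square: "theta2 q ^ 2 = theta2 (q ^ 2) * theta3 (q ^ 2) + theta3 (q ^ 2) * theta2 (q ^ 2)"
proof (rule has_sum_int_pairs_parity)
  let ?F = "\<lambda>(m, n). theta_term q (of_int m + 1/2) * theta_term q (of_int n + 1/2)"
  show "(?F has_sum theta2 q ^ 2) (UNIV \<times> UNIV)"
    using has_sum_product(1)[OF abs_summable_on_theta_half_int[OF q] abs_summable_on_theta_half_int[OF q]]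
    by (simp add: theta2_eq power2_eq_square)
  have "?F (u + v, u - v) = theta_term (q ^ 2) (of_int u + 1/2) * theta_term (q ^ 2) (of_int v)" for u v
    using theta_term_rotate[OF q(1), of "of_int u + 1/2" "of_int v"] by (simp add: algebra_simps)
  moreover have "((\<lambda>(u, v). theta_term (q ^ 2) (of_int u + 1/2) * theta_term (q ^ 2) (of_int v)) has_sum
           theta2 (q ^ 2) * theta3 (q ^ 2)) (UNIV \<times> UNIV)"
    using has_sum_product(1)[OF abs_summable_on_theta_half_int[OF q2] abs_summable_on_theta_int(1)[OF q2]] q
    by (simp add: theta2_eq theta3_eq)
  ultimately show "((\<lambda>(u, v). ?F (u + v, u - v)) has_sum theta2 (q ^ 2) * theta3 (q ^ 2)) (UNIV \<times> UNIV)"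
    by simp
  have eq: "theta_term q (of_int (u + v + 1) + 1/2) * theta_term q (of_int (u - v) + 1/2) =
        theta_term (q ^ 2) (of_int (u + 1)) * theta_term (q ^ 2) (of_int v + 1/2)" for u v :: int
    using theta_term_rotate[OF q(1), of "of_int u + 1" "of_int v + 1/2"] by (simp add: algebra_simps)
  have "((\<lambda>(u, v). theta_term (q ^ 2) (of_int u) * theta_term (q ^ 2) (of_int v + 1/2)) has_sum
           theta3 (q ^ 2) * theta2 (q ^ 2)) (UNIV \<times> UNIV)"
    using has_sum_product(1)[OF abs_summable_on_theta_int(1)[OF q2] abs_summable_on_theta_half_int[OF q2]] q
    by (simp add: theta2_eq theta3_eq)
  also have "?this \<longleftrightarrow> ((\<lambda>(u, v). theta_term (q ^ 2) (of_int (u + 1)) * theta_term (q ^ 2) (of_int v + 1/2)) has_sum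
           theta3 (q ^ 2) * theta2 (q ^ 2)) (UNIV \<times> UNIV)"
    by (rule has_sum_reindex_bij_witness[of _ "\<lambda>(u, v). (u + 1, v)" "\<lambda>(u, v). (u - 1, v)"]) auto
  finally show "((\<lambda>(u, v). ?F (u + v + 1, u - v)) has_sum theta3 (q ^ 2) * theta2 (q ^ 2)) (UNIV \<times> UNIV)"
    by (simp only: case_prod_unfold prod.sel eq)
qed

lemma theta3_pos: "theta3 q > 0"
proof -
  have "theta_term q (of_int 0) \<le> infsum (\<lambda>n::int. theta_term q (of_int n)) UNIV"
    using finite_sum_le_infsum[of "\<lambda>n::int. theta_term q (of_int n)" UNIV "{0}"] abs_summable_on_theta_int(1)[OF q]
    by simp
  then show ?thesis
    using q by (simp add: theta3_eq theta_term_def)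
qed

lemma theta2_pos: "theta2 q > 0"
proof -
  have "theta_term q (of_int 0 + 1/2) \<le> infsum (\<lambda>n::int. theta_term q (of_int n + 1/2)) UNIV"
    using finite_sum_le_infsum[of "\<lambda>n::int. theta_term q (of_int n + 1/2)" UNIV "{0}"] abs_summable_on_theta_half_int[OF q]
    by simp
  moreover have "theta_term q (of_int 0 + 1/2) > 0"
    using q by (simp add: theta_term_def)
  ultimately show ?thesis
    by (simp add: theta2_eq)
qed

end

section \<open>Identification of the theta squares with the sech sums\<close>

definition sech_diff :: "real \<Rightarrow> real" where
  "sech_diff \<alpha> = (sech_sum \<alpha> - alt_sech_sum \<alpha>) / 2"

context
  fixes \<alpha> :: real
  assumes alpha: "\<alpha> > 0"
begin

lemma sech_sum_double: "sech_sum \<alpha> + alt_sech_sum \<alpha> = 2 * sech_sum (2 * \<alpha>)"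
  using sech_sum_add_alt_sech_sum[OF alpha] by (simp add: sech_sum_def)

lemma sech_sum_recursion: "sech_sum \<alpha> = sech_sum (2 * \<alpha>) + sech_diff \<alpha>"
  using sech_sum_double by (simp add: sech_diff_def field_simps)

text \<open>The square of half a difference is the square of the arithmetic mean minus the product;
  both are known at 2\<alpha>, and their difference of squares factors.\<close>

lemma sech_diff_recursion: "sech_diff \<alpha> ^ 2 = 4 * sech_diff (2 * \<alpha>) * sech_sum (2 * (2 * \<alpha>))"
proof -
  have "sech_diff \<alpha> ^ 2 = ((sech_sum \<alpha> + alt_sech_sum \<alpha>) / 2) ^ 2 - sech_sum \<alpha> * alt_sech_sum \<alpha>"
    by (simp add: sech_diff_def power2_eq_square field_simps)
  also have "\<dots> = sech_sum (2 * \<alpha>) ^ 2 - alt_sech_sum (2 * \<alpha>) ^ 2"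
    using sech_sum_mult_alt_sech_sum[OF alpha] by (simp add: sech_sum_double alt_sech_sum_def[of "2 * \<alpha>"])
  also have "\<dots> = 2 * sech_diff (2 * \<alpha>) * (sech_sum (2 * \<alpha>) + alt_sech_sum (2 * \<alpha>))"
    by (simp add: sech_diff_def power2_eq_square algebra_simps)
  also have "sech_sum (2 * \<alpha>) + alt_sech_sum (2 * \<alpha>) = 2 * sech_sum (2 * (2 * \<alpha>))"
    using sech_sum_add_alt_sech_sum[of "2 * \<alpha>"] alpha by (simp add: sech_sum_def)
  finally show ?thesis by simp
qed

text \<open>Only odd indices survive, with nonnegative terms. This form yields positivity and shows
  that the leading terms are those at 1 and -1.\<close>

lemma sech_diff_eq_infsum: "sech_diff \<alpha> = infsum (\<lambda>n. (1 - (-1) powi n) / 2 * sechs \<alpha> n) UNIV"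
proof -
  have "((\<lambda>n. (sechs \<alpha> n + - ((-1) powi n * sechs \<alpha> n)) / 2) has_sum
      ((sech_sum \<alpha> + - alt_sech_sum \<alpha>) / 2)) UNIV"
    unfolding sech_sum_def alt_sech_sum_def
    by (intro has_sum_divide_const has_sum_add has_sum_uminusI has_sum_infsum
        summable_on_alt_sechs[OF alpha] abs_summable_summable[OF summable_on_sechs[OF alpha]])
  moreover have "(sechs \<alpha> n + - ((-1) powi n * sechs \<alpha> n)) / 2 = (1 - (-1) powi n) / 2 * sechs \<alpha> n" for n
    by (simp add: field_simps)
  ultimately have "((\<lambda>n. (1 - (-1) powi n) / 2 * sechs \<alpha> n) has_sum ((sech_sum \<alpha> + - alt_sech_sum \<alpha>) / 2)) UNIV"
    by (simp only:)
  from infsumI[OF this] show ?thesis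
    by (simp add: sech_diff_def)
qed

lemma sech_sum_pos: "sech_sum \<alpha> > 0"
proof -
  have "sum (sechs \<alpha>) {0} \<le> sech_sum \<alpha>"
    unfolding sech_sum_def
    by (rule finite_sum_le_infsum[OF abs_summable_summable[OF summable_on_sechs[OF alpha]]]) auto
  then have "sechs \<alpha> 0 \<le> sech_sum \<alpha>"
    by simp
  with sechs_pos(1)[of \<alpha> 0] show ?thesis by linarith
qed

lemma sech_diff_pos: "sech_diff \<alpha> > 0"
proof -
  have "(\<lambda>n. (1 - (-1) powi n) / 2 * sechs \<alpha> n) summable_on UNIV"
    by (rule abs_summable_summable, rule abs_summable_on_sechs_bound[OF alpha, of 1 _ 0])
       (auto simp: power_int_minus_left)
  then have "sum (\<lambda>n. (1 - (-1) powi n) / 2 * sechs \<alpha> n) {1} \<le> sech_diff \<alpha>"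
    unfolding sech_diff_eq_infsum
    by (rule finite_sum_le_infsum) (auto simp: power_int_minus_left)
  then have "sechs \<alpha> 1 \<le> sech_diff \<alpha>"
    by simp
  with sechs_pos(1)[of \<alpha> 1] show ?thesis by linarith
qed

end

lemma sechs_ln:
  assumes "0 < x"
  shows "sechs (- ln x) 0 = 1" "sechs (- ln x) 1 = 2 * x / (1 + x ^ 2)" "sechs (- ln x) (-1) = 2 * x / (1 + x ^ 2)"
proof -
  have "cosh (ln x) = (1 + x ^ 2) / (2 * x)"
    using assms by (simp add: cosh_ln_real field_simps power2_eq_square)
  then show "sechs (- ln x) 0 = 1" "sechs (- ln x) 1 = 2 * x / (1 + x ^ 2)" "sechs (- ln x) (-1) = 2 * x / (1 + x ^ 2)"
    by (simp_all add: sechs_def)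
qed

lemma sechs_ln_bound:
  assumes "0 < x" "x < 1"
  shows "sechs (- ln x) n \<le> 2 * x ^ nat \<bar>n\<bar>"
  using sechs_bound[of "- ln x" n] exp_ln_abs_int[of x n] assms by simp

text \<open>Since 2(n + 1/2)^2 = 1/2 + 2n^2 + 2n, a factor sqrt q splits off; its square is the
  order of vanishing at 0 that has to match \<open>sech_diff\<close>.\<close>

lemma theta2_eq_powser:
  assumes q: "0 < q"
  shows "theta2 (q ^ 2) ^ 2 = q * (infsum (\<lambda>n::int. q ^ nat (2 * n ^ 2 + 2 * n)) UNIV) ^ 2"
proof -
  have "theta_term (q ^ 2) (of_int n + 1/2) = sqrt q * q ^ nat (2 * n ^ 2 + 2 * n)" for n :: int
  proof -
    have "n \<le> n ^ 2" "- n \<le> n ^ 2"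
      using square_ge_abs_int[of n] by (auto simp flip: of_int_power of_int_minus of_int_abs)
    then have "0 \<le> 2 * n ^ 2 + 2 * n"
      by linarith
    then have e: "real (nat (2 * n ^ 2 + 2 * n)) = 2 * of_int n ^ 2 + 2 * of_int n"
      by simp
    have "q ^ 2 = q powr 2"
      using q by simp
    then have "theta_term (q ^ 2) (of_int n + 1/2) = q powr (2 * (of_int n + 1/2) ^ 2)"
      by (simp only: theta_term_def powr_powr)
    also have "2 * (of_int n + 1/2) ^ 2 = 1/2 + real (nat (2 * n ^ 2 + 2 * n))"
      unfolding e by (simp add: power2_eq_square algebra_simps)
    also have "q powr \<dots> = sqrt q * q ^ nat (2 * n ^ 2 + 2 * n)"
      using q by (simp only: powr_add powr_realpow powr_half_sqrt less_imp_le)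
    finally show ?thesis .
  qed
  then have "theta2 (q ^ 2) = sqrt q * infsum (\<lambda>n::int. q ^ nat (2 * n ^ 2 + 2 * n)) UNIV"
    by (simp add: theta2_eq infsum_cmult_right')
  then show ?thesis
    using q by (simp add: power_mult_distrib)
qed

context
  fixes X :: "nat \<Rightarrow> real"
  assumes X: "\<And>k. 0 < X k" "\<And>k. X k < 1" "X \<longlonglongrightarrow> 0"
begin

lemma tendsto_sech_sum: "(\<lambda>k. sech_sum (- ln (X k))) \<longlonglongrightarrow> 1"
proof -
  have "(\<lambda>k. infsum (sechs (- ln (X k))) UNIV / X k ^ 0) \<longlonglongrightarrow> 1"
  proof (rule tendsto_int_sum_tail[OF X, of 2])
    have "(\<lambda>k. 1 + 2 * X k / (1 + X k ^ 2) + 2 * X k / (1 + X k ^ 2)) \<longlonglongrightarrow>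
        1 + 2 * 0 / (1 + 0 ^ 2) + 2 * 0 / (1 + 0 ^ 2)"
      by (intro tendsto_intros X) auto
    then show "(\<lambda>k. (sechs (- ln (X k)) 0 + sechs (- ln (X k)) 1 + sechs (- ln (X k)) (-1)) / X k ^ 0) \<longlonglongrightarrow> 1"
      by (simp add: sechs_ln[OF X(1)])
    show "\<bar>sechs (- ln (X k)) n\<bar> \<le> 2 * X k ^ nat \<bar>n\<bar>" for k n
      using sechs_ln_bound[OF X(1,2), of k n] by simp
  qed auto
  then show ?thesis
    by (simp add: sech_sum_def)
qed

text \<open>The indices 1 and -1 contribute 2X/(1 + X^2) each, hence the limit 4; the same constant
  arises for \<open>theta2\<close>, so that the quotient tends to 1.\<close>

lemma tendsto_sech_diff: "(\<lambda>k. sech_diff (- ln (X k)) / X k) \<longlonglongrightarrow> 4"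
proof -
  have "(\<lambda>k. infsum (\<lambda>n. (1 - (-1) powi n) / 2 * sechs (- ln (X k)) n) UNIV / X k ^ 1) \<longlonglongrightarrow> 4"
  proof (rule tendsto_int_sum_tail[OF X, of 2])
    have lim: "(\<lambda>k. 4 / (1 + X k ^ 2)) \<longlonglongrightarrow> 4 / (1 + 0 ^ 2)"
      by (intro tendsto_intros X) auto
    have nz: "X k \<noteq> 0" for k
      using X(1)[of k] by simp
    let ?m = "\<lambda>k. ((1 - (-1) powi 0) / 2 * sechs (- ln (X k)) 0 + (1 - (-1) powi 1) / 2 * sechs (- ln (X k)) 1
        + (1 - (-1) powi (-1)) / 2 * sechs (- ln (X k)) (-1)) / X k ^ 1"
    have m: "?m k = 4 / (1 + X k ^ 2)" for k
      using nz by (simp add: sechs_ln(2)[OF X(1)] power_int_minus_left flip: add_divide_distrib)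
    show "?m \<longlonglongrightarrow> 4"
      using lim unfolding m by simp
    show "\<bar>(1 - (-1) powi n) / 2 * sechs (- ln (X k)) n\<bar> \<le> 2 * X k ^ nat \<bar>n\<bar>" for k n
      using sechs_ln_bound[OF X(1,2), of k n] X(1)[of k] by (auto simp: power_int_minus_left)
  qed auto
  moreover have "- ln (X k) > 0" for k
    using X(1,2)[of k] by simp
  ultimately show ?thesis
    by (simp add: sech_diff_eq_infsum)
qed

lemma tendsto_theta3: "(\<lambda>k. theta3 (X k)) \<longlonglongrightarrow> 1"
proof -
  have "(\<lambda>k. infsum (\<lambda>n::int. theta_term (X k) (of_int n)) UNIV / X k ^ 0) \<longlonglongrightarrow> 1"
  proof (rule tendsto_int_sum_tail[OF X, of 1])
    have "(\<lambda>k. 1 + X k + X k) \<longlonglongrightarrow> 1 + 0 + 0"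
      by (intro tendsto_intros X)
    then show "(\<lambda>k. (theta_term (X k) (of_int 0) + theta_term (X k) (of_int 1) + theta_term (X k) (of_int (-1))) / X k ^ 0) \<longlonglongrightarrow> 1"
      using X(1) by (simp add: theta_term_def less_imp_le less_imp_neq[THEN not_sym])
    show "\<bar>theta_term (X k) (of_int n)\<bar> \<le> 1 * X k ^ nat \<bar>n\<bar>" for k n
      using theta_term_bound[OF X(1,2), of n 0 "of_int n" k] square_ge_abs_int[of n] X(1)[of k] by simp
  qed auto
  then show ?thesis
    using X(1) by (simp add: theta3_eq)
qed

lemma tendsto_theta2: "(\<lambda>k. theta2 (X k ^ 2) ^ 2 / X k) \<longlonglongrightarrow> 4"
proof -
  have "(\<lambda>k. infsum (\<lambda>n::int. X k ^ nat (2 * n ^ 2 + 2 * n)) UNIV / X k ^ 0) \<longlonglongrightarrow> 2"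
  proof (rule tendsto_int_sum_tail[OF X, of 1])
    \<comment> \<open>The indices 0 and -1 both have exponent 0, so two terms survive in the limit,
      and 2^2 = 4.\<close>
    have "(\<lambda>k. 1 + X k ^ 4 + 1) \<longlonglongrightarrow> 1 + 0 ^ 4 + 1"
      by (intro tendsto_intros X)
    then show "(\<lambda>k. (X k ^ nat (2 * 0 ^ 2 + 2 * 0) + X k ^ nat (2 * 1 ^ 2 + 2 * 1)
        + X k ^ nat (2 * (-1) ^ 2 + 2 * (-1))) / X k ^ 0) \<longlonglongrightarrow> 2"
      by simp
    fix k and n :: int assume n: "\<bar>n\<bar> \<ge> 2"
    have "2 * \<bar>n\<bar> \<le> \<bar>n\<bar> * \<bar>n\<bar>"
      using n by (intro mult_right_mono) auto
    then have "\<bar>n\<bar> \<le> 2 * n ^ 2 + 2 * n"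
      by (simp add: power2_eq_square)
    then show "\<bar>X k ^ nat (2 * n ^ 2 + 2 * n)\<bar> \<le> 1 * X k ^ nat \<bar>n\<bar>"
      using X(1)[of k] X(2)[of k] by (auto intro!: power_decreasing)
  qed auto
  then have "(\<lambda>k. (infsum (\<lambda>n::int. X k ^ nat (2 * n ^ 2 + 2 * n)) UNIV) ^ 2) \<longlonglongrightarrow> 2 ^ 2"
    by (intro tendsto_power) simp
  moreover have "theta2 (X k ^ 2) ^ 2 / X k = (infsum (\<lambda>n::int. X k ^ nat (2 * n ^ 2 + 2 * n)) UNIV) ^ 2" for k
    using X(1)[of k] by (simp add: theta2_eq_powser)
  ultimately show ?thesis by simp
qed

end

lemma theta_squares_eq_sech_sums:
  assumes q: "0 < q" "q < 1"
  shows "theta3 q ^ 2 = sech_sum (- ln q)" "theta2 (q ^ 2) ^ 2 = sech_diff (- ln q)"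
proof -
  \<comment> \<open>Repeated squaring of q doubles -ln q at each step and drives it to infinity,
    where both pairs of sequences have the same leading terms.\<close>
  define X where "X k = q ^ (2 ^ k)" for k :: nat
  have X01: "0 < X k" "X k < 1" for k
    using q by (auto simp: X_def power_less_one_iff)
  have "X \<longlonglongrightarrow> 0"
  proof (rule Lim_null_comparison)
    show "(\<lambda>k. q ^ k) \<longlonglongrightarrow> 0"
      using q by (intro LIMSEQ_power_zero) simp
    have "norm (X k) \<le> q ^ k" for k
      using q less_exp[of k] by (auto simp: X_def intro!: power_decreasing)
    then show "\<forall>\<^sub>F k in sequentially. norm (X k) \<le> q ^ k"
      by simp
  qed
  note X = X01 this
  have XS: "X k ^ 2 = X (Suc k)" for k
    by (simp add: X_def power_mult[symmetric] mult.commute)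
  have lnX: "- ln (X (Suc k)) = 2 * (- ln (X k))" for k
    using X01[of k] by (simp flip: XS add: ln_realpow)
  have lnpos: "- ln (X k) > 0" for k
    using X01[of k] by simp
  define a where "a k = sech_sum (- ln (X k))" for k
  define d where "d k = sech_diff (- ln (X k))" for k
  define A where "A k = theta3 (X k) ^ 2" for k
  define D where "D k = theta2 (X k ^ 2) ^ 2" for k
  have pos: "a k > 0" "d k > 0" "A k > 0" "D k > 0" for k
    using sech_sum_pos[OF lnpos[of k]] sech_diff_pos[OF lnpos[of k]]
      zero_less_power[OF theta3_pos[OF X01[of k]], of 2] zero_less_power[OF theta2_pos[OF X01[of "Suc k"]], of 2]
    by (simp_all add: a_def d_def A_def D_def XS del: zero_less_power2)
  have rec: "a k = a (Suc k) + d k" "d k ^ 2 = 4 * d (Suc k) * a (Suc (Suc k))"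
    "A k = A (Suc k) + D k" "D k ^ 2 = 4 * D (Suc k) * A (Suc (Suc k))" for k
  proof -
    show "a k = a (Suc k) + d k"
      unfolding a_def d_def lnX by (rule sech_sum_recursion[OF lnpos])
    show "d k ^ 2 = 4 * d (Suc k) * a (Suc (Suc k))"
      unfolding a_def d_def lnX by (rule sech_diff_recursion[OF lnpos])
    show "A k = A (Suc k) + D k"
      using theta3_square[OF X01[of k]] by (simp add: A_def D_def XS)
    have "theta2 (X (Suc k)) ^ 2 = 2 * (theta2 (X (Suc (Suc k))) * theta3 (X (Suc (Suc k))))"
      using theta2_square[OF X01[of "Suc k"]] by (simp add: XS)
    then show "D k ^ 2 = 4 * D (Suc k) * A (Suc (Suc k))"
      unfolding A_def D_def XS by (simp only: power_mult_distrib) simp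
  qed
  have "(\<lambda>k. sech_sum (- ln (X k)) / theta3 (X k) ^ 2) \<longlonglongrightarrow> 1 / 1 ^ 2"
    by (intro tendsto_intros tendsto_sech_sum tendsto_theta3 X) auto
  then have lim1: "(\<lambda>k. a k / A k) \<longlonglongrightarrow> 1"
    by (simp add: a_def A_def)
  have "(\<lambda>k. (sech_diff (- ln (X k)) / X k) / (theta2 (X k ^ 2) ^ 2 / X k)) \<longlonglongrightarrow> 4 / 4"
    by (intro tendsto_intros tendsto_sech_diff tendsto_theta2 X) auto
  moreover have "X k \<noteq> 0" for k
    using X01(1)[of k] by simp
  ultimately have lim2: "(\<lambda>k. d k / D k) \<longlonglongrightarrow> 1"
    by (simp add: d_def D_def)
  have "a 0 = A 0" "d 0 = D 0"
    using agm_recursion_unique[of a d A D 0, OF pos rec lim1 lim2] by simp_all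
  then show "theta3 q ^ 2 = sech_sum (- ln q)" "theta2 (q ^ 2) ^ 2 = sech_diff (- ln q)"
    by (simp_all add: a_def A_def d_def D_def X_def)
qed

lemma theta4_square_eq_alt_sech_sum:
  assumes q: "0 < q" "q < 1"
  shows "theta4 q ^ 2 = alt_sech_sum (- ln q)"
proof -
  have pos: "- ln q > 0"
    using q by simp
  have "theta4 q ^ 2 = theta3 q ^ 2 - 2 * theta2 (q ^ 2) ^ 2"
    using theta3_square[OF q] theta4_square[OF q] by simp
  then show ?thesis
    using theta_squares_eq_sech_sums[OF q] by (simp add: sech_diff_def field_simps)
qed

text \<open>Jacobi's \<open>theta2 q ^ 4\<close> = \<open>theta3 q ^ 4\<close> -
  \<open>theta4 q ^ 4\<close>, read off from the three duplication formulas, expresses f by F(1) and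
  F(-1) alone.\<close>

lemma fq_eq_sech_sums:
  assumes q: "0 < q" "q < 1"
  shows "fq q = alt_sech_sum (- ln q) * (sech_sum (- ln q) ^ 2 - alt_sech_sum (- ln q) ^ 2) / 16"
proof -
  have "theta2 q ^ 4 = (theta2 q ^ 2) ^ 2"
    by simp
  also have "\<dots> = 4 * theta2 (q ^ 2) ^ 2 * theta3 (q ^ 2) ^ 2"
    unfolding theta2_square[OF q] by (simp add: power2_eq_square)
  also have "\<dots> = (theta3 q ^ 2) ^ 2 - (theta4 q ^ 2) ^ 2"
    unfolding theta3_square[OF q] theta4_square[OF q] by (simp add: power2_eq_square algebra_simps)
  finally show ?thesis
    using theta_squares_eq_sech_sums[OF q] theta4_square_eq_alt_sech_sum[OF q]
    by (simp add: fq_def mult.commute)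
qed

text \<open>The second moment at z = -1 is -4 f. Its terms are even in n and the factor n^2 removes
  n = 0, so one half-line carries -2 f.\<close>

lemma fq_sums_sechs:
  assumes q: "0 < q" "q < 1"
  shows "((\<lambda>n. (-1) ^ n * real (Suc n) ^ 2 * sechs (- ln q) (int (Suc n)) / 2) has_sum fq q) UNIV"
proof -
  have pos: "- ln q > 0"
    using q by simp
  define f where "f n = (-1) powi n * of_int n ^ 2 * sechs (- ln q) n" for n :: int
  have f: "(f has_sum (- 4 * fq q)) UNIV"
    using has_sum_sechs_second_moment[OF pos] unfolding f_def fq_eq_sech_sums[OF q] by simp
  have fm: "f (- n) = f n" for n
    by (auto simp: f_def power_int_minus_left)
  have "(\<lambda>n. f (int (Suc n))) summable_on UNIV"
    using summable_on_subset[OF has_sum_imp_summable[OF f], of "range (\<lambda>n. int (Suc n))"]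
      summable_on_reindex[of "\<lambda>n. int (Suc n)" UNIV f] by (simp add: inj_on_def o_def)
  then obtain T where T: "((\<lambda>n. f (int (Suc n))) has_sum T) UNIV"
    by (auto simp: summable_on_def)
  have "(\<lambda>n. f (int (Suc n))) sums T"
    by (rule has_sum_imp_sums[OF T])
  then have "(\<lambda>n. f (int n)) sums (T + f (int 0))"
    by (rule sums_Suc)
  then have s: "(\<lambda>n. f (int n)) sums T"
    by (simp add: f_def)
  have "(\<lambda>n. f (int n)) summable_on UNIV"
    using summable_on_subset[OF has_sum_imp_summable[OF f], of "range int"]
      summable_on_reindex[of int UNIV f] by (simp add: inj_on_def o_def)
  then have 1: "((\<lambda>n. f (int n)) has_sum T) UNIV"
    by (rule has_sum_of_sums[OF _ s])
  have 2: "((\<lambda>n. f (- int (Suc n))) has_sum T) UNIV"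
    using T unfolding fm .
  have "- 4 * fq q = T + T"
    using has_sum_unique[OF f has_sum_int_nonneg_neg[OF 1 2]] .
  then have "T / (-2) = fq q"
    by simp
  moreover have "f (int (Suc n)) / (-2) = (-1) ^ n * real (Suc n) ^ 2 * sechs (- ln q) (int (Suc n)) / 2" for n
    unfolding f_def power_int_of_nat by simp
  ultimately show ?thesis
    using has_sum_divide_const[OF T, of "-2"] by (simp only:)
qed

section \<open>The Lambert series and the L-value\<close>

lemma has_sum_group:
  fixes F :: "'a \<Rightarrow> real" and h :: "'a \<Rightarrow> 'b"
  assumes "(F has_sum S) UNIV" "\<And>N. finite {x. h x = N}"
  shows "((\<lambda>N. \<Sum>x | h x = N. F x) has_sum S) UNIV"
proof -
  have "((\<lambda>(N, x). F x) has_sum S) (Sigma UNIV (\<lambda>N. {x. h x = N}))"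
    using assms(1)
    by (subst has_sum_reindex_bij_witness[of _ "\<lambda>x. (h x, x)" snd UNIV F]) auto
  then show ?thesis
    by (rule has_sum_SigmaD) (use assms(2) in \<open>simp add: has_sum_finite\<close>)
qed

text \<open>Justifies the definite description in \<open>fcoeff\<close>, whose condition covers only
  q in (0,1); hence coefficients are compared through limits from the right.\<close>

lemma powser_unique_at_right_0:
  fixes a b :: "nat \<Rightarrow> real"
  assumes "\<And>q. 0 < q \<Longrightarrow> q < 1 \<Longrightarrow> (\<lambda>n. a n * q ^ n) sums f q"
    and "\<And>q. 0 < q \<Longrightarrow> q < 1 \<Longrightarrow> (\<lambda>n. b n * q ^ n) sums f q"
  shows "a = b"
proof -
  define e where "e n = a n - b n" for n
  have e: "(\<lambda>n. e n * q ^ n) sums 0" if "0 < q" "q < 1" for q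
    using sums_diff[OF assms(1)[OF that] assms(2)[OF that]] by (simp add: e_def algebra_simps)
  have "e n = 0" for n
  proof (induction n rule: less_induct)
    case (less n)
    have s: "(\<lambda>m. e (m + n) * q ^ m) sums 0" if q: "0 < q" "q < 1" for q
    proof -
      have "(\<lambda>m. e (m + n) * q ^ (m + n)) sums 0"
        using e[OF q] less sums_iff_shift[of "\<lambda>m. e m * q ^ m" n 0] by simp
      from sums_mult[OF this, of "1 / q ^ n"] q show ?thesis
        by (simp add: power_add)
    qed
    define g where "g q = (\<Sum>m. e (m + n) * q ^ m)" for q
    have "(\<lambda>m. e (m + n) * q ^ m) sums g q" if "norm q < 1/2" for q
      unfolding g_def
      by (rule summable_sums, rule powser_inside[OF sums_summable[OF s[of "1/2"]]]) (use that in auto)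
    then have "(g \<longlongrightarrow> e (0 + n)) (at 0)"
      by (intro powser_limit_0[of "1/2" "\<lambda>m. e (m + n)"]) auto
    then have "(g \<longlongrightarrow> e n) (at_right 0)"
      by (auto intro: filterlim_mono simp: at_le)
    moreover have "\<forall>\<^sub>F q in at_right 0. g q = 0"
      unfolding eventually_at_right_field using s by (auto intro!: exI[of _ 1] sums_unique[symmetric] simp: g_def)
    then have "(g \<longlongrightarrow> 0) (at_right 0)"
      by (rule tendsto_eventually)
    ultimately show "e n = 0"
      by (intro tendsto_unique[of "at_right (0::real)" g]) auto
  qed
  then show ?thesis
    by (auto simp: e_def)
qed

text \<open>A twisted divisor sum: N = d m with d = \<open>Suc n\<close> and m =
  \<open>2 * k + 1\<close>, where \<open>(-1) ^ k\<close> is the nontrivial character mod 4 at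
  m.\<close>

definition lambert_coeff :: "nat \<Rightarrow> real" where
  "lambert_coeff N = (\<Sum>(n, k) | Suc n * (2 * k + 1) = N. (-1) ^ (n + k) * real (Suc n) ^ 2)"

lemma finite_lambert_index: "finite {x. (case x of (n, k) \<Rightarrow> Suc n * (2 * k + 1)) = (N::nat)}"
proof (rule finite_subset)
  show "{x. (case x of (n, k) \<Rightarrow> Suc n * (2 * k + 1)) = N} \<subseteq> {..N} \<times> {..N}"
  proof (clarify, intro conjI)
    fix n k
    have "Suc n * 1 \<le> Suc n * (2 * k + 1)" "1 * (2 * k + 1) \<le> Suc n * (2 * k + 1)"
      by (intro mult_le_mono; simp)+
    then show "n \<in> {..Suc n * (2 * k + 1)}" "k \<in> {..Suc n * (2 * k + 1)}"
      by auto
  qed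
qed auto

lemma sechs_geometric_sums:
  assumes "0 < q" "q < 1"
  shows "(\<lambda>k. (-1) ^ k * q ^ (Suc n * (2 * k + 1))) sums (sechs (- ln q) (int (Suc n)) / 2)"
proof -
  define x where "x = q ^ Suc n"
  have x: "0 < x" "x < 1"
    using assms by (simp_all add: x_def power_less_one_iff del: power_Suc)
  have "norm (- x\<^sup>2) < 1"
    using x by (simp add: power_less_one_iff)
  from sums_mult[OF geometric_sums[OF this], of x]
  have "(\<lambda>k. x * (- x\<^sup>2) ^ k) sums (x * (1 / (1 - - x\<^sup>2)))" .
  also have "(\<lambda>k. x * (- x\<^sup>2) ^ k) = (\<lambda>k. (-1) ^ k * q ^ (Suc n * (2 * k + 1)))"
  proof
    fix k
    have "q ^ (Suc n * (2 * k + 1)) = x ^ (2 * k + 1)"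
      by (simp only: x_def power_mult)
    also have "\<dots> = x * (x\<^sup>2) ^ k"
      by (simp add: power_mult)
    finally show "x * (- x\<^sup>2) ^ k = (-1) ^ k * q ^ (Suc n * (2 * k + 1))"
      using power_minus[of "x\<^sup>2" k] by simp
  qed
  also have "x * (1 / (1 - - x\<^sup>2)) = sechs (- ln q) (int (Suc n)) / 2"
  proof -
    have "sechs (- ln q) (int (Suc n)) = sechs (- ln x) 1"
      using assms by (simp add: sechs_def x_def ln_realpow mult.commute del: power_Suc of_nat_Suc)
    moreover have "x * (1 / (1 - - x\<^sup>2)) = 2 * x / (1 + x\<^sup>2) / 2"
      by (simp del: divide_divide_eq_left)
    ultimately show ?thesis
      by (simp only: sechs_ln(2)[OF x(1)])
  qed
  finally show ?thesis .
qed

lemma fq_has_sum_pairs: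
  assumes q: "0 < q" "q < 1"
  shows "((\<lambda>(n, k). (-1) ^ (n + k) * real (Suc n) ^ 2 * q ^ (Suc n * (2 * k + 1))) has_sum fq q) UNIV"
proof -
  have pos: "- ln q > 0"
    using q by simp
  define F where "F = (\<lambda>(n, k). (-1) ^ (n + k) * real (Suc n) ^ 2 * q ^ (Suc n * (2 * k + 1)))"
  have "(\<lambda>x. norm (F x)) summable_on UNIV \<times> UNIV"
  proof (rule Infinite_Sum.abs_summable_on_comparison_test')
    define g where "g n = real (Suc n) ^ 2 * q ^ Suc n" for n
    have "summable (\<lambda>n. real n ^ 2 * exp (- (- ln q) * real n))"
      by (rule summable_inverse_square_bigo) (use pos in real_asymp)
    then have "summable (\<lambda>n. real n ^ 2 * q ^ n)"
      using q by (simp add: exp_of_nat2_mult)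
    then have "summable g"
      unfolding g_def by (subst summable_Suc_iff[of "\<lambda>n. real n ^ 2 * q ^ n"])
    moreover have "g n \<ge> 0" for n
      using q by (simp add: g_def)
    ultimately have "(\<lambda>n. norm (g n)) summable_on UNIV"
      by (simp add: summable_nonneg_imp_summable_on)
    moreover have "(\<lambda>k. norm (q ^ k)) summable_on UNIV"
      using q by (simp add: summable_nonneg_imp_summable_on)
    ultimately have "((\<lambda>(n, k). g n * q ^ k) has_sum (infsum g UNIV * infsum (\<lambda>k. q ^ k) UNIV)) (UNIV \<times> UNIV)"
      by (rule has_sum_product)
    then show "(\<lambda>(n, k). g n * q ^ k) summable_on (UNIV \<times> UNIV)"
      by (rule has_sum_imp_summable)
    fix x :: "nat \<times> nat"
    obtain n k where x: "x = (n, k)"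
      by (cases x)
    \<comment> \<open>Bounding the product of indices by their sum makes the majorant a product of
      two single series.\<close>
    have "Suc n + k \<le> Suc n * (2 * k + 1)"
      by simp
    then have "q ^ (Suc n * (2 * k + 1)) \<le> q ^ (Suc n + k)"
      using q by (intro power_decreasing) auto
    then have "real (Suc n) ^ 2 * q ^ (Suc n * (2 * k + 1)) \<le> real (Suc n) ^ 2 * q ^ (Suc n + k)"
      by (rule mult_left_mono) simp
    then show "norm (F x) \<le> (case x of (n, k) \<Rightarrow> g n * q ^ k)"
      using q by (simp add: x F_def g_def abs_mult power_abs power_add mult_ac)
  qed
  then have F: "F summable_on UNIV \<times> UNIV"
    by (rule abs_summable_summable)
  have row: "((\<lambda>k. F (n, k)) has_sum ((-1) ^ n * real (Suc n) ^ 2 * sechs (- ln q) (int (Suc n)) / 2)) UNIV" for n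
  proof -
    have s: "(\<lambda>k. F (n, k)) summable_on UNIV"
      using summable_on_SigmaD1[of "\<lambda>x y. F (x, y)" UNIV "\<lambda>_. UNIV" n] F by simp
    have "(\<lambda>k. F (n, k)) sums ((-1) ^ n * real (Suc n) ^ 2 * (sechs (- ln q) (int (Suc n)) / 2))"
      using sums_mult[OF sechs_geometric_sums[OF q, of n], of "(-1) ^ n * real (Suc n) ^ 2"]
      by (simp add: F_def power_add mult_ac)
    then show ?thesis
      by (intro has_sum_of_sums[OF s]) simp
  qed
  from has_sum_SigmaI[OF row fq_sums_sechs[OF q] F] show ?thesis
    by (simp add: F_def)
qed

lemma lambert_coeff_sums_fq:
  assumes q: "0 < q" "q < 1"
  shows "(\<lambda>N. lambert_coeff N * q ^ N) sums fq q"
proof -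
  let ?h = "\<lambda>(n, k). Suc n * (2 * k + 1)"
  have "((\<lambda>N. \<Sum>x | ?h x = N. (\<lambda>(n, k). (-1) ^ (n + k) * real (Suc n) ^ 2 * q ^ (Suc n * (2 * k + 1))) x)
      has_sum fq q) UNIV"
    by (intro has_sum_group fq_has_sum_pairs q finite_lambert_index)
  also have "(\<lambda>N. \<Sum>x | ?h x = N. (\<lambda>(n, k). (-1) ^ (n + k) * real (Suc n) ^ 2 * q ^ (Suc n * (2 * k + 1))) x) =
      (\<lambda>N. lambert_coeff N * q ^ N)"
    unfolding lambert_coeff_def sum_distrib_right
    by (intro ext sum.cong) auto
  finally show ?thesis
    by (rule has_sum_imp_sums)
qed

lemma fcoeff_eq: "fcoeff = lambert_coeff"
  unfolding fcoeff_def
proof (rule the_equality)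
  show "\<forall>q\<in>{0<..<1}. (\<lambda>n. lambert_coeff n * q ^ n) sums fq q"
    using lambert_coeff_sums_fq by auto
  show "a = lambert_coeff" if "\<forall>q\<in>{0<..<1}. (\<lambda>n. a n * q ^ n) sums fq q" for a
    by (rule powser_unique_at_right_0[of _ fq]) (use that lambert_coeff_sums_fq in auto)
qed

lemma alternating_inverse_squares_sums: "(\<lambda>n. (-1) ^ n / real (Suc n) ^ 2) sums (pi\<^sup>2 / 12)"
proof -
  have P: "(\<lambda>n. 1 / real (Suc n) ^ 2) sums (pi\<^sup>2 / 6)"
    using inverse_squares_sums by (simp add: add.commute)
  \<comment> \<open>Twice the even part is subtracted: \<open>Suc n\<close> = 2(m + 1) for n = 2m +
    1, and 2/(2(m + 1))^2 is half of 1/(m + 1)^2.\<close>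
  from sums_mult[OF sums_if'[OF P], of "1/2"]
  have "(\<lambda>n. 1 / 2 * (if even n then 0 else 1 / real (Suc ((n - 1) div 2)) ^ 2)) sums (1/2 * (pi\<^sup>2 / 6))" .
  from sums_diff[OF P this]
  have "(\<lambda>n. 1 / real (Suc n) ^ 2 - 1 / 2 * (if even n then 0 else 1 / real (Suc ((n - 1) div 2)) ^ 2))
      sums (pi\<^sup>2 / 12)"
    by simp
  also have "(\<lambda>n. 1 / real (Suc n) ^ 2 - 1 / 2 * (if even n then 0 else 1 / real (Suc ((n - 1) div 2)) ^ 2)) =
      (\<lambda>n. (-1) ^ n / real (Suc n) ^ 2)"
  proof
    fix n
    show "1 / real (Suc n) ^ 2 - 1 / 2 * (if even n then 0 else 1 / real (Suc ((n - 1) div 2)) ^ 2) =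
      (-1) ^ n / real (Suc n) ^ 2"
    proof (cases "even n")
      case False
      then obtain m where m: "n = 2 * m + 1"
        by (elim oddE)
      show ?thesis
        unfolding m by (simp add: divide_simps power2_eq_square) (simp add: algebra_simps)
    qed simp
  qed
  finally show ?thesis .
qed

text \<open>Since d^2/(d m)^4 = d^(-2) m^(-4), grouping by N = d m turns the product of two single
  series into the Dirichlet series.\<close>

lemma Lf4_eq: "Lf4 = pi\<^sup>2 / 12 * beta4"
proof -
  let ?h = "\<lambda>(n, k). Suc n * (2 * k + 1)"
  define u where "u n = (-1) ^ n / real (Suc n) ^ 2" for n
  define v where "v k = (-1) ^ k / odd_of k ^ 4" for k
  have "summable (\<lambda>n. 1 / real (Suc n) ^ 2)"
    using inverse_squares_sums by (simp add: sums_iff add.commute)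
  then have u: "(\<lambda>n. norm (u n)) summable_on UNIV"
    by (simp add: u_def power_abs summable_nonneg_imp_summable_on)
  have v: "(\<lambda>k. norm (v k)) summable_on UNIV"
    using summable_odd_of_power[of 4] by (simp add: v_def power_abs summable_nonneg_imp_summable_on)
  have iu: "infsum u UNIV = pi\<^sup>2 / 12"
    using sums_unique2[OF has_sum_imp_sums[OF has_sum_infsum[OF abs_summable_summable[OF u]]]]
      alternating_inverse_squares_sums by (simp add: u_def [abs_def])
  have iv: "infsum v UNIV = beta4"
    using sums_unique2[OF has_sum_imp_sums[OF has_sum_infsum[OF abs_summable_summable[OF v]]]]
      beta4_sums by (simp add: v_def [abs_def])
  have "((\<lambda>(n, k). u n * v k) has_sum (pi\<^sup>2 / 12 * beta4)) UNIV"
    using has_sum_product(1)[OF u v] by (simp add: iu iv)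
  from has_sum_group[OF this, of ?h]
  have "((\<lambda>N. \<Sum>x | ?h x = N. (\<lambda>(n, k). u n * v k) x) has_sum (pi\<^sup>2 / 12 * beta4)) UNIV"
    using finite_lambert_index by blast
  also have "(\<lambda>N. \<Sum>x | ?h x = N. (\<lambda>(n, k). u n * v k) x) = (\<lambda>N. lambert_coeff N / real N ^ 4)"
    unfolding lambert_coeff_def sum_divide_distrib
  proof (intro ext sum.cong)
    show "{x. ?h x = N} = {(n, k). Suc n * (2 * k + 1) = N}" for N
      by auto
    fix N :: nat and x :: "nat \<times> nat"
    assume "x \<in> {(n, k). Suc n * (2 * k + 1) = N}"
    then obtain n k where x: "x = (n, k)" and N: "N = Suc n * (2 * k + 1)"
      by (cases x) auto
    have N': "real N = real (Suc n) * odd_of k"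
      unfolding N odd_of_def of_nat_mult by simp
    have "u n * v k = (-1) ^ (n + k) * real (Suc n) ^ 2 / (real (Suc n) * odd_of k) ^ 4"
      by (simp add: u_def v_def power_add power_mult_distrib field_simps eval_nat_numeral del: of_nat_Suc)
    then show "(case x of (n, k) \<Rightarrow> u n * v k) = (case x of (n, k) \<Rightarrow> (-1) ^ (n + k) * real (Suc n) ^ 2) / real N ^ 4"
      by (simp add: x N')
  qed
  finally have "(\<lambda>N. lambert_coeff N / real N ^ 4) sums (pi\<^sup>2 / 12 * beta4)"
    by (rule has_sum_imp_sums)
  then have "(\<lambda>N. lambert_coeff (Suc N) / real (Suc N) ^ 4) sums (pi\<^sup>2 / 12 * beta4)"
    by (subst sums_Suc_iff) simp
  then show ?thesis
    unfolding Lf4_def fcoeff_eq by (rule sums_unique[symmetric])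
qed

section \<open>Wallis coefficients and moments of the elliptic integral\<close>

lemma summable_linear_geometric:
  fixes r :: real
  assumes "0 < r" "r < 1"
  shows "summable (\<lambda>k. real (p + 2 * k) * r ^ k)"
  by (rule summable_inverse_square_bigo) (use assms in real_asymp)

text \<open>One termwise differentiation rule for all odd and even series below. When
  \<open>p + 2 * k\<close> is 0, the truncated exponent is harmless because its factor is 0.\<close>

lemma DERIV_sparse_powser:
  fixes c :: "nat \<Rightarrow> real"
  assumes c: "\<And>k. \<bar>c k\<bar> \<le> C" and x: "\<bar>x\<bar> < 1"
  shows "summable (\<lambda>k. c k * x ^ (p + 2 * k))"
    and "((\<lambda>x. \<Sum>k. c k * x ^ (p + 2 * k)) has_real_derivative
           (\<Sum>k. c k * (real (p + 2 * k) * x ^ (p + 2 * k - 1)))) (at x)"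
    and "summable (\<lambda>k. c k * (real (p + 2 * k) * x ^ (p + 2 * k - 1)))"
proof -
  have C: "C \<ge> 0"
    using c[of 0] by linarith
  obtain r where r: "\<bar>x\<bar> < r" "r < 1"
    using dense[OF x] by blast
  then have r0: "0 < r"
    by linarith
  have bound: "norm (c k * (real (p + 2 * k) * y ^ (p + 2 * k - 1))) \<le> C * (real (p + 2 * k) * r ^ k)"
    if "y \<in> {-r..r}" for k y
  proof -
    have "\<bar>y\<bar> \<le> r"
      using that by auto
    then have "\<bar>y\<bar> ^ (p + 2 * k - 1) \<le> r ^ (p + 2 * k - 1)"
      by (intro power_mono) auto
    also have "\<dots> \<le> r ^ k"
      using r r0 by (intro power_decreasing) auto
    finally show ?thesis
      using c[of k] C by (auto simp: abs_mult power_abs intro!: mult_mono)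
  qed
  have M: "summable (\<lambda>k. C * (real (p + 2 * k) * r ^ k))"
    using r r0 by (intro summable_mult summable_linear_geometric)
  have unif: "uniformly_convergent_on {-r..r} (\<lambda>n y. \<Sum>k<n. c k * (real (p + 2 * k) * y ^ (p + 2 * k - 1)))"
    using bound M by (rule Weierstrass_m_test')
  have der: "((\<lambda>y. c k * y ^ (p + 2 * k)) has_real_derivative c k * (real (p + 2 * k) * y ^ (p + 2 * k - 1)))
      (at y within {-r..r})" for k y
    by (auto intro!: derivative_eq_intros)
  have s0: "summable (\<lambda>k. c k * 0 ^ (p + 2 * k))"
    by (rule summable_finite[of "{0}"]) auto
  have xi: "x \<in> interior {-r..r}"
    using r by auto
  show "summable (\<lambda>k. c k * x ^ (p + 2 * k))"
    "((\<lambda>x. \<Sum>k. c k * x ^ (p + 2 * k)) has_real_derivative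
           (\<Sum>k. c k * (real (p + 2 * k) * x ^ (p + 2 * k - 1)))) (at x)"
    using has_field_derivative_series'[OF _ der unif _ s0 xi] r0 by auto
  show "summable (\<lambda>k. c k * (real (p + 2 * k) * x ^ (p + 2 * k - 1)))"
    by (rule summable_comparison_test'[OF M], rule bound) (use r in auto)
qed

lemma continuous_on_sparse_powser:
  fixes c :: "nat \<Rightarrow> real"
  assumes "summable (\<lambda>k. \<bar>c k\<bar>)"
  shows "continuous_on {-1..1} (\<lambda>x. \<Sum>k. c k * x ^ (p + 2 * k))"
proof (rule uniform_limit_theorem)
  show "uniform_limit {-1..1} (\<lambda>n x. \<Sum>k<n. c k * x ^ (p + 2 * k)) (\<lambda>x. \<Sum>k. c k * x ^ (p + 2 * k)) sequentially"
  proof (rule Weierstrass_m_test[OF _ assms])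
    show "norm (c k * x ^ (p + 2 * k)) \<le> \<bar>c k\<bar>" if "x \<in> {-1..1}" for k and x :: real
      using that by (auto simp: abs_mult power_abs intro!: mult_left_le power_le_one)
  qed
qed (auto intro!: always_eventually continuous_intros)

lemma has_integral_nonneg_series:
  fixes f :: "nat \<Rightarrow> real \<Rightarrow> real"
  assumes "\<And>k. (f k has_integral I k) S" "\<And>k x. x \<in> S \<Longrightarrow> f k x \<ge> 0"
    and "\<And>x. x \<in> S \<Longrightarrow> (\<lambda>k. f k x) sums g x" and "I sums J"
  shows "(g has_integral J) S"
proof (rule has_integral_monotone_convergence_increasing)
  show "((\<lambda>x. \<Sum>k<n. f k x) has_integral (\<Sum>k<n. I k)) S" for n
    by (intro has_integral_sum assms) auto
qed (use assms in \<open>auto simp: sums_def\<close>)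

text \<open>The converse use of monotone convergence: a known integral of the limit bounds the
  partial sums, giving convergence of the termwise integrals together with their sum.\<close>

lemma sums_of_has_integral_nonneg_series:
  fixes f :: "nat \<Rightarrow> real \<Rightarrow> real"
  assumes f: "\<And>k. (f k has_integral I k) S" "\<And>k x. x \<in> S \<Longrightarrow> f k x \<ge> 0"
    and sums: "\<And>x. x \<in> S \<Longrightarrow> (\<lambda>k. f k x) sums g x" and g: "(g has_integral J) S"
  shows "I sums J"
proof -
  have I: "I k \<ge> 0" for k
    using f by (rule has_integral_nonneg)
  have "summable I"
  proof (rule bounded_imp_summable[OF I])
    fix n
    have "((\<lambda>x. \<Sum>k<Suc n. f k x) has_integral (\<Sum>k<Suc n. I k)) S"
      by (intro has_integral_sum f) auto
    moreover have "(\<Sum>k<Suc n. f k x) \<le> g x" if "x \<in> S" for x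
      using sum_le_suminf[OF sums_summable[OF sums[OF that]], of "{..<Suc n}"] sums_unique[OF sums[OF that]] f(2)[OF that]
      by auto
    ultimately show "(\<Sum>k\<le>n. I k) \<le> J"
      using has_integral_le[OF _ g] by (metis lessThan_Suc_atMost)
  qed
  then have s: "I sums suminf I"
    by (rule summable_sums)
  from has_integral_unique[OF has_integral_nonneg_series[OF f sums s] g] s show ?thesis
    by simp
qed

text \<open>The Wallis numbers W_n and V_n in Pochhammer form: (1)_n/(3/2)_n and (1/2)_n/(1)_n are
  the ratios that occur in the Kampe de Feriet terms.\<close>

definition sin_odd :: "nat \<Rightarrow> real" where "sin_odd n = fact n / pochhammer (3/2) n"
definition sin_even :: "nat \<Rightarrow> real" where "sin_even n = pochhammer (1/2) n / fact n"

lemma sin_odd_0 [simp]: "sin_odd 0 = 1"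
  and sin_even_0 [simp]: "sin_even 0 = 1"
  by (simp_all add: sin_odd_def sin_even_def)

lemma sin_odd_Suc: "real (2 * n + 3) * sin_odd (Suc n) = real (2 * n + 2) * sin_odd n"
proof -
  have "pochhammer (3/2) n > (0 :: real)"
    by (rule pochhammer_pos) simp
  then show ?thesis
    by (simp add: sin_odd_def pochhammer_Suc divide_simps) (simp add: algebra_simps)
qed

lemma sin_even_Suc: "real (2 * n + 2) * sin_even (Suc n) = real (2 * n + 1) * sin_even n"
  by (simp add: sin_even_def pochhammer_Suc divide_simps)

lemma sin_odd_pos [simp]: "sin_odd n > 0"
  and sin_even_pos [simp]: "sin_even n > 0"
  by (auto simp: sin_odd_def sin_even_def intro!: divide_pos_pos pochhammer_pos)

lemma sin_odd_nonneg [simp]: "sin_odd n \<ge> 0"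
  and sin_even_nonneg [simp]: "sin_even n \<ge> 0"
  by (simp_all add: less_imp_le)

lemma sin_odd_le_1: "sin_odd n \<le> 1"
proof (induction n)
  case (Suc n)
  have "real (2 * n + 3) * sin_odd (Suc n) \<le> real (2 * n + 3) * 1"
    unfolding sin_odd_Suc using Suc.IH by (intro mult_mono) auto
  then show ?case
    by (simp only: mult_le_cancel_left_pos)
qed simp

lemma sin_even_le_1: "sin_even n \<le> 1"
proof (induction n)
  case (Suc n)
  have "real (2 * n + 2) * sin_even (Suc n) \<le> real (2 * n + 2) * 1"
    unfolding sin_even_Suc using Suc.IH by (intro mult_mono) auto
  then show ?case
    by (simp only: mult_le_cancel_left_pos)
qed simp

text \<open>Multiplying the two recursions leaves the ratio (2n + 1)/(2n + 3), which telescopes.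
  This is what later reduces a squared Wallis number to a single one.\<close>

lemma sin_odd_mult_even: "sin_odd n * sin_even n = 1 / odd_of n"
proof (induction n)
  case 0
  then show ?case by (simp add: odd_of_def)
next
  case (Suc n)
  have "real (2 * n + 3) * real (2 * n + 2) * (sin_odd (Suc n) * sin_even (Suc n))
     = (real (2 * n + 3) * sin_odd (Suc n)) * (real (2 * n + 2) * sin_even (Suc n))"
    by (simp only: mult_ac)
  also have "\<dots> = real (2 * n + 2) * real (2 * n + 1) * (sin_odd n * sin_even n)"
    unfolding sin_odd_Suc sin_even_Suc by (simp only: mult_ac)
  also have "\<dots> = real (2 * n + 2) * 1"
  proof -
    have "real (2 * n + 1) = odd_of n"
      by (simp add: odd_of_def)
    then show ?thesis
      unfolding Suc.IH by simp
  qed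
  finally have "real (2 * n + 2) * (real (2 * n + 3) * (sin_odd (Suc n) * sin_even (Suc n))) = real (2 * n + 2) * 1"
    by (simp only: mult_ac)
  then have "real (2 * n + 3) * (sin_odd (Suc n) * sin_even (Suc n)) = 1"
    by (subst (asm) mult_cancel_left) auto
  then show ?case
    by (simp add: odd_of_def field_simps)
qed

text \<open>The partial products of Wallis are the reciprocals of these terms.\<close>

lemma tendsto_sin_even_square: "(\<lambda>n. odd_of n * sin_even n ^ 2) \<longlonglongrightarrow> 2 / pi"
proof -
  have eq: "(\<Prod>k=1..n. (4*real k^2) / (4*real k^2 - 1)) = inverse (odd_of n * sin_even n ^ 2)" for n
  proof (induction n)
    case 0
    then show ?case by (simp add: odd_of_def)
  next
    case (Suc n)
    have v: "sin_even (Suc n) = real (2 * n + 1) * sin_even n / real (2 * n + 2)"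
      using sin_even_Suc[of n] by (simp add: field_simps)
    have f: "4 * real (Suc n) ^ 2 - 1 = real (2 * n + 1) * real (2 * n + 3)"
      by (simp add: power2_eq_square algebra_simps)
    have "(\<Prod>k=1..Suc n. (4*real k^2) / (4*real k^2 - 1)) =
       inverse (odd_of n * sin_even n ^ 2) * (4 * real (Suc n) ^ 2 / (real (2 * n + 1) * real (2 * n + 3)))"
      unfolding f[symmetric] using Suc.IH by simp
    also have "\<dots> = inverse (odd_of (Suc n) * sin_even (Suc n) ^ 2)"
      unfolding v odd_of_def by (simp add: divide_simps power2_eq_square) (simp add: algebra_simps)
    finally show ?case .
  qed
  from tendsto_inverse[OF wallis[unfolded eq]] show ?thesis
    by simp
qed

lemma sin_even_square_bound: "\<exists>C. \<forall>n. sin_even n ^ 2 \<le> C / odd_of n"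
proof -
  have "Bseq (\<lambda>n. odd_of n * sin_even n ^ 2)"
    using tendsto_sin_even_square by (rule convergent_imp_Bseq[OF convergentI])
  then obtain C where "\<And>n. norm (odd_of n * sin_even n ^ 2) \<le> C"
    by (auto simp: Bseq_def)
  then have "sin_even n ^ 2 \<le> C / odd_of n" for n
    by (simp add: abs_mult field_simps)
  then show ?thesis by blast
qed

text \<open>Termwise the integral of x^(2m) (2/pi) K(x) over [0,1], with K the complete elliptic
  integral; it is the inner sum of both double series.\<close>

definition elliptic_moment :: "nat \<Rightarrow> real" where
  "elliptic_moment m = (\<Sum>n. sin_even n ^ 2 / odd_of (m + n))"

lemma elliptic_moment_sums: "(\<lambda>n. sin_even n ^ 2 / odd_of (m + n)) sums elliptic_moment m"
  unfolding elliptic_moment_def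
proof (rule summable_sums)
  obtain C where C: "\<And>n. sin_even n ^ 2 \<le> C / odd_of n"
    using sin_even_square_bound by blast
  show "summable (\<lambda>n. sin_even n ^ 2 / odd_of (m + n))"
  proof (rule summable_comparison_test')
    show "summable (\<lambda>n. C * (1 / odd_of n ^ 2))"
      by (intro summable_mult summable_odd_of_power) simp
    show "norm (sin_even n ^ 2 / odd_of (m + n)) \<le> C * (1 / odd_of n ^ 2)" for n
    proof -
      have "sin_even n ^ 2 / odd_of (m + n) \<le> sin_even n ^ 2 / odd_of n"
        by (intro divide_left_mono) (auto simp: odd_of_def intro!: mult_pos_pos)
      also have "\<dots> \<le> (C / odd_of n) / odd_of n"
        using C by (intro divide_right_mono) auto
      finally show ?thesis
        by (simp add: power2_eq_square)
    qed
  qed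
qed

text \<open>The summand is telescoping: this is Green's identity, term by term, for the operator
  \<open>y \<mapsto> (x (1 - x\<^sup>2) y')' - x y\<close> that annihilates the complete elliptic integral
  \<open>\<pi>/2 \<Sum> V\<^sub>n\<^sup>2 x\<^sup>2\<^sup>n\<close>.\<close>

lemma elliptic_moment_recursion:
  "real (2 * m + 2) ^ 2 * elliptic_moment (Suc m) = odd_of m ^ 2 * elliptic_moment m + 2 / pi"
proof -
  define B where "B n = sin_even n ^ 2" for n
  define g where "g n = real (2 * n) ^ 2 * B n / odd_of (m + n)" for n
  have B: "real (2 * n + 2) ^ 2 * B (Suc n) = real (2 * n + 1) ^ 2 * B n" for n
    using arg_cong[OF sin_even_Suc[of n], of "\<lambda>x. x ^ 2"] by (simp add: B_def power_mult_distrib)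
  have step: "odd_of m ^ 2 * (B n / odd_of (m + n)) - real (2 * m + 2) ^ 2 * (B n / odd_of (Suc m + n))
      = g n - g (Suc n)" for n
  proof -
    have "g (Suc n) = real (2 * n + 1) ^ 2 * B n / odd_of (Suc m + n)"
      using B[of n] by (simp add: g_def)
    moreover have "odd_of m ^ 2 / odd_of (m + n) - real (2 * m + 2) ^ 2 / odd_of (Suc m + n) =
       real (2 * n) ^ 2 / odd_of (m + n) - real (2 * n + 1) ^ 2 / odd_of (Suc m + n)"
    proof -
      have "odd_of m ^ 2 - real (2 * n) ^ 2 = odd_of (m + n) * (odd_of m - 2 * real n)"
        "real (2 * m + 2) ^ 2 - real (2 * n + 1) ^ 2 = odd_of (Suc m + n) * (odd_of m - 2 * real n)"
        by (simp_all add: odd_of_def power2_eq_square algebra_simps)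
      then have "(odd_of m ^ 2 - real (2 * n) ^ 2) / odd_of (m + n) =
          (real (2 * m + 2) ^ 2 - real (2 * n + 1) ^ 2) / odd_of (Suc m + n)"
        by simp
      then show ?thesis
        by (simp only: diff_divide_distrib)
    qed
    then have "B n * (odd_of m ^ 2 / odd_of (m + n) - real (2 * m + 2) ^ 2 / odd_of (Suc m + n)) =
       B n * (real (2 * n) ^ 2 / odd_of (m + n) - real (2 * n + 1) ^ 2 / odd_of (Suc m + n))"
      by (simp only:)
    ultimately show ?thesis
      by (simp add: g_def right_diff_distrib mult.commute)
  qed
  \<comment> \<open>The boundary term at infinity does not vanish: Wallis makes it 2/pi, the
    inhomogeneous term of the recursion.\<close>
  have "g \<longlonglongrightarrow> 2 / pi"
  proof -
    have "(\<lambda>n. (odd_of n * B n) * (real (2 * n) ^ 2 / (odd_of n * odd_of (m + n)))) \<longlonglongrightarrow> 2 / pi * 1"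
    proof (rule tendsto_mult)
      show "(\<lambda>n. odd_of n * B n) \<longlonglongrightarrow> 2 / pi"
        unfolding B_def by (rule tendsto_sin_even_square)
      show "(\<lambda>n. real (2 * n) ^ 2 / (odd_of n * odd_of (m + n))) \<longlonglongrightarrow> 1"
        unfolding odd_of_def by real_asymp
    qed
    then show ?thesis
      by (simp add: g_def [abs_def] field_simps)
  qed
  from telescope_sums'[OF this] have "(\<lambda>n. g n - g (Suc n)) sums (- (2 / pi))"
    by (simp add: g_def)
  moreover have "(\<lambda>n. g n - g (Suc n)) sums
      (odd_of m ^ 2 * elliptic_moment m - real (2 * m + 2) ^ 2 * elliptic_moment (Suc m))"
    unfolding step[symmetric] B_def by (intro sums_diff sums_mult elliptic_moment_sums)
  ultimately have "- (2 / pi) = odd_of m ^ 2 * elliptic_moment m - real (2 * m + 2) ^ 2 * elliptic_moment (Suc m)"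
    by (rule sums_unique2)
  then show ?thesis by simp
qed

section \<open>Power series in the sine and the half-angle tangent\<close>

lemma DERIV_zero_imp_eq:
  fixes f :: "real \<Rightarrow> real"
  assumes "\<And>x. 0 < x \<Longrightarrow> x < b \<Longrightarrow> (f has_real_derivative 0) (at x)"
    and "continuous_on {0..<b} f" and t: "0 \<le> t" "t < b"
  shows "f t = f 0"
proof (cases "t = 0")
  case False
  show ?thesis
  proof (rule DERIV_isconst_end[of 0 t f])
    show "continuous_on {0..t} f"
      by (rule continuous_on_subset[OF assms(2)]) (use t in auto)
  qed (use assms False in auto)
qed simp

lemma DERIV_zero_imp_eq_0:
  fixes f :: "real \<Rightarrow> real"
  assumes "\<And>x. 0 \<le> x \<Longrightarrow> x < b \<Longrightarrow> (f has_real_derivative 0) (at x)" "0 \<le> t" "t < b"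
  shows "f t = f 0"
  by (rule DERIV_zero_imp_eq[OF _ _ assms(2,3)])
     (auto intro!: assms(1) continuous_at_imp_continuous_on DERIV_isCont[OF assms(1)])

lemma sin_bounds_Ioo:
  assumes "0 < t" "t < pi / 2"
  shows "0 < sin t" "sin t < 1" "0 < cos t" "\<bar>sin t\<bar> < 1"
proof -
  show "0 < sin t" "0 < cos t"
    using assms by (auto intro: sin_gt_zero cos_gt_zero)
  then have "sin t ^ 2 < 1 ^ 2"
    by (simp add: sin_squared_eq)
  then show "sin t < 1"
    by (rule power_less_imp_less_base) simp
  with \<open>0 < sin t\<close> show "\<bar>sin t\<bar> < 1"
    by simp
qed

lemma abs_sin_less_1:
  assumes "0 \<le> t" "t < pi / 2"
  shows "\<bar>sin t\<bar> < 1"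
  using sin_bounds_Ioo[of t] assms by (cases "t = 0") auto

text \<open>The series of arcsin y / sqrt(1 - y^2).\<close>

definition odd_powser :: "real \<Rightarrow> real" where
  "odd_powser y = (\<Sum>n. sin_odd n * y ^ (1 + 2 * n))"

lemma abs_sin_odd_le: "\<bar>sin_odd n\<bar> \<le> 1" and abs_sin_even_le: "\<bar>sin_even n\<bar> \<le> 1"
  by (simp_all add: sin_odd_le_1 sin_even_le_1)

text \<open>The recursion of \<open>sin_odd\<close> is this linear differential equation read
  coefficientwise; substituting y = sin t makes it elementary.\<close>

lemma DERIV_odd_powser:
  assumes "\<bar>y\<bar> < 1"
  shows "\<exists>d. (odd_powser has_real_derivative d) (at y) \<and> (1 - y ^ 2) * d = 1 + y * odd_powser y"
proof (intro exI conjI)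
  let ?a = "\<lambda>n. sin_odd n * (real (1 + 2 * n) * y ^ (1 + 2 * n - 1))"
  note powser = DERIV_sparse_powser[where c = sin_odd and p = 1, OF abs_sin_odd_le assms]
  show "(odd_powser has_real_derivative suminf ?a) (at y)"
    unfolding odd_powser_def [abs_def] by (rule powser(2))
  have "?a (Suc n) = y ^ 2 * ?a n + y * (sin_odd n * y ^ (1 + 2 * n))" for n
  proof -
    have "?a (Suc n) = (real (2 * n + 3) * sin_odd (Suc n)) * y ^ (2 * n + 2)"
      by simp
    also have "\<dots> = real (2 * n + 2) * sin_odd n * y ^ (2 * n + 2)"
      by (simp only: sin_odd_Suc)
    finally show ?thesis
      by (simp add: algebra_simps power2_eq_square)
  qed
  then have "(\<Sum>n. ?a (Suc n)) = y ^ 2 * suminf ?a + y * odd_powser y"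
    using powser(1,3) by (simp only: odd_powser_def suminf_add[symmetric] suminf_mult summable_mult)
  moreover have "suminf ?a = ?a 0 + (\<Sum>n. ?a (Suc n))"
    using suminf_split_head[OF powser(3)] by simp
  ultimately have "suminf ?a = 1 + (y ^ 2 * suminf ?a + y * odd_powser y)"
    by simp
  then show "(1 - y ^ 2) * suminf ?a = 1 + y * odd_powser y"
    by (simp add: algebra_simps)
qed

lemma odd_powser_sin:
  assumes t: "0 \<le> t" "t < pi / 2"
  shows "odd_powser (sin t) * cos t = t"
proof -
  define f where "f t = odd_powser (sin t) * cos t - t" for t
  have D: "(f has_real_derivative 0) (at t)" if "\<bar>sin t\<bar> < 1" for t
  proof -
    from DERIV_odd_powser[OF that] obtain d where
      d: "(odd_powser has_real_derivative d) (at (sin t))" "(1 - sin t ^ 2) * d = 1 + sin t * odd_powser (sin t)"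
      by blast
    have chain: "((\<lambda>t. odd_powser (sin t)) has_real_derivative (d * cos t)) (at t)"
      by (rule DERIV_chain2[where g = sin, OF d(1) DERIV_sin])
    have "(f has_real_derivative (d * cos t * cos t + odd_powser (sin t) * (- sin t) - 1)) (at t)"
      unfolding f_def by (auto intro!: derivative_eq_intros chain)
    moreover have "d * cos t * cos t = 1 + sin t * odd_powser (sin t)"
      using d(2) unfolding cos_squared_eq[symmetric] by (simp add: power2_eq_square mult_ac)
    ultimately show ?thesis by simp
  qed
  have "f t = f 0"
    by (rule DERIV_zero_imp_eq_0[OF D[OF abs_sin_less_1] t])
  then show ?thesis
    by (simp add: f_def odd_powser_def)
qed

text \<open>The same scheme for 1/sqrt(1 - y^2), with the homogeneous equation (1 - y^2) v' = y
  v.\<close>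

lemma even_powser_sin:
  assumes t: "0 \<le> t" "t < pi / 2"
  shows "(\<Sum>n. sin_even n * sin t ^ (2 * n)) * cos t = 1"
proof -
  define v where "v y = (\<Sum>n. sin_even n * y ^ (0 + 2 * n))" for y :: real
  have v: "\<exists>d. (v has_real_derivative d) (at y) \<and> (1 - y ^ 2) * d = y * v y" if y: "\<bar>y\<bar> < 1" for y
  proof (intro exI conjI)
    let ?a = "\<lambda>n. sin_even n * (real (0 + 2 * n) * y ^ (0 + 2 * n - 1))"
    note powser = DERIV_sparse_powser[where c = sin_even and p = 0, OF abs_sin_even_le y]
    show "(v has_real_derivative suminf ?a) (at y)"
      unfolding v_def [abs_def] by (rule powser(2))
    have "?a (Suc n) = y ^ 2 * ?a n + y * (sin_even n * y ^ (0 + 2 * n))" for n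
    proof -
      have "?a (Suc n) = (real (2 * n + 2) * sin_even (Suc n)) * y ^ (2 * n + 1)"
        by simp
      also have "\<dots> = real (2 * n + 1) * sin_even n * y ^ (2 * n + 1)"
        by (simp only: sin_even_Suc)
      also have "\<dots> = y ^ 2 * ?a n + y * (sin_even n * y ^ (0 + 2 * n))"
        by (cases n) (simp_all add: algebra_simps power2_eq_square)
      finally show ?thesis .
    qed
    then have "(\<Sum>n. ?a (Suc n)) = y ^ 2 * suminf ?a + y * v y"
      using powser(1,3) by (simp only: v_def suminf_add[symmetric] suminf_mult summable_mult)
    moreover have "suminf ?a = ?a 0 + (\<Sum>n. ?a (Suc n))"
      using suminf_split_head[OF powser(3)] by simp
    ultimately have "suminf ?a = y ^ 2 * suminf ?a + y * v y"
      by simp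
    then show "(1 - y ^ 2) * suminf ?a = y * v y"
      by (simp add: algebra_simps)
  qed
  define f where "f t = v (sin t) * cos t" for t
  have D: "(f has_real_derivative 0) (at t)" if "\<bar>sin t\<bar> < 1" for t
  proof -
    from v[OF that] obtain d where
      d: "(v has_real_derivative d) (at (sin t))" "(1 - sin t ^ 2) * d = sin t * v (sin t)"
      by blast
    have chain: "((\<lambda>t. v (sin t)) has_real_derivative (d * cos t)) (at t)"
      by (rule DERIV_chain2[where g = sin, OF d(1) DERIV_sin])
    have "(f has_real_derivative (d * cos t * cos t + v (sin t) * (- sin t))) (at t)"
      unfolding f_def by (auto intro!: derivative_eq_intros chain)
    moreover have "d * cos t * cos t = sin t * v (sin t)"
      using d(2) unfolding cos_squared_eq[symmetric] by (simp add: power2_eq_square mult_ac)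
    ultimately show ?thesis by simp
  qed
  have "f t = f 0"
    by (rule DERIV_zero_imp_eq_0[OF D[OF abs_sin_less_1] t])
  moreover have "v 0 = 1"
    unfolding v_def using suminf_finite[of "{0}" "\<lambda>n. sin_even n * 0 ^ (0 + 2 * n)"] by simp
  ultimately show ?thesis
    by (simp add: f_def v_def)
qed

lemma even_powser_integral_sums:
  assumes t: "0 \<le> t" "t < pi / 2"
  shows "(\<lambda>n. sin_even n / odd_of n * sin t ^ (1 + 2 * n)) sums t"
proof -
  have b: "\<bar>sin_even n / odd_of n\<bar> \<le> 1" for n
    using order.trans[OF sin_even_le_1[of n] odd_of_pos(2)[of n]] by (simp add: divide_le_eq)
  note powser = DERIV_sparse_powser[where c = "\<lambda>n. sin_even n / odd_of n" and p = 1, OF b]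
  define f where "f t = (\<Sum>n. sin_even n / odd_of n * sin t ^ (1 + 2 * n)) - t" for t
  have D: "(f has_real_derivative 0) (at t)" if "0 \<le> t" "t < pi / 2" for t
  proof -
    have s: "\<bar>sin t\<bar> < 1"
      by (rule abs_sin_less_1[OF that])
    have odd_of_eq: "real (1 + 2 * n) = odd_of n" for n
      by (simp add: odd_of_def)
    have "(\<Sum>n. sin_even n / odd_of n * (real (1 + 2 * n) * sin t ^ (1 + 2 * n - 1))) * cos t =
        (\<Sum>n. sin_even n * sin t ^ (2 * n)) * cos t"
      unfolding odd_of_eq by simp
    also have "\<dots> = 1"
      by (rule even_powser_sin[OF that])
    finally show ?thesis
      unfolding f_def using DERIV_chain2[where g = sin, OF powser(2)[OF s] DERIV_sin]
      by (auto intro!: derivative_eq_intros)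
  qed
  have "f t = f 0"
    by (rule DERIV_zero_imp_eq_0[OF D t])
  then have "(\<Sum>n. sin_even n / odd_of n * sin t ^ (1 + 2 * n)) = t"
    by (simp add: f_def)
  with summable_sums[OF powser(1)[OF abs_sin_less_1[OF t]]] show ?thesis
    by simp
qed

text \<open>The derivative in t is \<open>odd_powser (sin t) * cos t\<close>, which is t.\<close>

lemma arcsin_square_sums:
  assumes t: "0 \<le> t" "t < pi / 2"
  shows "(\<lambda>n. sin_odd n / real (2 + 2 * n) * sin t ^ (2 + 2 * n)) sums (t ^ 2 / 2)"
proof -
  have b: "\<bar>sin_odd n / real (2 + 2 * n)\<bar> \<le> 1" for n
    using sin_odd_le_1[of n] by (simp add: divide_le_eq)
  note powser = DERIV_sparse_powser[where c = "\<lambda>n. sin_odd n / real (2 + 2 * n)" and p = 2, OF b]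
  define f where "f t = (\<Sum>n. sin_odd n / real (2 + 2 * n) * sin t ^ (2 + 2 * n)) - t ^ 2 / 2" for t
  have D: "(f has_real_derivative 0) (at t)" if "0 \<le> t" "t < pi / 2" for t
  proof -
    have s: "\<bar>sin t\<bar> < 1"
      by (rule abs_sin_less_1[OF that])
    have "(\<Sum>n. sin_odd n / real (2 + 2 * n) * (real (2 + 2 * n) * sin t ^ (2 + 2 * n - 1))) * cos t =
        odd_powser (sin t) * cos t"
      unfolding odd_powser_def by (simp del: of_nat_add of_nat_mult)
    also have "\<dots> = t"
      by (rule odd_powser_sin[OF that])
    finally show ?thesis
      unfolding f_def using DERIV_chain2[where g = sin, OF powser(2)[OF s] DERIV_sin]
      by (auto intro!: derivative_eq_intros)
  qed
  have "f t = f 0"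
    by (rule DERIV_zero_imp_eq_0[OF D t])
  then have "(\<Sum>n. sin_odd n / real (2 + 2 * n) * sin t ^ (2 + 2 * n)) = t ^ 2 / 2"
    by (simp add: f_def)
  with summable_sums[OF powser(1)[OF abs_sin_less_1[OF t]]] show ?thesis
    by (simp only:)
qed

lemma half_tan:
  assumes "0 < t" "t < pi / 2"
  shows "0 < tan (t / 2)" "tan (t / 2) < 1" "sin t = 2 * tan (t / 2) / (1 + tan (t / 2) ^ 2)"
    "((\<lambda>t. tan (t / 2)) has_real_derivative ((1 + tan (t / 2) ^ 2) / 2)) (at t)"
    "arctan (tan (t / 2)) = t / 2"
proof -
  have c: "cos (t / 2) > 0"
    using assms by (intro cos_gt_zero) auto
  show "0 < tan (t / 2)"
    using assms by (intro tan_gt_zero) auto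
  show "tan (t / 2) < 1"
    using tan_bound_pi2[of "t / 2"] assms by auto
  show "sin t = 2 * tan (t / 2) / (1 + tan (t / 2) ^ 2)"
    using sin_tan_half[of "t / 2"] by simp
  show "((\<lambda>t. tan (t / 2)) has_real_derivative ((1 + tan (t / 2) ^ 2) / 2)) (at t)"
    using c tan_sec[of "t / 2"] by (auto intro!: derivative_eq_intros simp: power_inverse)
  show "arctan (tan (t / 2)) = t / 2"
    using assms by (intro arctan_tan) auto
qed

lemma half_tan_continuous: "continuous_on {0..pi / 2} (\<lambda>t. tan (t / 2))"
proof -
  have "cos (t / 2) \<noteq> 0" if "t \<in> {0..pi / 2}" for t
    using that cos_gt_zero_pi[of "t / 2"] pi_gt_zero by auto
  then show ?thesis
    by (intro continuous_intros) auto
qed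

lemma half_tan_range: "t \<in> {0..pi / 2} \<Longrightarrow> tan (t / 2) \<in> {0..1}"
proof -
  assume t: "t \<in> {0..pi / 2}"
  consider "t = 0" | "t = pi / 2" | "0 < t" "t < pi / 2"
    using t by fastforce
  then show ?thesis
  proof cases
    case 2
    then have "t / 2 = pi / 4"
      by simp
    then show ?thesis
      by (simp only: tan_45) simp
  qed (use half_tan[of t] in auto)
qed

text \<open>The inverse tangent integral Ti_2, the primitive of arctan x / x.\<close>

definition inv_tan_integral :: "real \<Rightarrow> real" where
  "inv_tan_integral x = (\<Sum>k. (-1) ^ k / odd_of k ^ 2 * x ^ (1 + 2 * k))"

lemma DERIV_inv_tan_integral:
  assumes "0 < x" "x < 1"
  shows "(inv_tan_integral has_real_derivative (arctan x / x)) (at x)"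
proof -
  have b: "\<bar>(-1) ^ k / odd_of k ^ 2\<bar> \<le> 1" for k
    by (simp add: power_abs divide_le_eq one_le_power)
  have x: "\<bar>x\<bar> < 1"
    using assms by simp
  note powser = DERIV_sparse_powser[where c = "\<lambda>k. (-1) ^ k / odd_of k ^ 2" and p = 1, OF b x]
  have "(\<Sum>k. (-1) ^ k / odd_of k ^ 2 * (real (1 + 2 * k) * x ^ (1 + 2 * k - 1))) = arctan x / x"
  proof -
    have "x * (\<Sum>k. (-1) ^ k / odd_of k ^ 2 * (real (1 + 2 * k) * x ^ (1 + 2 * k - 1))) =
        (\<Sum>k. x * ((-1) ^ k / odd_of k ^ 2 * (real (1 + 2 * k) * x ^ (1 + 2 * k - 1))))"
      by (rule suminf_mult[OF powser(3), symmetric])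
    also have "\<dots> = (\<Sum>k. (-1) ^ k * (1 / real (k * 2 + 1)) * x ^ (k * 2 + 1))"
    proof (rule suminf_cong)
      fix k
      have "real (1 + 2 * k) = odd_of k" "real (k * 2 + 1) = odd_of k"
        by (simp_all add: odd_of_def)
      then show "x * ((-1) ^ k / odd_of k ^ 2 * (real (1 + 2 * k) * x ^ (1 + 2 * k - 1))) =
          (-1) ^ k * (1 / real (k * 2 + 1)) * x ^ (k * 2 + 1)"
        by (simp only:) (simp add: power2_eq_square mult_ac)
    qed
    also have "\<dots> = arctan x"
      using assms by (simp add: arctan_series mult.assoc)
    finally show ?thesis
      using assms by (simp add: field_simps)
  qed
  with powser(2) show ?thesis
    unfolding inv_tan_integral_def [abs_def] by simp
qed

lemma continuous_on_inv_tan_integral: "continuous_on {0..1} inv_tan_integral"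
proof -
  have "summable (\<lambda>k. \<bar>(-1) ^ k / odd_of k ^ 2\<bar>)"
    using summable_odd_of_power[of 2] by (simp add: power_abs)
  from continuous_on_subset[OF continuous_on_sparse_powser[OF this, of 1], of "{0..1}"] show ?thesis
    by (simp add: inv_tan_integral_def [abs_def])
qed

text \<open>Under x = tan(t/2) the form t dt/sin t becomes 2 arctan x dx/x. The explicit primitive
  brings continuity up to both ends, where the integrand is awkward.\<close>

definition phi_int :: "real \<Rightarrow> real" where "phi_int t = 2 * inv_tan_integral (tan (t / 2))"

lemma phi_int_0 [simp]: "phi_int 0 = 0"
  by (simp add: phi_int_def inv_tan_integral_def)

lemma DERIV_phi_int:
  assumes "0 < t" "t < pi / 2"
  shows "(phi_int has_real_derivative (t / sin t)) (at t)"
proof -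
  note x = half_tan[OF assms]
  have "1 + tan (t / 2) ^ 2 \<noteq> 0"
    by (smt (verit) zero_le_power2)
  then have "2 * ((t / 2) / tan (t / 2) * ((1 + tan (t / 2) ^ 2) / 2)) = t / sin t"
    using x(1) unfolding x(3) by (simp add: field_simps)
  with DERIV_cmult[OF DERIV_chain2[OF DERIV_inv_tan_integral[OF x(1,2)] x(4)], of 2] show ?thesis
    unfolding phi_int_def [abs_def] x(5) by simp
qed

lemma continuous_on_phi_int: "continuous_on {0..pi / 2} phi_int"
  unfolding phi_int_def
  by (intro continuous_intros continuous_on_compose2[OF continuous_on_inv_tan_integral half_tan_continuous])
     (use half_tan_range in auto)

text \<open>Both sides have derivative t/sin t on the open interval. At 0 this is the degenerate
  0/0, so only continuity is used there.\<close>

lemma phi_int_sums: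
  assumes t: "0 \<le> t" "t < pi / 2"
  shows "(\<lambda>n. sin_odd n / odd_of n * sin t ^ (1 + 2 * n)) sums phi_int t"
proof -
  have b: "\<bar>sin_odd n / odd_of n\<bar> \<le> 1" for n
    using order.trans[OF sin_odd_le_1[of n] odd_of_pos(2)[of n]] by (simp add: divide_le_eq)
  note powser = DERIV_sparse_powser[where c = "\<lambda>n. sin_odd n / odd_of n" and p = 1, OF b]
  define g where "g t = (\<Sum>n. sin_odd n / odd_of n * sin t ^ (1 + 2 * n))" for t
  have g: "(g has_real_derivative
      ((\<Sum>n. sin_odd n / odd_of n * (real (1 + 2 * n) * sin t ^ (1 + 2 * n - 1))) * cos t)) (at t)"
    if "0 \<le> t" "t < pi / 2" for t
    unfolding g_def by (rule DERIV_chain2[where g = sin, OF powser(2)[OF abs_sin_less_1[OF that]] DERIV_sin])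
  have D: "((\<lambda>t. g t - phi_int t) has_real_derivative 0) (at t)" if t: "0 < t" "t < pi / 2" for t
  proof -
    have s: "\<bar>sin t\<bar> < 1"
      by (rule sin_bounds_Ioo[OF t])
    let ?a = "\<lambda>n. sin_odd n / odd_of n * (real (1 + 2 * n) * sin t ^ (1 + 2 * n - 1))"
    have odd_of_eq: "real (1 + 2 * n) = odd_of n" for n
      by (simp add: odd_of_def)
    have "sin t * suminf ?a = (\<Sum>n. sin t * ?a n)"
      by (rule suminf_mult[OF powser(3)[OF s], symmetric])
    also have "\<dots> = odd_powser (sin t)"
      unfolding odd_powser_def odd_of_eq by (rule suminf_cong) (simp add: mult_ac)
    finally have "suminf ?a * cos t = t / sin t"
      using odd_powser_sin[of t] t sin_bounds_Ioo[OF t] by (simp add: field_simps)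
    then show ?thesis
      using DERIV_diff[OF g[of t] DERIV_phi_int[OF t]] t by simp
  qed
  have "g t - phi_int t = g 0 - phi_int 0"
  proof (rule DERIV_zero_imp_eq[OF _ _ t])
    have "continuous_on {0..<pi / 2} g"
      by (intro continuous_at_imp_continuous_on ballI DERIV_isCont[OF g]) auto
    then show "continuous_on {0..<pi / 2} (\<lambda>t. g t - phi_int t)"
      by (intro continuous_on_diff continuous_on_subset[OF continuous_on_phi_int]) auto
  qed (use D in auto)
  then have "g t = phi_int t"
    by (simp add: g_def)
  with summable_sums[OF powser(1)[OF abs_sin_less_1[OF t]]] show ?thesis
    by (simp add: g_def)
qed

section \<open>Logarithmic moments\<close>

text \<open>A squeeze for products with artanh(sin t), which is singular at pi/2: the bound is
  required at the endpoint too and so fixes the value there to 0.\<close>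

lemma continuous_on_vanishing_at_end:
  fixes f g :: "real \<Rightarrow> real"
  assumes "\<And>t. a \<le> t \<Longrightarrow> t < b \<Longrightarrow> isCont f t"
    and "\<And>t. a \<le> t \<Longrightarrow> t \<le> b \<Longrightarrow> \<bar>f t\<bar> \<le> g t"
    and "continuous_on {a..b} g" "g b = 0"
  shows "continuous_on {a..b} f"
  unfolding continuous_on_eq_continuous_within
proof
  fix t assume t: "t \<in> {a..b}"
  show "continuous (at t within {a..b}) f"
  proof (cases "t = b")
    case True
    then have "f b = 0"
      using assms(2)[of b] assms(4) t by simp
    moreover have "(f \<longlongrightarrow> 0) (at b within {a..b})"
    proof (rule Lim_null_comparison)
      show "\<forall>\<^sub>F t in at b within {a..b}. norm (f t) \<le> g t"
        using assms(2) by (auto simp: eventually_at_filter)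
      show "(g \<longlongrightarrow> 0) (at b within {a..b})"
      proof -
        have "(g \<longlongrightarrow> g b) (at b within {a..b})"
          using assms(3) t True by (auto simp: continuous_on_def)
        then show ?thesis
          by (simp add: assms(4))
      qed
    qed
    ultimately show ?thesis
      using True by (simp add: continuous_within)
  next
    case False
    then have "isCont f t"
      using assms(1)[of t] t by auto
    then show ?thesis
      by (rule continuous_at_imp_continuous_at_within)
  qed
qed

lemma ln_le_two_sqrt:
  assumes "(0::real) < y"
  shows "ln y \<le> 2 * sqrt y"
proof -
  have "ln y = 2 * ln (sqrt y)"
    using assms by (simp add: ln_sqrt)
  also have "\<dots> \<le> 2 * (sqrt y - 1)"
    using ln_le_minus_one[of "sqrt y"] assms by simp
  finally show ?thesis by simp
qed

lemma artanh_sin_eq_ln: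
  assumes "0 \<le> t" "t < pi / 2"
  shows "artanh (sin t) = ln ((1 + sin t) / cos t)"
proof -
  have c: "cos t > 0"
    using assms cos_gt_zero_pi[of t] by simp
  have s: "1 - sin t > 0" "1 + sin t > 0"
    using abs_sin_less_1[OF assms] by auto
  have "(1 + sin t) / (1 - sin t) = ((1 + sin t) / cos t) ^ 2"
  proof -
    have "cos t ^ 2 = (1 - sin t) * (1 + sin t)"
      by (simp add: cos_squared_eq power2_eq_square algebra_simps)
    then show ?thesis
      using s by (simp add: power_divide) (simp add: power2_eq_square)
  qed
  then show ?thesis
    using c s by (simp add: artanh_def ln_realpow)
qed

lemma artanh_sin_nonneg:
  assumes "0 \<le> t" "t \<le> pi / 2"
  shows "artanh (sin t) \<ge> 0"
proof (cases "t = pi / 2")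
  case False
  have "0 \<le> sin t" "sin t < 1"
    using abs_sin_less_1[of t] assms False sin_ge_zero[of t] by auto
  then show ?thesis
    by (simp add: artanh_def)
next
  \<comment> \<open>By the conventions 2/0 = 0 and ln 0 = 0, \<open>artanh 1\<close> is 0.\<close>
  case True
  show ?thesis
    unfolding True by (simp add: artanh_def)
qed

text \<open>The crude ln y <= 2 sqrt y costs only sqrt(cos t) of the factor cos t, so the bound
  still vanishes at pi/2.\<close>

lemma cos_artanh_sin_bound:
  assumes "0 \<le> t" "t \<le> pi / 2"
  shows "cos t * artanh (sin t) \<le> 2 * sqrt (cos t * (1 + sin t))"
proof (cases "t = pi / 2")
  case False
  then have t: "0 \<le> t" "t < pi / 2"
    using assms by auto
  have c: "cos t > 0"
    using t cos_gt_zero_pi[of t] by simp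
  have s: "1 + sin t > 0"
    using abs_sin_less_1[OF t] by auto
  have "cos t * artanh (sin t) \<le> cos t * (2 * sqrt ((1 + sin t) / cos t))"
    unfolding artanh_sin_eq_ln[OF t] using c s by (intro mult_left_mono ln_le_two_sqrt) auto
  also have "\<dots> = 2 * sqrt (cos t ^ 2 * ((1 + sin t) / cos t))"
  proof -
    have "cos t * (2 * sqrt ((1 + sin t) / cos t)) = 2 * (sqrt (cos t ^ 2) * sqrt ((1 + sin t) / cos t))"
      using c by simp
    then show ?thesis
      by (simp only: real_sqrt_mult)
  qed
  also have "cos t ^ 2 * ((1 + sin t) / cos t) = cos t * (1 + sin t)"
    using c by (simp add: power2_eq_square)
  finally show ?thesis .
next
  case True
  show ?thesis
    unfolding True by simp
qed

lemma DERIV_artanh_sin: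
  assumes "0 \<le> t" "t < pi / 2"
  shows "((\<lambda>t. artanh (sin t)) has_real_derivative (1 / cos t)) (at t)"
proof -
  have c: "cos t > 0"
    using assms cos_gt_zero_pi[of t] by simp
  have "((\<lambda>t. artanh (sin t)) has_real_derivative (1 / (1 - sin t ^ 2) * cos t)) (at t)"
    by (rule DERIV_chain2[where g = sin, OF artanh_real_has_field_derivative[OF abs_sin_less_1[OF assms]] DERIV_sin])
  also have "1 / (1 - sin t ^ 2) * cos t = 1 / cos t"
    unfolding cos_squared_eq[symmetric] using c by (simp add: power2_eq_square)
  finally show ?thesis .
qed

lemma has_integral_sin_power_step:
  assumes "((\<lambda>t. sin t ^ k) has_integral I) {0..pi / 2}"
  shows "((\<lambda>t. sin t ^ (k + 2)) has_integral (real (k + 1) / real (k + 2) * I)) {0..pi / 2}"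
proof -
  have D: "((\<lambda>t. sin t ^ (k + 1) * cos t) has_vector_derivative
      (real (k + 1) * sin t ^ k - real (k + 2) * sin t ^ (k + 2))) (at t)" for t :: real
  proof -
    have "((\<lambda>t. sin t ^ (k + 1) * cos t) has_real_derivative
        (real (k + 1) * sin t ^ k * cos t * cos t + sin t ^ (k + 1) * (- sin t))) (at t)"
      by (rule DERIV_cong[OF DERIV_mult[OF DERIV_power[OF DERIV_sin, of "k + 1"] DERIV_cos]])
         (simp add: algebra_simps)
    also have "real (k + 1) * sin t ^ k * cos t * cos t + sin t ^ (k + 1) * (- sin t) =
        real (k + 1) * sin t ^ k * (cos t ^ 2) - sin t ^ (k + 2)"
      by (simp add: power2_eq_square)
    also have "\<dots> = real (k + 1) * sin t ^ k - real (k + 2) * sin t ^ (k + 2)"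
      unfolding cos_squared_eq by (simp add: algebra_simps power_add power2_eq_square)
    finally show ?thesis
      by (simp add: has_real_derivative_iff_has_vector_derivative)
  qed
  have "((\<lambda>t. real (k + 1) * sin t ^ k - real (k + 2) * sin t ^ (k + 2)) has_integral
      (sin (pi / 2) ^ (k + 1) * cos (pi / 2) - sin 0 ^ (k + 1) * cos 0)) {0..pi / 2}"
    by (rule fundamental_theorem_of_calculus_interior; (rule D | intro continuous_intros | simp))
  then have "((\<lambda>t. real (k + 1) * sin t ^ k - real (k + 2) * sin t ^ (k + 2)) has_integral 0) {0..pi / 2}"
    by simp
  from has_integral_diff[OF has_integral_mult_right[OF assms, of "real (k + 1)"] this]
  have "((\<lambda>t. real (k + 2) * sin t ^ (k + 2)) has_integral (real (k + 1) * I)) {0..pi / 2}"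
    by simp
  from has_integral_mult_right[OF this, of "1 / real (k + 2)"] show ?thesis
    by simp
qed

lemma has_integral_sin_odd_power: "((\<lambda>t. sin t ^ (2 * n + 1)) has_integral sin_odd n) {0..pi / 2}"
proof (induction n)
  case 0
  have "((\<lambda>t. sin t) has_integral (- cos (pi / 2) - - cos 0)) {0..pi / 2}"
    by (rule fundamental_theorem_of_calculus_interior)
       (auto intro!: derivative_eq_intros continuous_intros simp flip: has_real_derivative_iff_has_vector_derivative)
  then show ?case by simp
next
  case (Suc n)
  have "real (2 * n + 1 + 1) / real (2 * n + 1 + 2) * sin_odd n = sin_odd (Suc n)"
    using sin_odd_Suc[of n] by (simp add: field_simps)
  moreover have "2 * n + 1 + 2 = 2 * Suc n + 1"
    by simp
  ultimately show ?case
    using has_integral_sin_power_step[OF Suc.IH] by (simp only:)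
qed

lemma has_integral_sin_even_power: "((\<lambda>t. sin t ^ (2 * n)) has_integral (pi / 2 * sin_even n)) {0..pi / 2}"
proof (induction n)
  case 0
  then show ?case
    using has_integral_const_real[of "1::real" 0 "pi / 2"] by simp
next
  case (Suc n)
  have "real (2 * n + 1) / real (2 * n + 2) * (pi / 2 * sin_even n) = pi / 2 * sin_even (Suc n)"
  proof -
    have "sin_even (Suc n) = real (2 * n + 1) * sin_even n / real (2 * n + 2)"
      using sin_even_Suc[of n] by (simp add: field_simps)
    then show ?thesis
      by (simp only:) simp
  qed
  moreover have "2 * n + 2 = 2 * Suc n"
    by simp
  ultimately show ?case
    using has_integral_sin_power_step[OF Suc.IH] by (simp only:)
qed

lemma has_integral_t_over_sin: "((\<lambda>t. t / sin t) has_integral phi_int (pi / 2)) {0..pi / 2}"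
proof -
  have "((\<lambda>t. t / sin t) has_integral (phi_int (pi / 2) - phi_int 0)) {0..pi / 2}"
    by (rule fundamental_theorem_of_calculus_interior)
       (use DERIV_phi_int continuous_on_phi_int in \<open>auto simp flip: has_real_derivative_iff_has_vector_derivative\<close>)
  then show ?thesis by simp
qed

lemma le_tan:
  assumes "0 \<le> u" "u < pi / 2"
  shows "u \<le> tan u"
proof -
  have "tan 0 - 0 \<le> tan u - u"
  proof (rule DERIV_nonneg_imp_nondecreasing[OF assms(1)])
    fix x assume x: "0 \<le> x" "x \<le> u"
    have c: "cos x > 0"
      using x assms cos_gt_zero_pi[of x] by simp
    have "((\<lambda>u. tan u - u) has_real_derivative (tan x ^ 2)) (at x)"
      using c tan_sec[of x] by (auto intro!: derivative_eq_intros simp: power_inverse)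
    then show "\<exists>y. ((\<lambda>u. tan u - u) has_real_derivative y) (at x) \<and> 0 \<le> y"
      by (intro exI conjI) auto
  qed
  then show ?thesis by simp
qed

text \<open>Transfers the bound for cos t artanh(sin t) to (pi/2 - t) artanh(sin t). With u = pi/2 -
  t it follows from u <= 2 tan(u/2) <= 2 sin u.\<close>

lemma pi_half_minus_le_cos:
  assumes "0 \<le> t" "t \<le> pi / 2"
  shows "pi / 2 - t \<le> 2 * cos t"
proof -
  define u where "u = pi / 2 - t"
  have u: "0 \<le> u" "u \<le> pi / 2"
    using assms by (auto simp: u_def)
  have x: "0 \<le> tan (u / 2)" "tan (u / 2) \<le> 1"
    using half_tan_range[of u] u by auto
  have "u \<le> 2 * tan (u / 2)"
    using le_tan[of "u / 2"] u pi_gt_zero by simp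
  also have "\<dots> \<le> 2 * (2 * tan (u / 2) / (1 + tan (u / 2) ^ 2))"
  proof -
    have "tan (u / 2) ^ 2 \<le> 1"
      using x by (simp add: power_le_one)
    then have "tan (u / 2) * (1 + tan (u / 2) ^ 2) \<le> tan (u / 2) * 2"
      using x by (intro mult_left_mono) auto
    moreover have "1 + tan (u / 2) ^ 2 > 0"
      by (simp add: add_pos_nonneg)
    ultimately have "tan (u / 2) \<le> 2 * tan (u / 2) / (1 + tan (u / 2) ^ 2)"
      by (simp add: pos_le_divide_eq mult.commute)
    then show ?thesis by simp
  qed
  also have "2 * tan (u / 2) / (1 + tan (u / 2) ^ 2) = sin u"
    using sin_tan_half[of "u / 2"] by simp
  finally show ?thesis
    by (simp add: u_def sin_diff)
qed

lemma continuous_on_cos_artanh_bound: "continuous_on A (\<lambda>t. 2 * (2 * sqrt (cos t * (1 + sin t))))"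
  by (intro continuous_intros)

text \<open>Integration by parts with the primitive t - pi/2 of 1, chosen to vanish at the singular
  end. The remaining integrand (pi/2 - t)/cos t is t/sin t reflected.\<close>

lemma has_integral_artanh_sin: "((\<lambda>t. artanh (sin t)) has_integral phi_int (pi / 2)) {0..pi / 2}"
proof -
  define f where "f t = - ((pi / 2 - t) * artanh (sin t)) - phi_int (pi / 2 - t)" for t
  have "((\<lambda>t. artanh (sin t)) has_integral (f (pi / 2) - f 0)) {0..pi / 2}"
  proof (rule fundamental_theorem_of_calculus_interior)
    have "continuous_on {0..pi / 2} (\<lambda>t. (pi / 2 - t) * artanh (sin t))"
    proof (rule continuous_on_vanishing_at_end[OF _ _ continuous_on_cos_artanh_bound])
      show "isCont (\<lambda>t. (pi / 2 - t) * artanh (sin t)) t" if "0 \<le> t" "t < pi / 2" for t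
        by (intro continuous_intros DERIV_isCont[OF DERIV_artanh_sin[OF that]])
      show "\<bar>(pi / 2 - t) * artanh (sin t)\<bar> \<le> 2 * (2 * sqrt (cos t * (1 + sin t)))"
        if t: "0 \<le> t" "t \<le> pi / 2" for t
      proof -
        have "(pi / 2 - t) * artanh (sin t) \<le> 2 * cos t * artanh (sin t)"
          by (rule mult_right_mono[OF pi_half_minus_le_cos[OF t] artanh_sin_nonneg[OF t]])
        then show ?thesis
          using cos_artanh_sin_bound[OF t] artanh_sin_nonneg[OF t] t by (simp add: abs_mult)
      qed
    qed simp
    moreover have "continuous_on {0..pi / 2} (\<lambda>t. phi_int (pi / 2 - t))"
      by (rule continuous_on_compose2[OF continuous_on_phi_int]) (auto intro!: continuous_intros)
    ultimately show "continuous_on {0..pi / 2} f"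
      unfolding f_def by (intro continuous_on_diff continuous_on_minus)
    fix t assume "t \<in> {0<..<pi / 2}"
    then have t: "0 < t" "t < pi / 2"
      by auto
    have "((\<lambda>t. phi_int (pi / 2 - t)) has_real_derivative ((pi / 2 - t) / sin (pi / 2 - t) * (-1))) (at t)"
      by (rule DERIV_chain2[where g = "\<lambda>t. pi / 2 - t", OF DERIV_phi_int]) (use t in \<open>auto intro!: derivative_eq_intros\<close>)
    then have 1: "((\<lambda>t. phi_int (pi / 2 - t)) has_real_derivative (- ((pi / 2 - t) / cos t))) (at t)"
      by (simp add: sin_diff)
    have 2: "((\<lambda>t. artanh (sin t)) has_real_derivative (1 / cos t)) (at t)"
      using t by (intro DERIV_artanh_sin) auto
    have "(f has_real_derivative artanh (sin t)) (at t)"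
      unfolding f_def by (auto intro!: derivative_eq_intros 1 2)
    then show "(f has_vector_derivative artanh (sin t)) (at t)"
      by (simp add: has_real_derivative_iff_has_vector_derivative)
  qed simp
  then show ?thesis
    by (simp add: f_def)
qed

definition log_moment :: "nat \<Rightarrow> real" where
  "log_moment m = integral {0..pi / 2} (\<lambda>t. sin t ^ (2 * m) * artanh (sin t))"

text \<open>Integrates the derivative of sin^(2m+1) t cos t artanh(sin t): the cosine kills the
  boundary value at pi/2 and cancels the derivative 1/cos t of artanh(sin t).\<close>

lemma log_moment_aux:
  assumes "((\<lambda>t. sin t ^ (2 * m) * artanh (sin t)) has_integral R) {0..pi / 2}"
  shows "((\<lambda>t. sin t ^ (2 * Suc m) * artanh (sin t)) has_integral
            ((odd_of m * R + sin_odd m) / real (2 * m + 2))) {0..pi / 2}"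
proof -
  define f where "f t = sin t ^ (2 * m + 1) * (cos t * artanh (sin t))" for t :: real
  define f' where "f' t = odd_of m * (sin t ^ (2 * m) * artanh (sin t)) + sin t ^ (2 * m + 1)
      - real (2 * m + 2) * (sin t ^ (2 * Suc m) * artanh (sin t))" for t :: real
  have "(f' has_integral (f (pi / 2) - f 0)) {0..pi / 2}"
  proof (rule fundamental_theorem_of_calculus_interior)
    have "continuous_on {0..pi / 2} (\<lambda>t. cos t * artanh (sin t))"
    proof (rule continuous_on_vanishing_at_end[OF _ _ continuous_on_cos_artanh_bound])
      show "isCont (\<lambda>t. cos t * artanh (sin t)) t" if "0 \<le> t" "t < pi / 2" for t
        by (intro continuous_intros DERIV_isCont[OF DERIV_artanh_sin[OF that]])
      show "\<bar>cos t * artanh (sin t)\<bar> \<le> 2 * (2 * sqrt (cos t * (1 + sin t)))"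
        if t: "0 \<le> t" "t \<le> pi / 2" for t
      proof -
        have "0 \<le> cos t" "0 \<le> 1 + sin t"
          using t sin_ge_minus_one[of t] by (auto intro: cos_ge_zero simp del: sin_ge_minus_one)
        then have "0 \<le> sqrt (cos t * (1 + sin t))"
          by simp
        then have "cos t * artanh (sin t) \<le> 2 * (2 * sqrt (cos t * (1 + sin t)))"
          using cos_artanh_sin_bound[OF t] by linarith
        moreover have "0 \<le> cos t * artanh (sin t)"
          using \<open>0 \<le> cos t\<close> artanh_sin_nonneg[OF t] by simp
        ultimately show ?thesis
          by (simp only: abs_of_nonneg)
      qed
    qed simp
    moreover have "continuous_on {0..pi / 2} (\<lambda>t::real. sin t ^ (2 * m + 1))"
      by (intro continuous_intros)
    ultimately show "continuous_on {0..pi / 2} f"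
      unfolding f_def by (rule continuous_on_mult[rotated])
    fix t assume "t \<in> {0<..<pi / 2}"
    then have t: "0 < t" "t < pi / 2"
      by auto
    have c: "cos t > 0"
      by (rule sin_bounds_Ioo[OF t])
    have 2: "((\<lambda>t. artanh (sin t)) has_real_derivative (1 / cos t)) (at t)"
      using t by (intro DERIV_artanh_sin) auto
    have "(f has_real_derivative (real (2 * m + 1) * sin t ^ (2 * m) * cos t * (cos t * artanh (sin t))
         + sin t ^ (2 * m + 1) * (- sin t * artanh (sin t) + cos t * (1 / cos t)))) (at t)"
      unfolding f_def
      by (rule DERIV_cong[OF DERIV_mult[OF DERIV_power[OF DERIV_sin, of "2 * m + 1"] DERIV_mult[OF DERIV_cos 2]]])
         (simp add: algebra_simps)
    also have "real (2 * m + 1) * sin t ^ (2 * m) * cos t * (cos t * artanh (sin t))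
         + sin t ^ (2 * m + 1) * (- sin t * artanh (sin t) + cos t * (1 / cos t)) =
         real (2 * m + 1) * sin t ^ (2 * m) * (cos t ^ 2) * artanh (sin t)
         + sin t ^ (2 * m + 1) - sin t ^ (2 * m + 2) * artanh (sin t)"
      using c by (simp add: power2_eq_square algebra_simps)
    also have "\<dots> = f' t"
      unfolding cos_squared_eq f'_def odd_of_def by (simp add: power2_eq_square algebra_simps)
    finally show "(f has_vector_derivative f' t) (at t)"
      by (simp add: has_real_derivative_iff_has_vector_derivative)
  qed simp
  then have "(f' has_integral 0) {0..pi / 2}"
    by (simp add: f_def)
  from has_integral_diff[OF has_integral_add[OF has_integral_mult_right[OF assms, of "odd_of m"]
        has_integral_sin_odd_power[of m]] this]
  have "((\<lambda>t. real (2 * m + 2) * (sin t ^ (2 * Suc m) * artanh (sin t))) has_integral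
      (odd_of m * R + sin_odd m)) {0..pi / 2}"
    by (simp add: f'_def)
  note * = has_integral_mult_right[OF this, of "1 / real (2 * m + 2)"]
  have "1 / real (2 * m + 2) * (real (2 * m + 2) * x) = x" for x
    by simp
  with * have "((\<lambda>t. sin t ^ (2 * Suc m) * artanh (sin t)) has_integral
      (1 / real (2 * m + 2) * (odd_of m * R + sin_odd m))) {0..pi / 2}"
    by (simp only:)
  then show ?thesis
    by (simp only: times_divide_eq_left mult_1_left)
qed

lemma has_integral_log_moment:
  "((\<lambda>t. sin t ^ (2 * m) * artanh (sin t)) has_integral log_moment m) {0..pi / 2}"
proof -
  have "(\<lambda>t. sin t ^ (2 * m) * artanh (sin t)) integrable_on {0..pi / 2}"
  proof (induction m)
    case 0
    then show ?case
      using has_integral_artanh_sin by (auto simp: integrable_on_def)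
  next
    case (Suc m)
    then show ?case
      using log_moment_aux[OF integrable_integral] by (auto simp: integrable_on_def)
  qed
  then show ?thesis
    by (simp add: log_moment_def integrable_integral)
qed

lemma log_moment_0: "log_moment 0 = phi_int (pi / 2)"
  using has_integral_unique[OF has_integral_log_moment[of 0]] has_integral_artanh_sin by simp

lemma log_moment_Suc: "real (2 * m + 2) * log_moment (Suc m) = odd_of m * log_moment m + sin_odd m"
  using has_integral_unique[OF has_integral_log_moment[of "Suc m"] log_moment_aux[OF has_integral_log_moment]]
  by (simp add: field_simps)

text \<open>Both sides obey the same first-order recursion, so it suffices that they agree at 0;
  there each is a multiple of the integral of t/sin t.\<close>

lemma elliptic_moment_eq: "elliptic_moment m = 2 / pi * (sin_even m * log_moment m)"
proof (induction m)
  case 0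
  \<comment> \<open>The arcsine series divided by sin t and integrated term by term; each power of
    sine supplies a second \<open>sin_even n\<close>.\<close>
  have "(\<lambda>n. sin_even n / odd_of n * (pi / 2 * sin_even n)) sums phi_int (pi / 2)"
  proof (rule sums_of_has_integral_nonneg_series)
    show "((\<lambda>t. sin_even n / odd_of n * sin t ^ (2 * n)) has_integral
        sin_even n / odd_of n * (pi / 2 * sin_even n)) {0<..<pi / 2}" for n
      using has_integral_mult_right[OF has_integral_sin_even_power[of n], of "sin_even n / odd_of n"]
      by (simp add: has_integral_Icc_iff_Ioo)
    show "((\<lambda>t. t / sin t) has_integral phi_int (pi / 2)) {0<..<pi / 2}"
      using has_integral_t_over_sin by (simp add: has_integral_Icc_iff_Ioo)
    fix t :: real assume "t \<in> {0<..<pi / 2}"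
    then have t: "0 < t" "t < pi / 2"
      by auto
    show "sin_even n / odd_of n * sin t ^ (2 * n) \<ge> 0" for n
      by (intro mult_nonneg_nonneg) auto
    have "(\<lambda>n. sin_even n / odd_of n * sin t ^ (1 + 2 * n) / sin t) sums (t / sin t)"
      by (intro sums_divide even_powser_integral_sums) (use t in auto)
    then show "(\<lambda>n. sin_even n / odd_of n * sin t ^ (2 * n)) sums (t / sin t)"
      using sin_bounds_Ioo(1)[OF t] by simp
  qed
  from sums_mult[OF this, of "2 / pi"]
  have "(\<lambda>n. sin_even n ^ 2 / odd_of (0 + n)) sums (2 / pi * phi_int (pi / 2))"
    by (simp add: power2_eq_square)
  then have "elliptic_moment 0 = 2 / pi * phi_int (pi / 2)"
    using elliptic_moment_sums sums_unique2 by blast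
  then show ?case
    by (simp add: log_moment_0)
next
  case (Suc m)
  \<comment> \<open>This turns the inhomogeneity \<open>sin_odd m\<close> of the logarithmic
    recursion into a constant, as in the elliptic one.\<close>
  have vw: "odd_of m * (sin_even m * sin_odd m) = 1"
    using sin_odd_mult_even[of m] by (simp add: mult.commute)
  have "real (2 * m + 2) ^ 2 * (sin_even (Suc m) * log_moment (Suc m))
     = (real (2 * m + 2) * sin_even (Suc m)) * (real (2 * m + 2) * log_moment (Suc m))"
    by (simp only: power2_eq_square mult_ac)
  also have "\<dots> = (odd_of m * sin_even m) * (odd_of m * log_moment m + sin_odd m)"
    unfolding sin_even_Suc log_moment_Suc by (simp add: odd_of_def)
  also have "\<dots> = odd_of m ^ 2 * (sin_even m * log_moment m) + odd_of m * (sin_even m * sin_odd m)"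
    by (simp add: power2_eq_square algebra_simps)
  also have "\<dots> = odd_of m ^ 2 * (sin_even m * log_moment m) + 1"
    by (simp only: vw)
  finally have "real (2 * m + 2) ^ 2 * (2 / pi * (sin_even (Suc m) * log_moment (Suc m)))
      = odd_of m ^ 2 * (2 / pi * (sin_even m * log_moment m)) + 2 / pi"
    by (simp add: field_simps)
  also have "\<dots> = real (2 * m + 2) ^ 2 * elliptic_moment (Suc m)"
    unfolding elliptic_moment_recursion Suc.IH ..
  finally show ?case
    by (simp only: mult_cancel_left) auto
qed

section \<open>Evaluation of the integrals\<close>

lemma artanh_sums:
  assumes x: "0 \<le> x" "x < (1::real)"
  shows "(\<lambda>k. x ^ (1 + 2 * k) / odd_of k) sums artanh x"
proof -
  have b: "\<bar>1 / odd_of k\<bar> \<le> 1" for k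
    by (simp add: divide_le_eq)
  note powser = DERIV_sparse_powser[where c = "\<lambda>k. 1 / odd_of k" and p = 1, OF b]
  define f where "f x = (\<Sum>k. 1 / odd_of k * x ^ (1 + 2 * k)) - artanh x" for x :: real
  have D: "(f has_real_derivative 0) (at x)" if "0 \<le> x" "x < 1" for x
  proof -
    have odd_of_eq: "real (1 + 2 * k) = odd_of k" for k
      by (simp add: odd_of_def)
    have x1: "\<bar>x\<bar> < 1" "norm (x ^ 2) < 1"
      using that by (auto simp: power_less_one_iff abs_square_less_1)
    have "(\<Sum>k. 1 / odd_of k * (real (1 + 2 * k) * x ^ (1 + 2 * k - 1))) = (\<Sum>k. (x ^ 2) ^ k)"
      unfolding odd_of_eq by (simp add: power_mult)
    also have "\<dots> = 1 / (1 - x ^ 2)"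
      by (rule suminf_geometric[OF x1(2)])
    finally show ?thesis
      using DERIV_diff[OF powser(2)[OF x1(1)] artanh_real_has_field_derivative[OF x1(1), of UNIV]]
      by (simp add: f_def [abs_def])
  qed
  have "f x = f 0"
    by (rule DERIV_zero_imp_eq_0[OF D x])
  then have "(\<Sum>k. 1 / odd_of k * x ^ (1 + 2 * k)) = artanh x"
    by (simp add: f_def)
  moreover have "(\<lambda>k. 1 / odd_of k * x ^ (1 + 2 * k)) sums (\<Sum>k. 1 / odd_of k * x ^ (1 + 2 * k))"
    by (rule summable_sums[OF powser(1)]) (use x in simp)
  ultimately show ?thesis
    by simp
qed

text \<open>With x = tan(t/2) the quotient (1 + sin t)/(1 - sin t) is the square of (1 + x)/(1 - x),
  so artanh(sin t) has a power series in the variable of \<open>phi_int\<close>.\<close>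

lemma artanh_sin_eq_half_tan:
  assumes "0 < t" "t < pi / 2"
  shows "artanh (sin t) = 2 * artanh (tan (t / 2))"
proof -
  define x where "x = tan (t / 2)"
  have x: "0 < x" "x < 1" "sin t = 2 * x / (1 + x ^ 2)"
    using half_tan[OF assms] by (auto simp: x_def)
  have p: "1 + x ^ 2 > 0"
    by (simp add: add_pos_nonneg)
  have "(1 + sin t) / (1 - sin t) = ((1 + sin t) * (1 + x ^ 2)) / ((1 - sin t) * (1 + x ^ 2))"
    using p by simp
  also have "(1 + sin t) * (1 + x ^ 2) = (1 + x) ^ 2"
    unfolding x(3) using p by (simp add: distrib_right power2_eq_square) (simp add: algebra_simps)
  also have "(1 - sin t) * (1 + x ^ 2) = (1 - x) ^ 2"
    unfolding x(3) using p by (simp add: left_diff_distrib power2_eq_square) (simp add: algebra_simps)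
  finally have "(1 + sin t) / (1 - sin t) = ((1 + x) / (1 - x)) ^ 2"
    by (simp add: power_divide)
  then show ?thesis
    using x by (simp add: artanh_def ln_realpow flip: x_def)
qed

text \<open>The integral of 2 x^(2k) Ti_2(x) over [0,1], written termwise.\<close>

definition euler_row :: "nat \<Rightarrow> real" where
  "euler_row k = (\<Sum>p. 2 * (-1) ^ p / (odd_of p ^ 2 * (odd_of p + odd_of k)))"

lemma summable_euler_row: "summable (\<lambda>p. \<bar>2 * (-1) ^ p / (odd_of p ^ 2 * (odd_of p + odd_of k))\<bar>)"
proof (rule summable_comparison_test')
  show "summable (\<lambda>p. 2 * (1 / odd_of p ^ 2))"
    by (intro summable_mult summable_odd_of_power) simp
  have "1 \<le> odd_of p + odd_of k" for p
    using odd_of_pos(2)[of p] odd_of_pos(4)[of k] by linarith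
  then show "norm \<bar>2 * (-1) ^ p / (odd_of p ^ 2 * (odd_of p + odd_of k))\<bar> \<le> 2 * (1 / odd_of p ^ 2)" for p
    by (auto simp: abs_mult power_abs intro!: divide_left_mono mult_pos_pos)
qed

text \<open>The unordered double sum permits the alternating index inside and the positive one
  outside, the order that integrating the artanh series produces.\<close>

lemma euler_row_sums: "(\<lambda>k. 2 / odd_of k * euler_row k) sums (6 * beta4 - pi * lambda3)"
proof -
  define G :: "nat \<times> nat \<Rightarrow> real" where
    "G = (\<lambda>(p, n). (-1) ^ p / (odd_of p ^ 2 * odd_of n * (odd_of p + odd_of n)))"
  define s where "s = 3/2 * beta4 - pi / 4 * lambda3"
  have "(G has_sum s) (UNIV \<times> UNIV)"
    using euler_double_sum by (simp add: G_def s_def)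
  then have G: "((\<lambda>(n, p). G (p, n)) has_sum s) (UNIV \<times> UNIV)"
    by (subst (asm) has_sum_swap)
  have row: "((\<lambda>p. G (p, n)) has_sum (euler_row n / (2 * odd_of n))) UNIV" for n
  proof -
    have s: "(\<lambda>p. G (p, n)) summable_on UNIV"
      using summable_on_SigmaD1[of "\<lambda>n p. G (p, n)" UNIV "\<lambda>_. UNIV" n] has_sum_imp_summable[OF G] by simp
    have "(\<lambda>p. 2 * (-1) ^ p / (odd_of p ^ 2 * (odd_of p + odd_of n))) sums euler_row n"
      unfolding euler_row_def by (rule summable_sums[OF summable_rabs_cancel[OF summable_euler_row]])
    from sums_divide[OF this, of "2 * odd_of n"]
    have "(\<lambda>p. G (p, n)) sums (euler_row n / (2 * odd_of n))"
      by (simp add: G_def mult_ac)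
    then show ?thesis
      by (rule has_sum_of_sums[OF s])
  qed
  have "((\<lambda>n. euler_row n / (2 * odd_of n)) has_sum s) UNIV"
    by (rule has_sum_SigmaD[OF G]) (use row in auto)
  from sums_mult[OF has_sum_imp_sums[OF this], of 4] show ?thesis
    by (simp add: s_def algebra_simps)
qed

lemma has_integral_euler_row:
  "((\<lambda>t. tan (t / 2) ^ (1 + 2 * k) * (phi_int t / sin t)) has_integral euler_row k) {0..pi / 2}"
proof -
  define c where "c p = 2 * (-1) ^ p / (odd_of p ^ 2 * (odd_of p + odd_of k))" for p
  have b: "\<bar>c p\<bar> \<le> 2" for p
  proof -
    have "1 \<le> odd_of p ^ 2 * (odd_of p + odd_of k)"
      using mult_mono[of 1 "odd_of p ^ 2" 1 "odd_of p + odd_of k"] odd_of_pos(2)[of p] odd_of_pos(4)[of k]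
      by (simp add: one_le_power)
    then show ?thesis
      by (simp add: c_def abs_mult power_abs divide_le_eq)
  qed
  \<comment> \<open>A primitive in x = tan(t/2) of 2 x^(2k) Ti_2(x); because dx/dt = x/sin t,
    composing with tan(t/2) gives exactly the integrand.\<close>
  define A where "A x = (\<Sum>p. c p * x ^ (2 * k + 2 + 2 * p))" for x
  have "((\<lambda>t. tan (t / 2) ^ (1 + 2 * k) * (phi_int t / sin t)) has_integral
      (A (tan (pi / 2 / 2)) - A (tan (0 / 2)))) {0..pi / 2}"
  proof (rule fundamental_theorem_of_calculus_interior)
    have "continuous_on {0..1} A"
      unfolding A_def
      by (rule continuous_on_subset[OF continuous_on_sparse_powser])
         (use summable_euler_row[of k] in \<open>auto simp: c_def\<close>)
    then show "continuous_on {0..pi / 2} (\<lambda>t. A (tan (t / 2)))"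
      by (rule continuous_on_compose2[OF _ half_tan_continuous]) (use half_tan_range in auto)
    fix t assume "t \<in> {0<..<pi / 2}"
    then have t: "0 < t" "t < pi / 2"
      by auto
    define x where "x = tan (t / 2)"
    note ht = half_tan[OF t, folded x_def]
    have x1: "\<bar>x\<bar> < 1"
      using ht(1,2) by simp
    note powser = DERIV_sparse_powser[where c = c and p = "2 * k + 2", OF b x1]
    let ?d = "\<lambda>p. c p * (real (2 * k + 2 + 2 * p) * x ^ (2 * k + 2 + 2 * p - 1))"
    have d: "?d p = 2 * x ^ (2 * k) * ((-1) ^ p / odd_of p ^ 2 * x ^ (1 + 2 * p))" for p
    proof -
      have "real (2 * k + 2 + 2 * p) = odd_of p + odd_of k"
        by (simp add: odd_of_def)
      moreover have "x ^ (2 * k + 2 + 2 * p - 1) = x ^ (2 * k) * x ^ (1 + 2 * p)"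
        unfolding power_add[symmetric] by (rule arg_cong[of _ _ "\<lambda>n. x ^ n"]) simp
      ultimately have "?d p = (c p * (odd_of p + odd_of k)) * (x ^ (2 * k) * x ^ (1 + 2 * p))"
        by (simp only: mult.assoc)
      also have "c p * (odd_of p + odd_of k) = 2 * (-1) ^ p / odd_of p ^ 2"
        by (simp add: c_def)
      finally show ?thesis
        by (simp only: times_divide_eq_left times_divide_eq_right mult_ac)
    qed
    have "summable (\<lambda>p. (-1) ^ p / odd_of p ^ 2 * x ^ (1 + 2 * p))"
      by (rule DERIV_sparse_powser(1)[OF _ x1, where C = 1]) (simp add: power_abs divide_le_eq one_le_power)
    then have "suminf ?d = 2 * x ^ (2 * k) * inv_tan_integral x"
      unfolding d inv_tan_integral_def by (rule suminf_mult)
    with powser(2) have "(A has_real_derivative (2 * x ^ (2 * k) * inv_tan_integral x)) (at x)"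
      by (simp only: A_def [abs_def])
    then have "(A has_real_derivative (2 * x ^ (2 * k) * inv_tan_integral x)) (at (tan (t / 2)))"
      by (simp only: x_def)
    from DERIV_chain2[where g = "\<lambda>t. tan (t / 2)", OF this ht(4)]
    have "((\<lambda>t. A (tan (t / 2))) has_real_derivative (2 * x ^ (2 * k) * inv_tan_integral x * ((1 + x ^ 2) / 2))) (at t)"
      by (simp add: x_def)
    also have "2 * x ^ (2 * k) * inv_tan_integral x * ((1 + x ^ 2) / 2) = tan (t / 2) ^ (1 + 2 * k) * (phi_int t / sin t)"
    proof -
      have "1 + x ^ 2 > 0"
        by (simp add: add_pos_nonneg)
      then show ?thesis
        using ht(1) unfolding ht(3) phi_int_def x_def[symmetric] by (simp add: field_simps)
    qed
    finally show "((\<lambda>t. A (tan (t / 2))) has_vector_derivative tan (t / 2) ^ (1 + 2 * k) * (phi_int t / sin t)) (at t)"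
      by (simp add: has_real_derivative_iff_has_vector_derivative)
  qed simp
  moreover have "A (tan (pi / 2 / 2)) = euler_row k"
    by (simp add: A_def c_def euler_row_def tan_45)
  moreover have "A (tan (0 / 2)) = 0"
    by (simp add: A_def)
  ultimately show ?thesis
    by simp
qed

lemma phi_int_nonneg:
  assumes "0 < t" "t < pi / 2"
  shows "phi_int t \<ge> 0"
proof -
  have "(\<lambda>n. sin_odd n / odd_of n * sin t ^ (1 + 2 * n)) sums phi_int t"
    by (rule phi_int_sums) (use assms in auto)
  then show ?thesis
    by (rule sums_le[OF _ sums_zero, rotated]) (use sin_bounds_Ioo[OF assms] in auto)
qed

text \<open>Only the artanh factor is expanded, since its terms are nonnegative; the alternating
  series of \<open>phi_int\<close> stays summed inside \<open>euler_row\<close>.\<close>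

lemma has_integral_artanh_phi_int:
  "((\<lambda>t. artanh (sin t) * (phi_int t / sin t)) has_integral (6 * beta4 - pi * lambda3)) {0<..<pi / 2}"
proof (rule has_integral_nonneg_series[OF _ _ _ euler_row_sums])
  show "((\<lambda>t. 2 / odd_of k * (tan (t / 2) ^ (1 + 2 * k) * (phi_int t / sin t))) has_integral
      (2 / odd_of k * euler_row k)) {0<..<pi / 2}" for k
    using has_integral_mult_right[OF has_integral_euler_row[of k], of "2 / odd_of k"]
    by (simp add: has_integral_Icc_iff_Ioo)
  fix t :: real assume "t \<in> {0<..<pi / 2}"
  then have t: "0 < t" "t < pi / 2"
    by auto
  note ht = half_tan[OF t]
  show "2 / odd_of k * (tan (t / 2) ^ (1 + 2 * k) * (phi_int t / sin t)) \<ge> 0" for k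
    using ht(1) sin_bounds_Ioo(1)[OF t] phi_int_nonneg[OF t]
    by (intro mult_nonneg_nonneg divide_nonneg_nonneg zero_le_power) auto
  have "(\<lambda>k. tan (t / 2) ^ (1 + 2 * k) / odd_of k) sums artanh (tan (t / 2))"
    by (rule artanh_sums) (use ht in auto)
  from sums_mult[OF this, of "2 * (phi_int t / sin t)"]
  show "(\<lambda>k. 2 / odd_of k * (tan (t / 2) ^ (1 + 2 * k) * (phi_int t / sin t))) sums
      (artanh (sin t) * (phi_int t / sin t))"
    unfolding artanh_sin_eq_half_tan[OF t] by (simp add: mult_ac)
qed

text \<open>The same integral, now with \<open>phi_int\<close> expanded in powers of sin t, where
  its coefficients are positive.\<close>

lemma log_moment_sums_1: "(\<lambda>m. sin_odd m / odd_of m * log_moment m) sums (6 * beta4 - pi * lambda3)"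
proof (rule sums_of_has_integral_nonneg_series[OF _ _ _ has_integral_artanh_phi_int])
  show "((\<lambda>t. sin_odd m / odd_of m * (sin t ^ (2 * m) * artanh (sin t))) has_integral
      (sin_odd m / odd_of m * log_moment m)) {0<..<pi / 2}" for m
    using has_integral_mult_right[OF has_integral_log_moment[of m], of "sin_odd m / odd_of m"]
    by (simp add: has_integral_Icc_iff_Ioo)
  fix t :: real assume "t \<in> {0<..<pi / 2}"
  then have t: "0 < t" "t < pi / 2"
    by auto
  show "sin_odd m / odd_of m * (sin t ^ (2 * m) * artanh (sin t)) \<ge> 0" for m
    using artanh_sin_nonneg[of t] t by (intro mult_nonneg_nonneg) auto
  have "(\<lambda>m. sin_odd m / odd_of m * sin t ^ (1 + 2 * m)) sums phi_int t"
    by (rule phi_int_sums) (use t in auto)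
  from sums_mult[OF this, of "artanh (sin t) / sin t"]
  show "(\<lambda>m. sin_odd m / odd_of m * (sin t ^ (2 * m) * artanh (sin t))) sums
      (artanh (sin t) * (phi_int t / sin t))"
    using sin_bounds_Ioo(1)[OF t] by (simp add: mult_ac)
qed

section \<open>The second integral by a damped Fourier series\<close>

lemma artanh_mono_real:
  assumes "-1 < x" "x \<le> y" "y < (1::real)"
  shows "artanh x \<le> artanh y"
proof -
  have "(1 + x) / (1 - x) \<le> (1 + y) / (1 - y)"
    using assms by (intro frac_le) auto
  then show ?thesis
    using assms by (simp add: artanh_def)
qed

text \<open>Abel damping of artanh(sin t), recovered as r tends to 1; for r < 1 its Fourier series
  converges uniformly in t.\<close>

definition damped_artanh :: "real \<Rightarrow> real \<Rightarrow> real" where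
  "damped_artanh r t = artanh (2 * r / (1 + r ^ 2) * sin t)"

text \<open>This is \<open>2 Im (Arctan (r e\<^sup>i\<^sup>t))\<close>, so the Taylor series of the arctangent is a Fourier series in \<open>t\<close>.\<close>

lemma damped_artanh_sums:
  assumes r: "0 < r" "r < 1"
  shows "(\<lambda>k. 2 * ((-1) ^ k / odd_of k) * r ^ (2 * k + 1) * sin (odd_of k * t)) sums damped_artanh r t"
proof -
  define z where "z = of_real r * cis t"
  have nz: "norm z < 1"
    using r by (simp add: z_def norm_mult)
  have "(\<lambda>n. Im ((-1) ^ n / of_nat (2 * n + 1) * z ^ (2 * n + 1))) sums Im (Arctan z)"
    by (intro sums_Im Arctan_series(2) nz)
  moreover have "Im ((-1) ^ n / of_nat (2 * n + 1) * z ^ (2 * n + 1)) =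
      (-1) ^ n / odd_of n * r ^ (2 * n + 1) * sin (odd_of n * t)" for n
  proof -
    have "cis t ^ (2 * n + 1) = cis (odd_of n * t)"
      by (simp only: Complex.DeMoivre) (simp add: odd_of_def add.commute)
    then have "z ^ (2 * n + 1) = of_real (r ^ (2 * n + 1)) * cis (odd_of n * t)"
      by (simp only: z_def power_mult_distrib of_real_power)
    moreover have "(-1) ^ n / of_nat (2 * n + 1) = complex_of_real ((-1) ^ n / odd_of n)"
      by (simp add: odd_of_def add.commute)
    ultimately have "(-1) ^ n / of_nat (2 * n + 1) * z ^ (2 * n + 1) =
        complex_of_real ((-1) ^ n / odd_of n * r ^ (2 * n + 1)) * cis (odd_of n * t)"
      by (simp only: of_real_mult mult.assoc)
    then show ?thesis
      by (simp only: times_complex.sel Im_complex_of_real Re_complex_of_real cis.sel mult_zero_left add_0_right)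
  qed
  ultimately have s: "(\<lambda>n. (-1) ^ n / odd_of n * r ^ (2 * n + 1) * sin (odd_of n * t)) sums Im (Arctan z)"
    by simp
  have c1: "cmod (1 - \<i> * z) ^ 2 = 1 + r ^ 2 + 2 * r * sin t"
  proof -
    have "cmod (1 - \<i> * z) ^ 2 = (1 + r * sin t) ^ 2 + (r * cos t) ^ 2"
      unfolding cmod_power2 by (simp add: z_def)
    also have "\<dots> = 1 + r ^ 2 * (sin t ^ 2 + cos t ^ 2) + 2 * r * sin t"
      by algebra
    finally show ?thesis by simp
  qed
  have c2: "cmod (1 + \<i> * z) ^ 2 = 1 + r ^ 2 - 2 * r * sin t"
  proof -
    have "cmod (1 + \<i> * z) ^ 2 = (1 - r * sin t) ^ 2 + (r * cos t) ^ 2"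
      unfolding cmod_power2 by (simp add: z_def)
    also have "\<dots> = 1 + r ^ 2 * (sin t ^ 2 + cos t ^ 2) - 2 * r * sin t"
      by algebra
    finally show ?thesis by simp
  qed
  have nz': "1 - \<i> * z \<noteq> 0" "1 + \<i> * z \<noteq> 0"
  proof -
    have "norm (\<i> * z) < 1"
      using nz by (simp add: norm_mult)
    then show "1 - \<i> * z \<noteq> 0" "1 + \<i> * z \<noteq> 0"
      by (auto simp: add_eq_0_iff2 dest: arg_cong[of _ _ norm])
  qed
  have p: "cmod (1 - \<i> * z) > 0" "cmod (1 + \<i> * z) > 0"
    using nz' by auto
  have "2 * Im (Arctan z) = ln (cmod ((1 - \<i> * z) / (1 + \<i> * z)))"
    using nz' by (simp add: Arctan_def)
  also have "\<dots> = ln ((cmod (1 - \<i> * z) / cmod (1 + \<i> * z)) ^ 2) / 2"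
    using p by (simp add: norm_divide ln_realpow)
  also have "(cmod (1 - \<i> * z) / cmod (1 + \<i> * z)) ^ 2 = (1 + r ^ 2 + 2 * r * sin t) / (1 + r ^ 2 - 2 * r * sin t)"
    by (simp add: power_divide c1 c2)
  also have "\<dots> = (1 + 2 * r / (1 + r ^ 2) * sin t) / (1 - 2 * r / (1 + r ^ 2) * sin t)"
  proof -
    define y where "y = 2 * r / (1 + r ^ 2) * sin t"
    have q: "1 + r ^ 2 > 0"
      by (simp add: add_pos_nonneg)
    have e: "(1 + y) * (1 + r ^ 2) = 1 + r ^ 2 + 2 * r * sin t" "(1 - y) * (1 + r ^ 2) = 1 + r ^ 2 - 2 * r * sin t"
      unfolding distrib_right left_diff_distrib y_def using q by simp_all
    have "(1 + y) * (1 + r ^ 2) / ((1 - y) * (1 + r ^ 2)) = (1 + y) / (1 - y)"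
      using q by simp
    then show ?thesis
      by (simp only: e) (simp only: y_def)
  qed
  finally have "2 * Im (Arctan z) = damped_artanh r t"
    by (simp add: damped_artanh_def artanh_def)
  with sums_mult[OF s, of 2] show ?thesis
    by (simp add: mult_ac)
qed

lemma sin_cos_odd_pi_half: "sin (odd_of k * (pi / 2)) = (-1) ^ k" "cos (odd_of k * (pi / 2)) = 0"
proof -
  have e: "odd_of k * (pi / 2) = real k * pi + pi / 2"
    by (simp add: odd_of_def algebra_simps)
  show "sin (odd_of k * (pi / 2)) = (-1) ^ k" "cos (odd_of k * (pi / 2)) = 0"
    unfolding e sin_add cos_add cos_npi sin_npi by simp_all
qed

lemma has_integral_square_sin:
  "((\<lambda>t. t ^ 2 * sin (odd_of k * t)) has_integral (pi * (-1) ^ k / odd_of k ^ 2 - 2 / odd_of k ^ 3)) {0..pi / 2}"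
proof -
  define n where "n = odd_of k"
  have n: "n \<noteq> 0"
    by (simp add: n_def)
  define f where "f t = - (t ^ 2 * cos (n * t) / n) + 2 * t * sin (n * t) / n ^ 2 + 2 * cos (n * t) / n ^ 3" for t
  have "((\<lambda>t. t ^ 2 * sin (n * t)) has_integral (f (pi / 2) - f 0)) {0..pi / 2}"
  proof (rule fundamental_theorem_of_calculus)
    fix t :: real
    have "(f has_real_derivative (- ((2 * t * cos (n * t) - t ^ 2 * (sin (n * t) * n)) / n)
        + (2 * sin (n * t) + 2 * t * (cos (n * t) * n)) / n ^ 2 - 2 * (sin (n * t) * n) / n ^ 3)) (at t within {0..pi / 2})"
      unfolding f_def using n by (auto intro!: derivative_eq_intros simp: field_simps)
    also have "- ((2 * t * cos (n * t) - t ^ 2 * (sin (n * t) * n)) / n)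
        + (2 * sin (n * t) + 2 * t * (cos (n * t) * n)) / n ^ 2 - 2 * (sin (n * t) * n) / n ^ 3 = t ^ 2 * sin (n * t)"
      using n by (simp add: field_simps power2_eq_square power3_eq_cube)
    finally show "(f has_vector_derivative t ^ 2 * sin (n * t)) (at t within {0..pi / 2})"
      by (simp add: has_real_derivative_iff_has_vector_derivative)
  qed simp
  moreover have "f (pi / 2) - f 0 = pi * (-1) ^ k / n ^ 2 - 2 / n ^ 3"
    unfolding f_def using sin_cos_odd_pi_half[of k, folded n_def] by simp
  ultimately show ?thesis
    by (simp add: n_def)
qed

text \<open>\<open>(-1) ^ k / odd_of k\<close> times the integral of t^2 sin((2k + 1)t) over
  [0, pi/2].\<close>

definition damped_coeff :: "nat \<Rightarrow> real" where
  "damped_coeff k = pi * (1 / odd_of k ^ 3) - 2 * ((-1) ^ k / odd_of k ^ 4)"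

lemma has_integral_damped_artanh:
  assumes r: "0 < r" "r < 1"
  shows "((\<lambda>t. t ^ 2 / 2 * damped_artanh r t) has_integral (\<Sum>k. damped_coeff k * r ^ (1 + 2 * k))) {0..pi / 2}"
proof -
  define f where "f k t = t ^ 2 / 2 * (2 * ((-1) ^ k / odd_of k) * r ^ (2 * k + 1) * sin (odd_of k * t))" for k t
  have f: "(f k has_integral (damped_coeff k * r ^ (1 + 2 * k))) {0..pi / 2}" for k
  proof -
    have "((\<lambda>t. (-1) ^ k / odd_of k * r ^ (1 + 2 * k) * (t ^ 2 * sin (odd_of k * t))) has_integral
        ((-1) ^ k / odd_of k * r ^ (1 + 2 * k) * (pi * (-1) ^ k / odd_of k ^ 2 - 2 / odd_of k ^ 3))) {0..pi / 2}"
      by (intro has_integral_mult_right has_integral_square_sin)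
    moreover have "(-1) ^ k / odd_of k * r ^ (1 + 2 * k) * (pi * (-1) ^ k / odd_of k ^ 2 - 2 / odd_of k ^ 3)
        = damped_coeff k * r ^ (1 + 2 * k)"
    proof -
      have "(-1) ^ k / odd_of k * (pi * (-1) ^ k / odd_of k ^ 2 - 2 / odd_of k ^ 3) = damped_coeff k"
        by (simp add: damped_coeff_def right_diff_distrib eval_nat_numeral mult_ac flip: power_mult_distrib)
      moreover have "(-1) ^ k / odd_of k * r ^ (1 + 2 * k) * (pi * (-1) ^ k / odd_of k ^ 2 - 2 / odd_of k ^ 3)
          = (-1) ^ k / odd_of k * (pi * (-1) ^ k / odd_of k ^ 2 - 2 / odd_of k ^ 3) * r ^ (1 + 2 * k)"
        by (simp only: mult_ac)
      ultimately show ?thesis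
        by (simp only:)
    qed
    moreover have "(\<lambda>t. (-1) ^ k / odd_of k * r ^ (1 + 2 * k) * (t ^ 2 * sin (odd_of k * t))) = f k"
      by (simp add: f_def fun_eq_iff)
    ultimately show ?thesis by simp
  qed
  have "uniform_limit {0..pi / 2} (\<lambda>n t. \<Sum>k<n. f k t) (\<lambda>t. \<Sum>k. f k t) sequentially"
  proof (rule Weierstrass_m_test)
    show "summable (\<lambda>k. (pi / 2) ^ 2 * r ^ k)"
      using r by (intro summable_mult summable_geometric) auto
    fix k and t :: real assume t: "t \<in> {0..pi / 2}"
    have "norm (f k t) = t ^ 2 * (1 / odd_of k) * r ^ (2 * k + 1) * \<bar>sin (odd_of k * t)\<bar>"
      using r by (simp add: f_def abs_mult power_abs)
    also have "\<dots> \<le> (pi / 2) ^ 2 * 1 * r ^ k * 1"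
      using r t by (intro mult_mono power_mono power_decreasing) (auto simp: divide_le_eq)
    finally show "norm (f k t) \<le> (pi / 2) ^ 2 * r ^ k"
      by simp
  qed
  then obtain I J where I: "\<And>n. ((\<lambda>t. \<Sum>k<n. f k t) has_integral I n) {0..pi / 2}"
    and J: "((\<lambda>t. \<Sum>k. f k t) has_integral J) {0..pi / 2}" and IJ: "I \<longlonglongrightarrow> J"
    by (rule uniform_limit_integral) (auto simp: f_def intro!: continuous_intros)
  have "I n = (\<Sum>k<n. damped_coeff k * r ^ (1 + 2 * k))" for n
    by (rule has_integral_unique[OF I]) (intro has_integral_sum f, simp)
  then have "I = (\<lambda>n. \<Sum>k<n. damped_coeff k * r ^ (1 + 2 * k))"
    by (rule ext)
  with IJ have "(\<lambda>k. damped_coeff k * r ^ (1 + 2 * k)) sums J"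
    by (simp only: sums_def)
  then have "J = (\<Sum>k. damped_coeff k * r ^ (1 + 2 * k))"
    by (rule sums_unique)
  moreover have "(\<Sum>k. f k t) = t ^ 2 / 2 * damped_artanh r t" for t
    unfolding f_def using sums_mult[OF damped_artanh_sums[OF r]] by (rule sums_unique[symmetric])
  ultimately show ?thesis
    using J by (simp only:)
qed

text \<open>The Fourier terms change sign, so monotone convergence is applied in r instead of k: the
  integrands increase with r, and the integrals converge by continuity at 1 of an absolutely
  convergent power series.\<close>

lemma has_integral_square_artanh_sin:
  "((\<lambda>t. t ^ 2 / 2 * artanh (sin t)) has_integral (pi * lambda3 - 2 * beta4)) {0<..<pi / 2}"
proof -
  define r where "r j = 1 - 1 / (real j + 2)" for j :: nat
  define \<kappa> where "\<kappa> x = 2 * x / (1 + x ^ 2)" for x :: real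
  have r: "0 < r j" "r j < 1" for j
    by (auto simp: r_def)
  have r_lim: "r \<longlonglongrightarrow> 1"
    unfolding r_def by real_asymp
  have \<kappa>_mono: "\<kappa> x \<le> \<kappa> y" if "0 \<le> x" "x \<le> y" "y \<le> 1" for x y
  proof -
    \<comment> \<open>Monotonicity of 2x/(1 + x^2) on [0,1] rests on y(1 + x^2) - x(1 + y^2) = (y -
      x)(1 - x y).\<close>
    have "x * y \<le> 1"
      using mult_mono[of x 1 y 1] that by simp
    then have "0 \<le> (y - x) * (1 - x * y)"
      using that by simp
    then have "2 * x * (1 + y ^ 2) \<le> 2 * y * (1 + x ^ 2)"
      by (simp add: power2_eq_square algebra_simps)
    then show ?thesis
      unfolding \<kappa>_def by (subst frac_le_eq) (auto simp: add_pos_nonneg divide_le_0_iff sum_power2_eq_zero_iff add_nonneg_eq_0_iff)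
  qed
  have \<kappa>: "0 \<le> \<kappa> (r j)" "\<kappa> (r j) \<le> 1" for j
    using \<kappa>_mono[of 0 "r j"] \<kappa>_mono[of "r j" 1] r[of j] by (auto simp: \<kappa>_def)
  show ?thesis
  proof (rule has_integral_monotone_convergence_increasing)
    show "((\<lambda>t. t ^ 2 / 2 * damped_artanh (r j) t) has_integral (\<Sum>k. damped_coeff k * r j ^ (1 + 2 * k))) {0<..<pi / 2}" for j
      using has_integral_damped_artanh[OF r] by (simp add: has_integral_Icc_iff_Ioo)
    fix t :: real assume "t \<in> {0<..<pi / 2}"
    then have t: "0 < t" "t < pi / 2"
      by auto
    note s = sin_bounds_Ioo[OF t]
    show "t ^ 2 / 2 * damped_artanh (r j) t \<le> t ^ 2 / 2 * damped_artanh (r (Suc j)) t" for j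
    proof -
      have "r j \<le> r (Suc j)"
        by (simp add: r_def frac_le)
      then have "\<kappa> (r j) \<le> \<kappa> (r (Suc j))"
        using r[of j] r[of "Suc j"] by (intro \<kappa>_mono) auto
      then have "\<kappa> (r j) * sin t \<le> \<kappa> (r (Suc j)) * sin t"
        using s by (intro mult_right_mono) auto
      moreover have "0 \<le> \<kappa> (r j) * sin t"
        using \<kappa> s by simp
      moreover have "\<kappa> (r (Suc j)) * sin t \<le> 1 * sin t"
        using \<kappa> s by (intro mult_right_mono) auto
      ultimately have "-1 < \<kappa> (r j) * sin t" "\<kappa> (r j) * sin t \<le> \<kappa> (r (Suc j)) * sin t"
        "\<kappa> (r (Suc j)) * sin t < 1"
        using s by linarith+
      then have "damped_artanh (r j) t \<le> damped_artanh (r (Suc j)) t"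
        unfolding damped_artanh_def \<kappa>_def[symmetric] by (rule artanh_mono_real)
      then show ?thesis
        by (intro mult_left_mono) auto
    qed
    have "(\<lambda>j. \<kappa> (r j) * sin t) \<longlonglongrightarrow> 2 * 1 / (1 + 1 ^ 2) * sin t"
      unfolding \<kappa>_def by (intro tendsto_intros r_lim) auto
    then have "(\<lambda>j. \<kappa> (r j) * sin t) \<longlonglongrightarrow> sin t"
      by simp
    then have "(\<lambda>j. artanh (\<kappa> (r j) * sin t)) \<longlonglongrightarrow> artanh (sin t)"
      by (rule isCont_tendsto_compose[rotated]) (rule DERIV_isCont[OF artanh_real_has_field_derivative[OF s(4)]])
    then show "(\<lambda>j. t ^ 2 / 2 * damped_artanh (r j) t) \<longlonglongrightarrow> t ^ 2 / 2 * artanh (sin t)"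
      unfolding damped_artanh_def \<kappa>_def by (rule tendsto_mult_left)
  next
    have "summable (\<lambda>k. \<bar>damped_coeff k\<bar>)"
    proof (rule summable_comparison_test')
      show "summable (\<lambda>k. pi * (1 / odd_of k ^ 3) + 2 * (1 / odd_of k ^ 4))"
        by (intro summable_add summable_mult summable_odd_of_power) auto
      show "norm \<bar>damped_coeff k\<bar> \<le> pi * (1 / odd_of k ^ 3) + 2 * (1 / odd_of k ^ 4)" for k
        unfolding damped_coeff_def
        using abs_triangle_ineq4[of "pi * (1 / odd_of k ^ 3)" "2 * ((-1) ^ k / odd_of k ^ 4)"]
        by (simp add: abs_mult power_abs)
    qed
    then have "continuous_on {-1..1} (\<lambda>x. \<Sum>k. damped_coeff k * x ^ (1 + 2 * k))"
      by (rule continuous_on_sparse_powser)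
    then have "(\<lambda>j. \<Sum>k. damped_coeff k * r j ^ (1 + 2 * k)) \<longlonglongrightarrow> (\<Sum>k. damped_coeff k * 1 ^ (1 + 2 * k))"
      by (rule continuous_on_tendsto_compose[OF _ r_lim]) (use r in \<open>auto intro!: always_eventually simp: less_imp_le intro: order.trans[of _ 0]\<close>)
    moreover have "damped_coeff sums (pi * lambda3 - 2 * beta4)"
      unfolding damped_coeff_def [abs_def] by (intro sums_diff sums_mult lambda3_sums beta4_sums)
    ultimately show "(\<lambda>j. \<Sum>k. damped_coeff k * r j ^ (1 + 2 * k)) \<longlonglongrightarrow> pi * lambda3 - 2 * beta4"
      by (simp add: sums_unique[symmetric])
  qed
qed

lemma log_moment_sums_2:
  "(\<lambda>m. sin_odd m / real (2 * m + 2) * log_moment (Suc m)) sums (pi * lambda3 - 2 * beta4)"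
proof (rule sums_of_has_integral_nonneg_series[OF _ _ _ has_integral_square_artanh_sin])
  show "((\<lambda>t. sin_odd m / real (2 * m + 2) * (sin t ^ (2 * Suc m) * artanh (sin t))) has_integral
      (sin_odd m / real (2 * m + 2) * log_moment (Suc m))) {0<..<pi / 2}" for m
    using has_integral_mult_right[OF has_integral_log_moment[of "Suc m"], of "sin_odd m / real (2 * m + 2)"]
    by (simp only: has_integral_Icc_iff_Ioo)
  fix t :: real assume "t \<in> {0<..<pi / 2}"
  then have t: "0 < t" "t < pi / 2"
    by auto
  show "sin_odd m / real (2 * m + 2) * (sin t ^ (2 * Suc m) * artanh (sin t)) \<ge> 0" for m
    using artanh_sin_nonneg[of t] sin_bounds_Ioo(1)[OF t] t
    by (intro mult_nonneg_nonneg divide_nonneg_nonneg zero_le_power) auto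
  have "(\<lambda>m. sin_odd m / real (2 + 2 * m) * sin t ^ (2 + 2 * m)) sums (t ^ 2 / 2)"
    by (rule arcsin_square_sums) (use t in auto)
  from sums_mult[OF this, of "artanh (sin t)"]
  show "(\<lambda>m. sin_odd m / real (2 * m + 2) * (sin t ^ (2 * Suc m) * artanh (sin t))) sums
      (t ^ 2 / 2 * artanh (sin t))"
    by (simp add: mult_ac add.commute)
qed

section \<open>Values of the two double hypergeometric series\<close>

lemma pochhammer_half_ratio: "pochhammer (1/2) k / pochhammer (3/2) k = 1 / odd_of k"
  using sin_odd_mult_even[of k] by (simp add: sin_odd_def sin_even_def)

lemma pochhammer_three_half_ratio: "pochhammer (3/2) k / pochhammer (5/2) k = 3 / odd_of (Suc k)"
proof -
  have "pochhammer (3/2) k * odd_of (Suc k) = 3 * pochhammer (5/2 :: real) k"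
  proof (induction k)
    case (Suc k)
    have "pochhammer (3/2) (Suc k) * odd_of (Suc (Suc k)) = (pochhammer (3/2) k * odd_of (Suc k)) * (5/2 + real k)"
      by (simp add: pochhammer_Suc odd_of_def algebra_simps)
    then show ?case
      unfolding Suc.IH by (simp add: pochhammer_Suc)
  qed (simp add: odd_of_def)
  moreover have "pochhammer (5/2 :: real) k > 0"
    by (rule pochhammer_pos) simp
  ultimately show ?thesis
    by (simp add: field_simps)
qed

lemma has_sum_moment_pairs:
  assumes "\<And>m. (\<lambda>n. F (m, n)) sums g m" and "g sums S" and "\<And>m n. F (m, n) \<ge> (0 :: real)"
  shows "(F has_sum S) (UNIV :: (nat \<times> nat) set)"
proof -
  have g0: "g m \<ge> 0" for m
    by (rule sums_le[OF _ sums_zero assms(1)[of m]]) (rule assms)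
  have row: "((\<lambda>n. F (m, n)) has_sum g m) UNIV" for m
    by (rule sums_nonneg_imp_has_sum) (use assms in auto)
  have g: "(g has_sum S) UNIV"
    by (rule sums_nonneg_imp_has_sum) (use assms g0 in auto)
  have "F summable_on UNIV \<times> UNIV"
    by (rule summable_on_SigmaI[OF row has_sum_imp_summable[OF g]]) (rule assms)
  from has_sum_SigmaI[OF row g this] show ?thesis
    by simp
qed

text \<open>The term is W_m^2 V_n^2/(2m + 2n + 1). Summing over n produces a factor V_m, and W_m V_m
  = 1/(2m + 1) leaves a single W_m.\<close>

lemma kampe_de_feriet_1:
  "kampe_de_feriet [1/2] [3/2] [1,1,1] [3/2,3/2] [1/2,1/2] [1] 1 1 = 2 / pi * (6 * beta4 - pi * lambda3)"
proof -
  define F where "F = (\<lambda>(m, n). sin_odd m ^ 2 * (sin_even n ^ 2 / odd_of (m + n)))"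
  have F: "(F has_sum (2 / pi * (6 * beta4 - pi * lambda3))) UNIV"
  proof (rule has_sum_moment_pairs)
    show "(\<lambda>n. F (m, n)) sums (sin_odd m ^ 2 * elliptic_moment m)" for m
      unfolding F_def prod.case by (intro sums_mult elliptic_moment_sums)
    have "sin_odd m ^ 2 * elliptic_moment m = 2 / pi * (sin_odd m / odd_of m * log_moment m)" for m
    proof -
      have "sin_odd m ^ 2 * elliptic_moment m =
          2 / pi * (sin_odd m * (sin_odd m * sin_even m) * log_moment m)"
        by (simp add: elliptic_moment_eq power2_eq_square)
      then show ?thesis
        by (simp add: sin_odd_mult_even)
    qed
    then show "(\<lambda>m. sin_odd m ^ 2 * elliptic_moment m) sums (2 / pi * (6 * beta4 - pi * lambda3))"
      by (simp only: sums_mult log_moment_sums_1)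
  qed (simp add: F_def)
  have eq: "F (m, n) = sin_odd m ^ 2 * sin_even n ^ 2 * (pochhammer (1/2) (m + n) / pochhammer (3/2) (m + n))" for m n
    unfolding pochhammer_half_ratio F_def by simp
  have "kampe_de_feriet [1/2] [3/2] [1,1,1] [3/2,3/2] [1/2,1/2] [1] 1 1 = infsum F UNIV"
    unfolding kampe_de_feriet_def
    by (intro infsum_cong)
       (auto simp: eq sin_odd_def sin_even_def power2_eq_square pochhammer_fact[symmetric] mult_ac)
  then show ?thesis
    using infsumI[OF F] by simp
qed

text \<open>The ratio (3/2)_k/(5/2)_k = 3/(2k + 3) supplies the factor 3 and moves the inner moment
  to m + 1, where W_m V_(m+1) = 1/(2m + 2).\<close>

lemma kampe_de_feriet_2:
  "kampe_de_feriet [3/2] [5/2] [1,1,1] [3/2,3/2] [1/2,1/2] [1] 1 1 = 6 / pi * (pi * lambda3 - 2 * beta4)"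
proof -
  define F where "F = (\<lambda>(m, n). 3 * sin_odd m ^ 2 * (sin_even n ^ 2 / odd_of (Suc m + n)))"
  have F: "(F has_sum (6 / pi * (pi * lambda3 - 2 * beta4))) UNIV"
  proof (rule has_sum_moment_pairs)
    show "(\<lambda>n. F (m, n)) sums (3 * sin_odd m ^ 2 * elliptic_moment (Suc m))" for m
      unfolding F_def prod.case by (intro sums_mult elliptic_moment_sums)
    have "3 * sin_odd m ^ 2 * elliptic_moment (Suc m) =
        6 / pi * (sin_odd m / real (2 * m + 2) * log_moment (Suc m))" for m
    proof -
      have "real (2 * m + 2) * (sin_odd m * sin_even (Suc m)) = odd_of m * (sin_odd m * sin_even m)"
      proof -
        have "odd_of m = real (2 * m + 1)"
          by (simp add: odd_of_def)
        with sin_even_Suc[of m] show ?thesis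
          by (simp only: mult.left_commute[of _ "sin_odd m"])
      qed
      also have "odd_of m * (sin_odd m * sin_even m) = 1"
        by (simp add: sin_odd_mult_even)
      finally have "(sin_odd m * sin_even (Suc m)) * real (2 * m + 2) = 1"
        by (simp only: mult.commute)
      then have "sin_odd m * sin_even (Suc m) = 1 / real (2 * m + 2)"
        by (rule eq_divide_imp[rotated]) simp
      moreover have "3 * sin_odd m ^ 2 * elliptic_moment (Suc m) =
          6 / pi * (sin_odd m * (sin_odd m * sin_even (Suc m)) * log_moment (Suc m))"
        by (simp add: elliptic_moment_eq power2_eq_square)
      ultimately show ?thesis
        by simp
    qed
    then show "(\<lambda>m. 3 * sin_odd m ^ 2 * elliptic_moment (Suc m)) sums (6 / pi * (pi * lambda3 - 2 * beta4))"
      by (simp only: sums_mult log_moment_sums_2)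
  qed (simp add: F_def)
  have eq: "F (m, n) = sin_odd m ^ 2 * sin_even n ^ 2 * (pochhammer (3/2) (m + n) / pochhammer (5/2) (m + n))" for m n
    unfolding pochhammer_three_half_ratio F_def by simp
  have "kampe_de_feriet [3/2] [5/2] [1,1,1] [3/2,3/2] [1/2,1/2] [1] 1 1 = infsum F UNIV"
    unfolding kampe_de_feriet_def
    by (intro infsum_cong)
       (auto simp: eq sin_odd_def sin_even_def power2_eq_square pochhammer_fact[symmetric] mult_ac)
  then show ?thesis
    using infsumI[OF F] by simp
qed

theorem theorem2:
  shows "Lf4 = pi ^ 3 / 288 *
     (3 * kampe_de_feriet [1/2] [3/2] [1,1,1] [3/2,3/2] [1/2,1/2] [1] 1 1
        + kampe_de_feriet [3/2] [5/2] [1,1,1] [3/2,3/2] [1/2,1/2] [1] 1 1)"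
proof -
  \<comment> \<open>\<open>lambda3\<close> drops out, and the prefactor turns 24/pi into the pi^2/12
    of \<open>Lf4_eq\<close>.\<close>
  have "3 * (2 / pi * (6 * beta4 - pi * lambda3)) + 6 / pi * (pi * lambda3 - 2 * beta4) = 24 / pi * beta4"
    by (simp add: field_simps)
  then show ?thesis
    unfolding Lf4_eq kampe_de_feriet_1 kampe_de_feriet_2 by (simp add: power2_eq_square power3_eq_cube)
qed

end
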